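(* Let $V$ be a real vector space of dimension $n\ge2$, $0\ne\mu\in\wedge^nV^*$, and let $\mathcal F_\mu(V)=\rho(\Gamma(\mathfrak{sl}(V)))$ be the singular foliation generated by the linear $\mathfrak{sl}(V)$-action. Consider the resolution $$0\to\Gamma(\wedge^nV^* )\xrightarrow{\,d_n\phi_n^{-1}\partial_n\,}\Gamma(K_{n-1})\xrightarrow{d_{n-1}}\cdots\xrightarrow{d_2}\Gamma(K_1)\xrightarrow{\rho_\mu}\mathcal F_\mu(V)\to0,$$ with $\Gamma(K_i)$ in degree $1-i$ and $\Gamma(\wedge^nV^* )$ in degree $1-n$. Define a binary operation as follows: on the spaces $\Gamma(K_i)$, $1\le i\le n-1$, it is the restriction of the Nijenhuis–Richardson type bracket on $\Gamma(\wedge^\bullet V^*\otimes V)$ given in the context (so it takes $\Gamma(K_{k_1})\times\Gamma(K_{k_2})$ to $\Gamma(K_{k_1+k_2-1})$ and is zero if $k_1+k_2-1\ge n$, since $K_n=0$); and for constant $X\in K_1=\mathfrak{sl}(V)$ one sets $[X,\mu]:=0\in\Gamma(\wedge^nV^* )$, extended by the Leibniz rule; brackets of $\Gamma(\wedge^nV^* )$ with elements of negative degree vanish. Then this binary operation, together with the differential of the resolution and the anchor $\rho_\mu$, is a dg-Lie algebroid structure on the resolution, which is a universal $L_\infty$-algebroid of $\mathcal F_\mu$ and is minimal at the origin.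
   Context: For a finite-dimensional real vector space $U$, $\Gamma(U)=C^\infty(V,U)$. Let $\{e_i\}$ be a basis of $V$ with linear coordinates $x^i$ (repeated indices summed). $d_k(\alpha\otimes v)=x^i\iota_{e_i}(\alpha)\otimes v$ on $\Gamma(\wedge^kV^*\otimes V)$; $\rho(\phi\otimes v)=\phi\,\partial_v$ on $\Gamma(V^*\otimes V)$; $\partial_k(\alpha)=-x^i\iota_{e_i}(\alpha)$ on $\Gamma(\wedge^kV^* )$; $\phi_k:\wedge^kV^*\otimes V\to\wedge^{k-1}V^*$, $\phi_k(\alpha\otimes v)=(-1)^{k-1}\iota_v\alpha$ (with $\phi_n$ an isomorphism), $K_k=\ker\phi_k$, $\rho_\mu=\rho|_{\Gamma(K_1)}$. Bracket: for $f_1,f_2\in C^\infty(V)$, $\psi_a\in\wedge^{k_a}V^*$, $w_a\in V$, $$[f_1\psi_1\otimes w_1,f_2\psi_2\otimes w_2]=f_1f_2\big(\psi_1\wedge\iota_{w_1}(\psi_2)\otimes w_2-(-1)^{(k_1-1)(k_2-1)}\psi_2\wedge\iota_{w_2}(\psi_1)\otimes w_1\big)+\delta_{k_1,1}f_1\,\rho(\psi_1\otimes w_1)(f_2)\,\psi_2\otimes w_2-\delta_{k_2,1}f_2\,\rho(\psi_2\otimes w_2)(f_1)\,\psi_1\otimes w_1 .$$ The Leibniz extension of $[X,\mu]=0$ is $[X,g\mu]=\rho_\mu(X)(g)\,\mu$ for $X\in\Gamma(K_1)$, $g\in C^\infty(V)$. A dg-Lie algebroid over $M$ is a graded vector bundle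 $E=\bigoplus_{i\le0}E_i$ with a $C^\infty(M)$-linear degree $1$ differential $d$ on $\Gamma(E)$, an anchor $\rho:E_0\to TM$ (extended by zero to $E_i$, $i<0$) with $\rho\circ d=0$, and a graded skew-symmetric degree $0$ bracket with $[a,fb]=f[a,b]+\rho(a)(f)b$, $\rho[a,b]=[\rho a,\rho b]$, $d[a,b]=[da,b]+(-1)^{|a|}[a,db]$, and the graded Jacobi identity. It is an $L_\infty$-algebroid with vanishing $k$-ary brackets for $k\ge3$. An $L_\infty$-algebroid is universal for a singular foliation $\mathcal F$ if its underlying complex together with the anchor $\Gamma(E_0)\to\mathcal F$ is a resolution of $\mathcal F$; it is minimal at a point if all the differentials (as vector bundle maps) vanish at that point. *)

theory Defs
  imports "HOL-Analysis.Analysis" "HOL-Library.Function_Algebras"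
begin

instantiation "fun" :: (type, real_vector) real_vector
begin

definition scaleR_fun :: "real \<Rightarrow> ('a \<Rightarrow> 'b) \<Rightarrow> 'a \<Rightarrow> 'b"
  where "scaleR_fun c f = (\<lambda>x. c *\<^sub>R f x)"

instance
  by standard (simp_all add: scaleR_fun_def fun_eq_iff scaleR_add_right scaleR_add_left)

end

lemma scaleR_fun_apply [simp]: "(c *\<^sub>R f) x = c *\<^sub>R f x"
  by (simp add: scaleR_fun_def)

lemma sum_fun_apply [simp]: "(\<Sum>i\<in>I. f i) x = (\<Sum>i\<in>I. f i x)"
  by (induction I rule: infinite_finite_induct) auto


section \<open>Smooth functions and sections of trivial bundles\<close>

primrec C_k :: "nat \<Rightarrow> ('a::euclidean_space \<Rightarrow> 'b::real_normed_vector) \<Rightarrow> bool" where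
  "C_k 0 f \<longleftrightarrow> continuous_on UNIV f"
| "C_k (Suc k) f \<longleftrightarrow>
     (\<forall>x. f differentiable (at x)) \<and> (\<forall>v. C_k k (\<lambda>x. frechet_derivative f (at x) v))"

definition smooth :: "('a::euclidean_space \<Rightarrow> 'b::real_normed_vector) \<Rightarrow> bool"
  where "smooth f \<longleftrightarrow> (\<forall>k. C_k k f)"

text \<open>\<open>sections U\<close> is \<open>\<Gamma>(U) = C\<^sup>\<infinity>(V, U)\<close>, where \<open>U\<close> is a finite-dimensional subspace of a
  real vector space that itself need not carry a topology. A map into such a \<open>U\<close> is smooth iff
  its composition with every linear functional is.\<close>

definition sections :: "'e::real_vector set \<Rightarrow> ('v::euclidean_space \<Rightarrow> 'e) set"
  where "sections U = {s. (\<forall>x. s x \<in> U) \<and> (\<forall>l::'e \<Rightarrow> real. linear l \<longrightarrow> smooth (\<lambda>x. l (s x)))}"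

text \<open>\<open>X(f)\<close> for a vector field \<open>X\<close>.\<close>

definition der :: "('v::euclidean_space \<Rightarrow> 'v) \<Rightarrow> ('v \<Rightarrow> 'b::real_normed_vector) \<Rightarrow> 'v \<Rightarrow> 'b"
  where "der X f x = frechet_derivative f (at x) (X x)"

definition vf_bracket :: "('v::euclidean_space \<Rightarrow> 'v) \<Rightarrow> ('v \<Rightarrow> 'v) \<Rightarrow> 'v \<Rightarrow> 'v"
  where "vf_bracket X Y = der X Y - der Y X"

definition Cinf_linear ::
  "'e::real_vector set \<Rightarrow> 'f::real_vector set \<Rightarrow>
   (('v::euclidean_space \<Rightarrow> 'e) \<Rightarrow> 'v \<Rightarrow> 'f) \<Rightarrow> bool"
  where "Cinf_linear U W T \<longleftrightarrow>
    (\<forall>a\<in>sections U. T a \<in> sections W) \<and>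
    (\<forall>a\<in>sections U. \<forall>b\<in>sections U. T (a + b) = T a + T b) \<and>
    (\<forall>f a. smooth f \<longrightarrow> a \<in> sections U \<longrightarrow> T (\<lambda>x. f x *\<^sub>R a x) = (\<lambda>x. f x *\<^sub>R T a x))"


section \<open>dg-Lie algebroids over a vector space\<close>

text \<open>The base is the vector space \<open>V\<close>, over which every vector bundle is trivial; so a graded
  vector bundle is given by the fibres \<open>E i\<close>. A vector bundle map \<open>E\<^sub>0 \<rightarrow> TV\<close> is identified with
  the induced \<open>C\<^sup>\<infinity>(V)\<close>-linear map on sections. The operations carry the degrees of their
  arguments as indices. The axioms range over all integer degrees, but \<open>E i\<close> is zero
  for \<open>i > 0\<close>.\<close>

locale dg_Lie_algebroid =
  fixes E :: "int \<Rightarrow> 'e::real_vector set"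
    and d :: "int \<Rightarrow> ('v::euclidean_space \<Rightarrow> 'e) \<Rightarrow> 'v \<Rightarrow> 'e"
    and \<rho> :: "('v \<Rightarrow> 'e) \<Rightarrow> 'v \<Rightarrow> 'v"
    and br :: "int \<Rightarrow> int \<Rightarrow> ('v \<Rightarrow> 'e) \<Rightarrow> ('v \<Rightarrow> 'e) \<Rightarrow> 'v \<Rightarrow> 'e"
  assumes subspace_E: "subspace (E i)"
    and finite_dim_E: "\<exists>B. finite B \<and> E i \<subseteq> span B"
    and E_pos: "i > 0 \<Longrightarrow> E i = {0}"
    and d_linear: "Cinf_linear (E i) (E (i + 1)) (d i)"
    and d_d: "a \<in> sections (E i) \<Longrightarrow> d (i + 1) (d i a) = 0"
    and anchor_linear: "Cinf_linear (E 0) UNIV \<rho>"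
    and anchor_d: "a \<in> sections (E (-1)) \<Longrightarrow> \<rho> (d (-1) a) = 0"
    and br_closed: "\<lbrakk>a \<in> sections (E i); b \<in> sections (E j)\<rbrakk>
          \<Longrightarrow> br i j a b \<in> sections (E (i + j))"
    and br_add: "\<lbrakk>a \<in> sections (E i); b \<in> sections (E j); c \<in> sections (E j)\<rbrakk>
          \<Longrightarrow> br i j a (b + c) = br i j a b + br i j a c"
    and br_skew: "\<lbrakk>a \<in> sections (E i); b \<in> sections (E j)\<rbrakk>
          \<Longrightarrow> br i j a b = - (((-1) powi (i * j)) *\<^sub>R br j i b a)"
    and br_Leibniz: "\<lbrakk>smooth f; a \<in> sections (E i); b \<in> sections (E j)\<rbrakk>
          \<Longrightarrow> br i j a (\<lambda>x. f x *\<^sub>R b x) =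
              (\<lambda>x. f x *\<^sub>R br i j a b x + (if i = 0 then der (\<rho> a) f x else 0) *\<^sub>R b x)"
    and anchor_br: "\<lbrakk>a \<in> sections (E 0); b \<in> sections (E 0)\<rbrakk>
          \<Longrightarrow> \<rho> (br 0 0 a b) = vf_bracket (\<rho> a) (\<rho> b)"
    and d_br: "\<lbrakk>a \<in> sections (E i); b \<in> sections (E j)\<rbrakk>
          \<Longrightarrow> d (i + j) (br i j a b) =
              br (i + 1) j (d i a) b + ((-1) powi i) *\<^sub>R br i (j + 1) a (d j b)"
    and Jacobi: "\<lbrakk>a \<in> sections (E i); b \<in> sections (E j); c \<in> sections (E k)\<rbrakk>
          \<Longrightarrow> br i (j + k) a (br j k b c) =
              br (i + j) k (br i j a b) c + ((-1) powi (i * j)) *\<^sub>R br j (i + k) b (br i k a c)"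

definition is_resolution ::
  "(int \<Rightarrow> 'e::real_vector set) \<Rightarrow> (int \<Rightarrow> ('v::euclidean_space \<Rightarrow> 'e) \<Rightarrow> 'v \<Rightarrow> 'e) \<Rightarrow>
   (('v \<Rightarrow> 'e) \<Rightarrow> 'v \<Rightarrow> 'v) \<Rightarrow> ('v \<Rightarrow> 'v) set \<Rightarrow> bool"
  where "is_resolution E d \<rho> F \<longleftrightarrow>
    \<rho> ` sections (E 0) = F \<and>
    {a \<in> sections (E 0). \<rho> a = 0} = d (-1) ` sections (E (-1)) \<and>
    (\<forall>i<0. {a \<in> sections (E i). d i a = 0} = d (i - 1) ` sections (E (i - 1)))"

text \<open>A dg-Lie algebroid is regarded as an \<open>L\<^sub>\<infinity>\<close>-algebroid without higher brackets; it is
  universal for \<open>F\<close> if its underlying complex together with the anchor resolves \<open>F\<close>.\<close>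

definition universal_Linf_algebroid ::
  "(int \<Rightarrow> 'e::real_vector set) \<Rightarrow> (int \<Rightarrow> ('v::euclidean_space \<Rightarrow> 'e) \<Rightarrow> 'v \<Rightarrow> 'e) \<Rightarrow>
   (('v \<Rightarrow> 'e) \<Rightarrow> 'v \<Rightarrow> 'v) \<Rightarrow>
   (int \<Rightarrow> int \<Rightarrow> ('v \<Rightarrow> 'e) \<Rightarrow> ('v \<Rightarrow> 'e) \<Rightarrow> 'v \<Rightarrow> 'e) \<Rightarrow> ('v \<Rightarrow> 'v) set \<Rightarrow> bool"
  where "universal_Linf_algebroid E d \<rho> br F \<longleftrightarrow>
    dg_Lie_algebroid E d \<rho> br \<and> is_resolution E d \<rho> F"

text \<open>The value at \<open>p\<close> of the vector bundle map underlying \<open>d i\<close> sends \<open>a p\<close> to \<open>d i a p\<close>.\<close>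

definition minimal_at ::
  "(int \<Rightarrow> 'e::real_vector set) \<Rightarrow> (int \<Rightarrow> ('v::euclidean_space \<Rightarrow> 'e) \<Rightarrow> 'v \<Rightarrow> 'e) \<Rightarrow> 'v \<Rightarrow> bool"
  where "minimal_at E d p \<longleftrightarrow> (\<forall>i. \<forall>a\<in>sections (E i). d i a p = 0)"


section \<open>Alternating forms\<close>

text \<open>A \<open>k\<close>-form is a function on argument lists that vanishes off the lists of length \<open>k\<close>.
  \<open>alt k\<close> is \<open>\<wedge>\<^sup>kV\<^sup>*\<close> for real values and \<open>\<wedge>\<^sup>kV\<^sup>* \<otimes> V\<close> for values in \<open>V\<close>, where
  \<open>\<alpha> \<otimes> v\<close> is \<open>tens \<alpha> v\<close>.\<close>

definition alt :: "nat \<Rightarrow> ('v::real_vector list \<Rightarrow> 'b::real_vector) set"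
  where "alt k = {\<alpha>.
    (\<forall>vs. length vs \<noteq> k \<longrightarrow> \<alpha> vs = 0) \<and>
    (\<forall>vs i. length vs = k \<and> i < k \<longrightarrow> linear (\<lambda>v. \<alpha> (vs[i := v]))) \<and>
    (\<forall>vs. length vs = k \<and> \<not> distinct vs \<longrightarrow> \<alpha> vs = 0)}"

definition tens :: "('v list \<Rightarrow> real) \<Rightarrow> 'v::real_vector \<Rightarrow> 'v list \<Rightarrow> 'v"
  where "tens \<alpha> w = (\<lambda>vs. \<alpha> vs *\<^sub>R w)"

definition contract :: "'v \<Rightarrow> ('v list \<Rightarrow> 'b) \<Rightarrow> 'v list \<Rightarrow> 'b"
  where "contract v \<alpha> = (\<lambda>vs. \<alpha> (v # vs))"

text \<open>The normalisation is the one for which \<open>\<iota>\<^sub>v\<close> is an antiderivation, i.e.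
  \<open>(\<alpha> \<and> \<beta>)(v,w) = \<alpha>(v)\<beta>(w) - \<alpha>(w)\<beta>(v)\<close> for 1-forms.\<close>

definition wedge ::
  "nat \<Rightarrow> nat \<Rightarrow> ('v list \<Rightarrow> real) \<Rightarrow> ('v list \<Rightarrow> 'b::real_vector) \<Rightarrow> 'v list \<Rightarrow> 'b"
  where "wedge k l \<alpha> \<beta> = (\<lambda>vs. if length vs = k + l
    then (1 / (fact k * fact l)) *\<^sub>R
      (\<Sum>\<sigma> | \<sigma> permutes {..<k + l}.
         (of_int (sign \<sigma>) * \<alpha> (take k (permute_list \<sigma> vs))) *\<^sub>R \<beta> (drop k (permute_list \<sigma> vs)))
    else 0)"

text \<open>\<open>A = (\<Sum>b\<in>Basis. component b A \<otimes> b)\<close>, which extends operations given on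
  decomposable tensors.\<close>

definition component :: "'v::euclidean_space \<Rightarrow> ('v list \<Rightarrow> 'v) \<Rightarrow> 'v list \<Rightarrow> real"
  where "component b A = (\<lambda>vs. A vs \<bullet> b)"

lemma tens_component: "A = (\<Sum>b\<in>Basis. tens (component b A) b)"
  by (rule ext) (simp add: tens_def component_def euclidean_representation)

lemma component_tens: "component b (tens \<alpha> w) = (w \<bullet> b) *\<^sub>R \<alpha>"
  by (rule ext) (simp add: component_def tens_def)

lemma contract_linear:
  assumes "\<alpha> \<in> alt k"
  shows "linear (\<lambda>v. contract v \<alpha>)"
proof -
  have *: "linear (\<lambda>v. \<alpha> (v # vs))" for vs
  proof (cases "Suc (length vs) = k")
    case True
    have "\<forall>us i. length us = k \<and> i < k \<longrightarrow> linear (\<lambda>v. \<alpha> (us[i := v]))"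
      using assms unfolding alt_def by blast
    from this[rule_format, of "0 # vs" 0] True show ?thesis by auto
  next
    case False
    then have "\<alpha> (v # vs) = 0" for v
      using assms by (simp add: alt_def)
    then show ?thesis by (simp add: linear_zero)
  qed
  show ?thesis
    by (rule linearI) (auto simp: contract_def fun_eq_iff linear_add[OF *] linear_scale[OF *])
qed

lemma contract_basis:
  assumes "\<alpha> \<in> alt k"
  shows "(\<Sum>e\<in>Basis. (w \<bullet> e) *\<^sub>R contract e \<alpha>) = contract w \<alpha>"
proof -
  have "contract w \<alpha> = contract (\<Sum>e\<in>Basis. (w \<bullet> e) *\<^sub>R e) \<alpha>"
    by (simp add: euclidean_representation)
  also have "\<dots> = (\<Sum>e\<in>Basis. (w \<bullet> e) *\<^sub>R contract e \<alpha>)"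
    by (simp add: linear_sum[OF contract_linear[OF assms]] linear_scale[OF contract_linear[OF assms]])
  finally show ?thesis by simp
qed


section \<open>The maps of the complex\<close>

text \<open>\<open>\<phi>\<^sub>k(\<alpha> \<otimes> v) = (-1)\<^sup>k\<^sup>-\<^sup>1 \<iota>\<^sub>v\<alpha>\<close>, \<open>k \<ge> 1\<close>\<close>

definition phi :: "nat \<Rightarrow> ('v::euclidean_space list \<Rightarrow> 'v) \<Rightarrow> 'v list \<Rightarrow> real"
  where "phi k A = ((-1) ^ (k - 1)) *\<^sub>R (\<Sum>b\<in>Basis. contract b (component b A))"

lemma phi_tens: "\<alpha> \<in> alt k \<Longrightarrow> phi k (tens \<alpha> w) = ((-1) ^ (k - 1)) *\<^sub>R contract w \<alpha>"
  unfolding phi_def contract_basis[symmetric, where w = w]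
  by (simp add: component_tens) (simp add: contract_def fun_eq_iff)

definition K :: "nat \<Rightarrow> ('v::euclidean_space list \<Rightarrow> 'v) set"
  where "K k = {A \<in> alt k. phi k A = 0}"

text \<open>The operator \<open>x\<^sup>i\<iota>\<^bsub>e\<^sub>i\<^esub>\<close>. It equals \<open>\<iota>\<^sub>x\<close> and so does not depend on the basis.
  It is \<open>d\<^sub>k\<close> on \<open>\<Gamma>(\<wedge>\<^sup>kV\<^sup>* \<otimes> V)\<close> and \<open>-\<partial>\<^sub>k\<close> on \<open>\<Gamma>(\<wedge>\<^sup>kV\<^sup>*)\<close>.\<close>

definition euler ::
  "('v::euclidean_space \<Rightarrow> 'v list \<Rightarrow> 'b::real_vector) \<Rightarrow> 'v \<Rightarrow> 'v list \<Rightarrow> 'b"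
  where "euler A = (\<lambda>x. \<Sum>e\<in>Basis. (x \<bullet> e) *\<^sub>R contract e (A x))"

lemma euler_eq: "A x \<in> alt k \<Longrightarrow> euler A x = contract x (A x)"
  by (simp add: euler_def contract_basis)

lemma euler_tens: "euler (\<lambda>x. tens (\<alpha> x) v) = (\<lambda>x. tens (euler \<alpha> x) v)"
  by (simp add: euler_def tens_def contract_def fun_eq_iff scaleR_sum_left)

definition rho :: "('v::euclidean_space \<Rightarrow> 'v list \<Rightarrow> 'v) \<Rightarrow> 'v \<Rightarrow> 'v"
  where "rho A = (\<lambda>x. A x [x])"

lemma rho_tens: "rho (\<lambda>x. tens (\<alpha> x) v) x = \<alpha> x [x] *\<^sub>R v"
  by (simp add: rho_def tens_def)

definition sl :: "('v::euclidean_space list \<Rightarrow> 'v) set"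
  where "sl = {A \<in> alt 1. (\<Sum>b\<in>Basis. A [b] \<bullet> b) = 0}"

definition F_mu :: "('v::euclidean_space \<Rightarrow> 'v) set"
  where "F_mu = rho ` sections sl"


section \<open>The bracket on \<open>\<Gamma>(\<wedge>\<^sup>\<bullet>V\<^sup>* \<otimes> V)\<close>\<close>

text \<open>The bilinear extension of \<open>(\<psi>\<^sub>1 \<otimes> w\<^sub>1, \<psi>\<^sub>2 \<otimes> w\<^sub>2) \<mapsto> \<psi>\<^sub>1 \<and> \<iota>\<^bsub>w\<^sub>1\<^esub>\<psi>\<^sub>2 \<otimes> w\<^sub>2\<close>\<close>

definition insertion ::
  "nat \<Rightarrow> nat \<Rightarrow> ('v::euclidean_space list \<Rightarrow> 'v) \<Rightarrow> ('v list \<Rightarrow> 'v) \<Rightarrow> 'v list \<Rightarrow> 'v"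
  where "insertion k1 k2 A B = (\<Sum>b\<in>Basis. wedge k1 (k2 - 1) (component b A) (contract b B))"

definition der_form ::
  "('v::euclidean_space \<Rightarrow> 'v) \<Rightarrow> ('v \<Rightarrow> 'v list \<Rightarrow> 'b::real_normed_vector) \<Rightarrow> 'v \<Rightarrow> 'v list \<Rightarrow> 'b"
  where "der_form X B = (\<lambda>x vs. der X (\<lambda>y. B y vs) x)"

text \<open>\<open>nr_bracket k1 k2\<close> is the bracket on forms of degrees \<open>k1, k2 \<ge> 1\<close>; by the lemma
  \<open>nr_bracket_tens\<close> below it is given by the expected formula on decomposable elements.\<close>

definition nr_bracket ::
  "nat \<Rightarrow> nat \<Rightarrow> ('v::euclidean_space \<Rightarrow> 'v list \<Rightarrow> 'v) \<Rightarrow> ('v \<Rightarrow> 'v list \<Rightarrow> 'v) \<Rightarrow> 'v \<Rightarrow> 'v list \<Rightarrow> 'v"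
  where "nr_bracket k1 k2 A B = (\<lambda>x.
     insertion k1 k2 (A x) (B x) - ((-1) ^ ((k1 - 1) * (k2 - 1))) *\<^sub>R insertion k2 k1 (B x) (A x)
     + (if k1 = 1 then der_form (rho A) B x else 0)
     - (if k2 = 1 then der_form (rho B) A x else 0))"

lemma wedge_scale_left: "wedge k l (c *\<^sub>R \<alpha>) \<beta> = c *\<^sub>R wedge k l \<alpha> \<beta>"
  by (rule ext) (simp add: wedge_def scaleR_sum_right mult_ac)

lemma wedge_scale_right: "wedge k l \<alpha> (c *\<^sub>R \<beta>) = c *\<^sub>R wedge k l \<alpha> \<beta>"
  by (rule ext) (simp add: wedge_def scaleR_sum_right mult_ac)

lemma wedge_sum_right: "wedge k l \<alpha> (\<Sum>i\<in>I. \<beta> i) = (\<Sum>i\<in>I. wedge k l \<alpha> (\<beta> i))"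
  apply (rule ext)
  apply (simp add: wedge_def scaleR_sum_right)
  apply (subst sum.swap)
  apply simp
  done

lemma wedge_tens_right: "wedge k l \<alpha> (tens \<beta> w) = tens (wedge k l \<alpha> \<beta>) w"
  by (rule ext) (simp add: wedge_def tens_def scaleR_sum_left sum_divide_distrib scaleR_sum_right)

lemma tens_scale: "tens (c *\<^sub>R \<alpha>) w = c *\<^sub>R tens \<alpha> w"
  by (rule ext) (simp add: tens_def)

lemma insertion_tens:
  assumes "\<psi>2 \<in> alt k2"
  shows "insertion k1 k2 (c1 *\<^sub>R tens \<psi>1 w1) (c2 *\<^sub>R tens \<psi>2 w2)
    = (c1 * c2) *\<^sub>R tens (wedge k1 (k2 - 1) \<psi>1 (contract w1 \<psi>2)) w2"
proof -
  have c: "component b (c1 *\<^sub>R tens \<psi>1 w1) = (c1 * (w1 \<bullet> b)) *\<^sub>R \<psi>1" for b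
    by (simp add: component_def tens_def fun_eq_iff)
  have i: "contract b (c2 *\<^sub>R tens \<psi>2 w2) = c2 *\<^sub>R tens (contract b \<psi>2) w2" for b
    by (simp add: contract_def tens_def fun_eq_iff)
  have "insertion k1 k2 (c1 *\<^sub>R tens \<psi>1 w1) (c2 *\<^sub>R tens \<psi>2 w2)
      = (\<Sum>b\<in>Basis. (c1 * c2 * (w1 \<bullet> b)) *\<^sub>R tens (wedge k1 (k2 - 1) \<psi>1 (contract b \<psi>2)) w2)"
    by (simp add: insertion_def c i wedge_scale_left wedge_scale_right wedge_tens_right
        tens_scale mult_ac)
  also have "\<dots> = (c1 * c2) *\<^sub>R
      tens (wedge k1 (k2 - 1) \<psi>1 (\<Sum>b\<in>Basis. (w1 \<bullet> b) *\<^sub>R contract b \<psi>2)) w2"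
    by (simp add: wedge_sum_right wedge_scale_right tens_def fun_eq_iff scaleR_sum_left
        scaleR_sum_right mult_ac)
  finally show ?thesis by (simp add: contract_basis[OF assms])
qed

lemma der_form_tens:
  assumes "\<And>x. f differentiable (at x)"
  shows "der_form X (\<lambda>x. f x *\<^sub>R tens \<psi> w) x = der X f x *\<^sub>R tens \<psi> w"
proof
  fix vs
  have "((\<lambda>y. f y *\<^sub>R (\<psi> vs *\<^sub>R w)) has_derivative
          (\<lambda>h. frechet_derivative f (at x) h *\<^sub>R (\<psi> vs *\<^sub>R w))) (at x)"
    using assms[of x] by (intro has_derivative_scaleR_left) (simp add: frechet_derivative_works)
  from frechet_derivative_at[OF this, symmetric]
  show "der_form X (\<lambda>x. f x *\<^sub>R tens \<psi> w) x vs = (der X f x *\<^sub>R tens \<psi> w) vs"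
    by (simp add: der_form_def der_def tens_def)
qed

lemma nr_bracket_tens:
  fixes f1 f2 :: "'v::euclidean_space \<Rightarrow> real"
  assumes "smooth f1" "smooth f2" "\<psi>1 \<in> alt k1" "\<psi>2 \<in> alt k2"
  shows "nr_bracket k1 k2 (\<lambda>x. f1 x *\<^sub>R tens \<psi>1 w1) (\<lambda>x. f2 x *\<^sub>R tens \<psi>2 w2) = (\<lambda>x.
      (f1 x * f2 x) *\<^sub>R (tens (wedge k1 (k2 - 1) \<psi>1 (contract w1 \<psi>2)) w2
         - ((-1) ^ ((k1 - 1) * (k2 - 1))) *\<^sub>R tens (wedge k2 (k1 - 1) \<psi>2 (contract w2 \<psi>1)) w1)
      + (if k1 = 1 then (f1 x * der (rho (\<lambda>_. tens \<psi>1 w1)) f2 x) *\<^sub>R tens \<psi>2 w2 else 0)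
      - (if k2 = 1 then (f2 x * der (rho (\<lambda>_. tens \<psi>2 w2)) f1 x) *\<^sub>R tens \<psi>1 w1 else 0))"
proof -
  have diff: "g differentiable (at x)" if "smooth g" for g :: "'v \<Rightarrow> real" and x
    using that[unfolded smooth_def, rule_format, of "Suc 0"] by simp
  have r: "der (rho (\<lambda>x. f x *\<^sub>R tens \<psi> w)) g x = f x * der (rho (\<lambda>_. tens \<psi> w)) g x"
    if "smooth g" for f g :: "'v \<Rightarrow> real" and \<psi> w x
    using linear_scale[OF linear_frechet_derivative[OF diff[OF that]]]
    by (simp add: der_def rho_def)
  show ?thesis
    using assms(1,2)
    by (simp add: nr_bracket_def insertion_tens assms(3,4) der_form_tens diff r
        scaleR_diff_right mult_ac cong: if_cong)
qed


section \<open>The graded bundle and its operations\<close>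

text \<open>All fibres live in \<open>(\<wedge>\<^sup>\<bullet>V\<^sup>* \<otimes> V) \<times> \<wedge>\<^sup>\<bullet>V\<^sup>*\<close>: the first factor holds the \<open>K\<^sub>k\<close> (in degree
  \<open>1 - k\<close>, \<open>1 \<le> k \<le> n - 1\<close>), the second holds \<open>\<wedge>\<^sup>nV\<^sup>*\<close> (in degree \<open>1 - n\<close>).\<close>

type_synonym 'v fibre = "('v list \<Rightarrow> 'v) \<times> ('v list \<Rightarrow> real)"

definition E_mu :: "int \<Rightarrow> 'v::euclidean_space fibre set"
  where "E_mu i =
    (if i = 1 - int DIM('v) then {0} \<times> alt DIM('v)
     else if 1 - int DIM('v) < i \<and> i \<le> 0 then K (nat (1 - i)) \<times> {0}
     else {0})"

text \<open>\<open>d\<^sub>n \<phi>\<^sub>n\<^sup>-\<^sup>1 \<partial>\<^sub>n\<close>\<close>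

definition d_top :: "('v::euclidean_space \<Rightarrow> 'v list \<Rightarrow> real) \<Rightarrow> 'v \<Rightarrow> 'v list \<Rightarrow> 'v"
  where "d_top \<eta> = euler (\<lambda>x. the_inv_into (alt DIM('v)) (phi DIM('v)) (- euler \<eta> x))"

definition d_mu :: "int \<Rightarrow> ('v::euclidean_space \<Rightarrow> 'v fibre) \<Rightarrow> 'v \<Rightarrow> 'v fibre"
  where "d_mu i a =
    (if i = 1 - int DIM('v) then (\<lambda>x. (d_top (\<lambda>y. snd (a y)) x, 0))
     else if 1 - int DIM('v) < i \<and> i < 0 then (\<lambda>x. (euler (\<lambda>y. fst (a y)) x, 0))
     else 0)"

definition rho_mu :: "('v::euclidean_space \<Rightarrow> 'v fibre) \<Rightarrow> 'v \<Rightarrow> 'v"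
  where "rho_mu a = rho (\<lambda>x. fst (a x))"

text \<open>The function \<open>g\<close> with \<open>\<eta> = g\<mu>\<close>, and \<open>[X, g\<mu>] = \<rho>\<^sub>\<mu>(X)(g) \<mu>\<close>\<close>

definition coefficient ::
  "('v list \<Rightarrow> real) \<Rightarrow> ('v::euclidean_space \<Rightarrow> 'v list \<Rightarrow> real) \<Rightarrow> 'v \<Rightarrow> real"
  where "coefficient \<mu> \<eta> x = (THE c. \<eta> x = c *\<^sub>R \<mu>)"

definition top_bracket ::
  "('v list \<Rightarrow> real) \<Rightarrow> ('v::euclidean_space \<Rightarrow> 'v list \<Rightarrow> 'v) \<Rightarrow> ('v \<Rightarrow> 'v list \<Rightarrow> real) \<Rightarrow>
   'v \<Rightarrow> 'v list \<Rightarrow> real"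
  where "top_bracket \<mu> X \<eta> = (\<lambda>x. der (rho X) (coefficient \<mu> \<eta>) x *\<^sub>R \<mu>)"

definition bracket_mu ::
  "('v::euclidean_space list \<Rightarrow> real) \<Rightarrow> int \<Rightarrow> int \<Rightarrow>
   ('v \<Rightarrow> 'v fibre) \<Rightarrow> ('v \<Rightarrow> 'v fibre) \<Rightarrow> 'v \<Rightarrow> 'v fibre"
  where "bracket_mu \<mu> i j a b =
    (let n = int DIM('v);
         a1 = (\<lambda>x. fst (a x)); a2 = (\<lambda>x. snd (a x));
         b1 = (\<lambda>x. fst (b x)); b2 = (\<lambda>x. snd (b x))
     in if i \<in> {2 - n..0} \<and> j \<in> {2 - n..0} then
          (\<lambda>x. (nr_bracket (nat (1 - i)) (nat (1 - j)) a1 b1 x, 0))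
        else if i = 0 \<and> j = 1 - n then (\<lambda>x. (0, top_bracket \<mu> a1 b2 x))
        else if i = 1 - n \<and> j = 0 then (\<lambda>x. (0, - top_bracket \<mu> b1 a2 x))
        else 0)"

end

theory Submission
  imports Defs
begin

text \<open>Write \<open>\<iota>\<close> for contraction, \<open>n\<close> for the dimension of \<open>V\<close>, and \<open>A \<rhd> B\<close> for the insertion of \<open>A\<close> into \<open>B\<close>.

A form of positive degree is determined by its contractions with vectors (\<open>form_eqI\<close>). An identity
between forms can therefore be proved by induction on the total degree: contract both sides with an
arbitrary vector and move the contraction inwards. What makes this work is that \<open>\<iota>\<^sub>v\<close> is an
antiderivation (\<open>contract_wedge\<close>); this and the fact that products of alternating forms are
alternating (\<open>wedge_alt\<close>) are read off from the sum over permutations. Graded commutativity, the identities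
\<open>\<Sum>\<^sub>b b \<and> \<iota>\<^sub>b\<alpha> = k \<alpha>\<close> and \<open>\<Sum>\<^sub>b \<iota>\<^sub>b(b \<and> \<alpha>) = (n - k) \<alpha>\<close> for \<open>k\<close>-forms, and the graded pre-Lie identity
for \<open>\<rhd>\<close> (\<open>prelie_defect_eq_0\<close>) follow.

\<^emph>\<open>The bracket.\<close> A section \<open>A\<close> acts on sections by \<open>B \<mapsto> A \<rhd> B\<close>, plus the derivative of \<open>B\<close> along \<open>rho A\<close>
if \<open>A\<close> has form degree 1, and the bracket is \<open>[A,B] = A\<cdot>B \<minusplus> B\<cdot>A\<close>. The pre-Lie identity, the product
rule and the symmetry of second derivatives show that \<open>[A,B]\<close> acts as the graded commutator of the
two actions (\<open>act_commutator\<close>), and the graded Jacobi identity is a formal consequence. The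
bracket preserves trace-free forms because, for trace-free \<open>A\<close> and \<open>B\<close>, the trace of \<open>A \<rhd> B\<close> is graded
symmetric in \<open>A\<close> and \<open>B\<close>; brackets whose form degree reaches \<open>n\<close> vanish because \<open>K\<^sub>n = 0\<close>.

\<^emph>\<open>The differential.\<close> It is \<open>\<iota>\<^sub>x\<close>, and its compatibility with the bracket is the antiderivation rule, where
the derivative of the factor \<open>x\<close> in \<open>\<iota>\<^sub>x B\<close> accounts for the term in which \<open>\<iota>\<^sub>x A\<close> is a vector. In the
lowest degree \<open>d \<eta> = \<plusminus> \<iota>\<^sub>x(\<eta> \<otimes> x)\<close>. For trace-free \<open>X\<close> one has \<open>[X, g\<mu> \<otimes> x] = rho X (g) \<mu> \<otimes> x\<close>: the algebraic
action of \<open>X\<close> on \<open>\<mu>\<close> is multiplication by its trace, and the radial field \<open>x\<close> is invariant under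
linear maps. This is the compatibility with \<open>[X, g\<mu>] = rho X (g) \<mu>\<close> (\<open>d_top_bracket\<close>).

\<^emph>\<open>Exactness.\<close> On forms with smooth coefficients the Lie derivative along the Euler field is
\<open>\<iota>\<^sub>x d\<^sub>d\<^sub>R + d\<^sub>d\<^sub>R \<iota>\<^sub>x\<close>, and on \<open>k\<close>-forms with \<open>k \<ge> 1\<close> it is inverted by
\<open>A \<mapsto> (x \<mapsto> \<integral>\<^sub>0\<^sup>1 t\<^sup>k\<^sup>-\<^sup>1 A(t x) dt)\<close>. Hence \<open>\<iota>\<^sub>x A = 0\<close> implies \<open>A = \<iota>\<^sub>x B\<close>, where \<open>B\<close> is the exterior derivative of
that integral (\<open>koszul_exact\<close>). If \<open>A\<close> is trace-free, then \<open>tr B\<close> is again annihilated by \<open>\<iota>\<^sub>x\<close>, so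
\<open>tr B = \<iota>\<^sub>x G\<close>. As long as \<open>G\<close> is not of top degree, \<open>G\<close> is the trace of some \<open>C\<close>, and \<open>B + \<iota>\<^sub>x C\<close> is a
trace-free primitive of \<open>A\<close> (\<open>koszul_exact_K\<close>). If \<open>G\<close> is of top degree, then \<open>B = G \<otimes> x\<close>, which says that
\<open>A\<close> is in the image of \<open>\<Gamma>(\<and>\<^sup>nV\<^sup>*)\<close> (\<open>koszul_exact_K_top\<close>). The first map of the resolution is injective off
the origin, hence injective by continuity. All differentials contain the factor \<open>x\<close>, which gives
minimality at the origin.\<close>


section \<open>Smooth maps\<close>

lemma C_k_const: "C_k k (\<lambda>x. c)"
  by (induction k arbitrary: c) auto

lemma C_k_SucD: "C_k (Suc k) f \<Longrightarrow> C_k k f"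
proof (induction k arbitrary: f)
  case 0
  then show ?case
    by (auto intro!: continuous_at_imp_continuous_on differentiable_imp_continuous_within)
next
  case (Suc k)
  then show ?case by (metis C_k.simps(2))
qed

lemma C_k_add: "C_k k f \<Longrightarrow> C_k k g \<Longrightarrow> C_k k (\<lambda>x. f x + g x)"
proof (induction k arbitrary: f g)
  case 0
  then show ?case by (auto intro: continuous_on_add)
next
  case (Suc k)
  have "frechet_derivative (\<lambda>x. f x + g x) (at x) v
      = frechet_derivative f (at x) v + frechet_derivative g (at x) v" for x v
    using Suc.prems
    by (intro fun_cong[OF frechet_derivative_at[symmetric], THEN trans] has_derivative_add)
      (auto simp: frechet_derivative_works)
  then show ?case using Suc by (auto intro: differentiable_add)
qed

lemma C_k_bilinear:
  assumes "bounded_bilinear h"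
  shows "C_k k f \<Longrightarrow> C_k k g \<Longrightarrow> C_k k (\<lambda>x. h (f x) (g x))"
proof (induction k arbitrary: f g)
  case 0
  then show ?case by (auto intro: bounded_bilinear.continuous_on[OF assms])
next
  case (Suc k)
  have *: "((\<lambda>x. h (f x) (g x)) has_derivative
      (\<lambda>v. h (f x) (frechet_derivative g (at x) v) + h (frechet_derivative f (at x) v) (g x))) (at x)" for x
    using Suc.prems
    by (intro bounded_bilinear.FDERIV[OF assms]) (auto simp: frechet_derivative_works)
  have "C_k k (\<lambda>x. h (f x) (frechet_derivative g (at x) v) + h (frechet_derivative f (at x) v) (g x))" for v
    using Suc.prems C_k_SucD[OF Suc.prems(1)] C_k_SucD[OF Suc.prems(2)] by (intro C_k_add Suc.IH) simp_all
  then show ?case using * frechet_derivative_at[OF *, symmetric]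
    by (auto simp: differentiable_def)
qed

lemma C_k_bounded_linear:
  assumes "bounded_linear h"
  shows "C_k k f \<Longrightarrow> C_k k (\<lambda>x. h (f x))"
proof (induction k arbitrary: f)
  case 0
  then show ?case by (auto intro: bounded_linear.continuous_on[OF assms])
next
  case (Suc k)
  have *: "((\<lambda>x. h (f x)) has_derivative (\<lambda>v. h (frechet_derivative f (at x) v))) (at x)" for x
    using Suc.prems
    by (intro bounded_linear.has_derivative[OF assms]) (auto simp: frechet_derivative_works)
  show ?case using Suc * frechet_derivative_at[OF *, symmetric]
    by (auto simp: differentiable_def)
qed

lemma C_k_id: "C_k k (\<lambda>x. x)"
proof (cases k)
  case (Suc l)
  have "frechet_derivative (\<lambda>x. x) (at x) v = v" for x v :: 'a
    by (rule fun_cong[OF frechet_derivative_at[symmetric], THEN trans]) (auto intro: has_derivative_ident)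
  then show ?thesis using Suc by (auto intro: C_k_const)
qed auto

lemma smooth_const [simp]: "smooth (\<lambda>x. c)"
  by (simp add: smooth_def C_k_const)

lemma smooth_zero [simp]: "smooth 0"
  by (simp add: zero_fun_def)

lemma smooth_id: "smooth (\<lambda>x. x)"
  by (simp add: smooth_def C_k_id)

lemma smooth_add: "smooth f \<Longrightarrow> smooth g \<Longrightarrow> smooth (\<lambda>x. f x + g x)"
  by (simp add: smooth_def C_k_add)

lemma smooth_bounded_linear: "bounded_linear h \<Longrightarrow> smooth f \<Longrightarrow> smooth (\<lambda>x. h (f x))"
  by (simp add: smooth_def C_k_bounded_linear)

lemma smooth_linear:
  fixes h :: "'b::euclidean_space \<Rightarrow> 'c::real_normed_vector"
  shows "linear h \<Longrightarrow> smooth f \<Longrightarrow> smooth (\<lambda>x. h (f x))"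
  by (simp add: linear_conv_bounded_linear smooth_bounded_linear)

lemma smooth_bilinear:
  "bounded_bilinear h \<Longrightarrow> smooth f \<Longrightarrow> smooth g \<Longrightarrow> smooth (\<lambda>x. h (f x) (g x))"
  by (simp add: smooth_def C_k_bilinear)

lemmas smooth_scaleR = smooth_bilinear[OF bounded_bilinear_scaleR]
lemmas smooth_mult = smooth_bilinear[OF bounded_bilinear_mult]
lemmas smooth_inner = smooth_bilinear[OF bounded_bilinear_inner]

lemma smooth_minus: "smooth f \<Longrightarrow> smooth (\<lambda>x. - f x)"
  by (rule smooth_bounded_linear[OF bounded_linear_minus[OF bounded_linear_ident]])

lemma smooth_diff: "smooth f \<Longrightarrow> smooth g \<Longrightarrow> smooth (\<lambda>x. f x - g x)"
  using smooth_add[of f "\<lambda>x. - g x"] by (simp add: smooth_minus)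

lemma smooth_sum: "(\<And>i. i \<in> I \<Longrightarrow> smooth (f i)) \<Longrightarrow> smooth (\<lambda>x. \<Sum>i\<in>I. f i x)"
  by (induction I rule: infinite_finite_induct) (auto intro: smooth_add)

lemmas smooth_intros = smooth_const smooth_zero smooth_id smooth_add smooth_scaleR smooth_mult
  smooth_inner smooth_minus smooth_diff smooth_sum

lemma smooth_componentwise:
  fixes f :: "'a::euclidean_space \<Rightarrow> 'b::euclidean_space"
  assumes "\<And>b. b \<in> Basis \<Longrightarrow> smooth (\<lambda>x. f x \<bullet> b)"
  shows "smooth f"
proof -
  have "smooth (\<lambda>x. \<Sum>b\<in>Basis. (f x \<bullet> b) *\<^sub>R b)"
    by (intro smooth_sum smooth_scaleR smooth_const assms)
  then show ?thesis by (simp add: euclidean_representation)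
qed

lemma smooth_imp_differentiable: "smooth f \<Longrightarrow> f differentiable (at x)"
  unfolding smooth_def by (metis C_k.simps(2))

lemma smooth_has_derivative:
  "smooth f \<Longrightarrow> (f has_derivative frechet_derivative f (at x)) (at x)"
  using smooth_imp_differentiable frechet_derivative_works by blast

lemma smooth_imp_continuous_on: "smooth f \<Longrightarrow> continuous_on S f"
  unfolding smooth_def by (metis C_k.simps(1) continuous_on_subset subset_UNIV)

lemma smooth_directional: "smooth f \<Longrightarrow> smooth (\<lambda>x. frechet_derivative f (at x) v)"
  unfolding smooth_def by (metis C_k.simps(2))

lemma linear_frechet: "smooth f \<Longrightarrow> linear (frechet_derivative f (at x))"
  by (simp add: smooth_imp_differentiable linear_frechet_derivative)

lemma der_eqI: "(f has_derivative f') (at x) \<Longrightarrow> der X f x = f' (X x)"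
  unfolding der_def using frechet_derivative_at by metis

lemma der_basis:
  assumes "smooth f"
  shows "der X f x = (\<Sum>b\<in>Basis. (X x \<bullet> b) *\<^sub>R frechet_derivative f (at x) b)"
proof -
  have "der X f x = frechet_derivative f (at x) (\<Sum>b\<in>Basis. (X x \<bullet> b) *\<^sub>R b)"
    by (simp add: der_def euclidean_representation)
  then show ?thesis
    by (simp add: linear_sum[OF linear_frechet[OF assms]] linear_scale[OF linear_frechet[OF assms]])
qed

lemma smooth_der:
  assumes "smooth X" "smooth f"
  shows "smooth (der X f)"
proof -
  have "smooth (\<lambda>x. \<Sum>b\<in>Basis. (X x \<bullet> b) *\<^sub>R frechet_derivative f (at x) b)"
    using assms by (intro smooth_intros smooth_directional) auto
  moreover have "der X f = (\<lambda>x. \<Sum>b\<in>Basis. (X x \<bullet> b) *\<^sub>R frechet_derivative f (at x) b)"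
    using der_basis[OF assms(2)] by blast
  ultimately show ?thesis by simp
qed

lemma der_const [simp]: "der X (\<lambda>x. c) x = 0"
  by (rule der_eqI[THEN trans]) (auto intro: has_derivative_const)

lemma der_id [simp]: "der X (\<lambda>x. x) x = X x"
  by (rule der_eqI[THEN trans]) (auto intro: has_derivative_ident)

lemma der_add: "smooth f \<Longrightarrow> smooth g \<Longrightarrow> der X (\<lambda>x. f x + g x) x = der X f x + der X g x"
  by (simp add: der_eqI[OF has_derivative_add[OF smooth_has_derivative smooth_has_derivative]])
    (simp add: der_def)

lemma der_bounded_linear: "bounded_linear h \<Longrightarrow> smooth f \<Longrightarrow> der X (\<lambda>x. h (f x)) x = h (der X f x)"
  by (simp add: der_eqI[OF bounded_linear.has_derivative[OF _ smooth_has_derivative]]) (simp add: der_def)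

lemma der_minus: "smooth f \<Longrightarrow> der X (\<lambda>x. - f x) x = - der X f x"
  by (rule der_bounded_linear[OF bounded_linear_minus[OF bounded_linear_ident]])

lemma der_diff: "smooth f \<Longrightarrow> smooth g \<Longrightarrow> der X (\<lambda>x. f x - g x) x = der X f x - der X g x"
  using der_add[of f "\<lambda>x. - g x" X x] by (simp add: smooth_minus der_minus)

lemma der_sum: "(\<And>i. i \<in> I \<Longrightarrow> smooth (f i)) \<Longrightarrow> der X (\<lambda>x. \<Sum>i\<in>I. f i x) x = (\<Sum>i\<in>I. der X (f i) x)"
  by (induction I rule: infinite_finite_induct) (auto simp: der_add smooth_sum)

lemma der_bilinear:
  "bounded_bilinear h \<Longrightarrow> smooth f \<Longrightarrow> smooth g \<Longrightarrow>
    der X (\<lambda>x. h (f x) (g x)) x = h (f x) (der X g x) + h (der X f x) (g x)"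
  by (simp add: der_eqI[OF bounded_bilinear.FDERIV[OF _ smooth_has_derivative smooth_has_derivative]])
    (simp add: der_def)

lemmas der_scaleR = der_bilinear[OF bounded_bilinear_scaleR]
lemmas der_inner = der_bilinear[OF bounded_bilinear_inner]

lemma der_zero_field [simp]: "smooth f \<Longrightarrow> X x = 0 \<Longrightarrow> der X f x = 0"
  by (simp add: der_def linear_0[OF linear_frechet])

lemma smooth_line:
  assumes "smooth f"
  shows "((\<lambda>t. f (p + t *\<^sub>R v)) has_vector_derivative frechet_derivative f (at (p + t *\<^sub>R v)) v)
    (at t within S)"
proof -
  have "(f has_derivative frechet_derivative f (at (p + t *\<^sub>R v)))
      (at (p + t *\<^sub>R v) within (\<lambda>t. p + t *\<^sub>R v) ` S)"
    using smooth_has_derivative[OF assms] has_derivative_at_withinI by blast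
  moreover have "((\<lambda>t. p + t *\<^sub>R v) has_derivative (\<lambda>h. h *\<^sub>R v)) (at t within S)"
    by (auto intro!: derivative_eq_intros)
  ultimately have "((\<lambda>t. f (p + t *\<^sub>R v)) has_derivative
      (\<lambda>h. frechet_derivative f (at (p + t *\<^sub>R v)) (h *\<^sub>R v))) (at t within S)"
    using has_derivative_in_compose by fastforce
  then show ?thesis
    by (simp add: has_vector_derivative_def linear_scale[OF linear_frechet[OF assms]])
qed

text \<open>Integrating \<open>D\<^sub>v f\<close> along the segment from \<open>x + r u\<close> in direction \<open>v\<close> gives a difference of values
of \<open>f\<close>. Differentiating under the integral in \<open>r\<close> and then in the length of the segment exchanges the two
derivatives.\<close>

lemma symmetric_second_derivative:
  fixes f :: "'a::euclidean_space \<Rightarrow> 'b::euclidean_space"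
  assumes f: "smooth f"
  shows "frechet_derivative (\<lambda>y. frechet_derivative f (at y) v) (at x) u
    = frechet_derivative (\<lambda>y. frechet_derivative f (at y) u) (at x) v"
proof -
  define D where "D = (\<lambda>w y. frechet_derivative f (at y) w)"
  define H where "H = (\<lambda>y. frechet_derivative (D v) (at y) u)"
  have sD: "smooth (D w)" for w
    unfolding D_def by (rule smooth_directional[OF f])
  have sH: "smooth H"
    unfolding H_def by (rule smooth_directional[OF sD])
  have int: "((\<lambda>t. D v (p + t *\<^sub>R v)) has_integral f (p + s *\<^sub>R v) - f p) {0..s}" if "0 \<le> s" for p s
    using fundamental_theorem_of_calculus[OF that, of "\<lambda>t. f (p + t *\<^sub>R v)"] smooth_line[OF f, of p v]
    unfolding D_def by auto
  have diff_int: "integral {0..s} (\<lambda>t. H (x + t *\<^sub>R v)) = D u (x + s *\<^sub>R v) - D u x"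
    if s: "0 \<le> s" for s
  proof -
    have "((\<lambda>r. integral (cbox 0 s) (\<lambda>t. D v (x + t *\<^sub>R v + r *\<^sub>R u))) has_vector_derivative
        integral (cbox 0 s) (\<lambda>t. H (x + t *\<^sub>R v + 0 *\<^sub>R u))) (at 0 within UNIV)"
    proof (rule leibniz_rule_vector_derivative)
      show "((\<lambda>r. D v (x + t *\<^sub>R v + r *\<^sub>R u)) has_vector_derivative H (x + t *\<^sub>R v + r *\<^sub>R u))
          (at r within UNIV)" for r t
        unfolding H_def by (rule smooth_line[OF sD])
      show "(\<lambda>t. D v (x + t *\<^sub>R v + r *\<^sub>R u)) integrable_on cbox 0 s" for r
        by (rule integrable_continuous)
          (intro continuous_on_compose2[OF smooth_imp_continuous_on[OF sD, of UNIV]] continuous_intros; simp)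
      show "continuous_on (UNIV \<times> cbox 0 s) (\<lambda>(r, t). H (x + t *\<^sub>R v + r *\<^sub>R u))"
        unfolding split_beta
        by (intro continuous_on_compose2[OF smooth_imp_continuous_on[OF sH, of UNIV]] continuous_intros; simp)
    qed auto
    moreover have "integral (cbox 0 s) (\<lambda>t. D v (x + t *\<^sub>R v + r *\<^sub>R u))
        = f (x + s *\<^sub>R v + r *\<^sub>R u) - f (x + r *\<^sub>R u)" for r
      using integral_unique[OF int[OF s, of "x + r *\<^sub>R u"]] by (simp add: algebra_simps)
    ultimately have "((\<lambda>r. f (x + s *\<^sub>R v + r *\<^sub>R u) - f (x + r *\<^sub>R u)) has_vector_derivative
        integral {0..s} (\<lambda>t. H (x + t *\<^sub>R v))) (at 0)"
      by (simp add: cbox_interval)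
    moreover have "((\<lambda>r. f (x + s *\<^sub>R v + r *\<^sub>R u) - f (x + r *\<^sub>R u)) has_vector_derivative
        D u (x + s *\<^sub>R v + 0 *\<^sub>R u) - D u (x + 0 *\<^sub>R u)) (at 0)"
      unfolding D_def by (intro has_vector_derivative_diff smooth_line[OF f])
    ultimately show ?thesis
      using vector_derivative_unique_at by fastforce
  qed
  have "((\<lambda>s. integral {0..s} (\<lambda>t. H (x + t *\<^sub>R v))) has_vector_derivative H (x + 0 *\<^sub>R v))
      (at 0 within {0..1})"
  proof (rule integral_has_vector_derivative)
    show "continuous_on {0..1} (\<lambda>t. H (x + t *\<^sub>R v))"
      by (intro continuous_on_compose2[OF smooth_imp_continuous_on[OF sH, of UNIV]] continuous_intros; simp)
  qed simp
  then have "((\<lambda>s. integral {0..s} (\<lambda>t. H (x + t *\<^sub>R v))) has_vector_derivative H x) (at 0 within {0..1})"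
    by simp
  then have "((\<lambda>s. D u (x + s *\<^sub>R v) - D u x) has_vector_derivative H x) (at 0 within {0..1})"
    by (rule has_vector_derivative_transform[rotated 2]) (auto simp: diff_int)
  moreover have "((\<lambda>s. D u (x + s *\<^sub>R v) - D u x) has_vector_derivative
      frechet_derivative (D u) (at (x + 0 *\<^sub>R v)) v - 0) (at 0 within {0..1})"
    by (intro has_vector_derivative_diff smooth_line[OF sD] has_vector_derivative_const)
  moreover have "at (0::real) within {0..1} \<noteq> bot"
    by (simp add: at_within_Icc_at_right)
  ultimately have "H x = frechet_derivative (D u) (at x) v"
    using vector_derivative_unique_within by fastforce
  then show ?thesis by (simp add: H_def D_def)
qed

text \<open>In \<open>X(Y f)\<close> the terms without a second derivative of \<open>f\<close> are the derivative of \<open>f\<close> along \<open>X(Y)\<close>; the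
terms with one are symmetric in \<open>X\<close> and \<open>Y\<close> and cancel.\<close>

lemma der_vf_bracket:
  fixes f :: "'a::euclidean_space \<Rightarrow> 'b::euclidean_space"
  assumes X: "smooth X" and Y: "smooth Y" and f: "smooth f"
  shows "der (vf_bracket X Y) f x = der X (der Y f) x - der Y (der X f) x"
proof -
  let ?D = "\<lambda>w y. frechet_derivative f (at y) w"
  have sD: "smooth (?D w)" for w
    by (rule smooth_directional[OF f])
  have expand: "der X (der Y f) x
      = ?D (der X Y x) x + (\<Sum>b\<in>Basis. (Y x \<bullet> b) *\<^sub>R (\<Sum>c\<in>Basis. (X x \<bullet> c) *\<^sub>R frechet_derivative (?D b) (at x) c))"
    if "smooth X" "smooth Y" for X Y :: "'a \<Rightarrow> 'a"
  proof -
    have "der X (der Y f) x = der X (\<lambda>x. \<Sum>b\<in>Basis. (Y x \<bullet> b) *\<^sub>R ?D b x) x"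
      using der_basis[OF f, of Y] by presburger
    also have "\<dots> = (\<Sum>b\<in>Basis. (Y x \<bullet> b) *\<^sub>R der X (?D b) x + (der X Y x \<bullet> b) *\<^sub>R ?D b x)"
      using that by (simp add: der_sum der_scaleR der_inner smooth_intros sD)
    also have "\<dots> = (\<Sum>b\<in>Basis. (der X Y x \<bullet> b) *\<^sub>R ?D b x) + (\<Sum>b\<in>Basis. (Y x \<bullet> b) *\<^sub>R der X (?D b) x)"
      by (simp add: sum.distrib)
    also have "(\<Sum>b\<in>Basis. (der X Y x \<bullet> b) *\<^sub>R ?D b x) = ?D (der X Y x) x"
      using der_basis[OF f, of "\<lambda>x. der X Y x" x] by (simp add: der_def)
    finally show ?thesis by (simp add: der_basis[OF sD])
  qed
  have "(\<Sum>b\<in>Basis. (Y x \<bullet> b) *\<^sub>R (\<Sum>c\<in>Basis. (X x \<bullet> c) *\<^sub>R frechet_derivative (?D b) (at x) c))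
      = (\<Sum>c\<in>Basis. (X x \<bullet> c) *\<^sub>R (\<Sum>b\<in>Basis. (Y x \<bullet> b) *\<^sub>R frechet_derivative (?D c) (at x) b))"
    unfolding scaleR_sum_right
    by (subst sum.swap) (simp add: symmetric_second_derivative[OF f] mult.commute)
  then show ?thesis
    unfolding expand[OF X Y] expand[OF Y X]
    by (simp add: vf_bracket_def der_def linear_diff[OF linear_frechet[OF f]])
qed

text \<open>The inverse of the operator \<open>E + (m + 1)\<close>, where \<open>E\<close> is the derivative along the Euler field.\<close>

definition radial_integral :: "nat \<Rightarrow> ('a::euclidean_space \<Rightarrow> 'b::euclidean_space) \<Rightarrow> 'a \<Rightarrow> 'b"
  where "radial_integral m f x = integral {0..1} (\<lambda>t. t ^ m *\<^sub>R f (t *\<^sub>R x))"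

lemma continuous_scaled:
  fixes f :: "'a::euclidean_space \<Rightarrow> 'b::euclidean_space"
  assumes "continuous_on UNIV f"
  shows "continuous_on S (\<lambda>(x, t::real). t ^ m *\<^sub>R f (t *\<^sub>R x))"
proof -
  have "continuous_on S (\<lambda>z. f (snd z *\<^sub>R fst z))"
    by (rule continuous_on_compose2[OF assms, of S "\<lambda>z. snd z *\<^sub>R fst z"])
      (auto intro!: continuous_intros)
  then show ?thesis
    unfolding split_beta by (intro continuous_intros)
qed

lemma radial_integrable:
  fixes f :: "'a::euclidean_space \<Rightarrow> 'b::euclidean_space"
  assumes "continuous_on UNIV f"
  shows "(\<lambda>t. t ^ m *\<^sub>R f (t *\<^sub>R x)) integrable_on {0..1::real}"
  by (intro integrable_continuous_interval continuous_on_compose2[OF assms] continuous_intros; simp)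

lemma radial_integral_continuous:
  fixes f :: "'a::euclidean_space \<Rightarrow> 'b::euclidean_space"
  assumes "continuous_on UNIV f"
  shows "continuous_on UNIV (radial_integral m f)"
  unfolding radial_integral_def[abs_def]
  using integral_continuous_on_param[of UNIV 0 "1::real" "\<lambda>x t. t ^ m *\<^sub>R f (t *\<^sub>R x)"]
    continuous_scaled[OF assms] by (simp add: cbox_interval)

text \<open>The inner derivative of \<open>t x\<close> raises the weight \<open>t\<^sup>m\<close> by one. Hence smoothness is proved below by an
induction that keeps the weight arbitrary.\<close>

lemma radial_integral_has_derivative:
  fixes f :: "'a::euclidean_space \<Rightarrow> 'b::euclidean_space"
  assumes "C_k (Suc 0) f"
  shows "(radial_integral m f has_derivative
    (\<lambda>v. radial_integral (Suc m) (\<lambda>y. frechet_derivative f (at y) v) x)) (at x)"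
proof -
  have fd: "f differentiable (at y)" for y using assms by simp
  have fl: "bounded_linear (frechet_derivative f (at y))" for y
    using fd frechet_derivative_works has_derivative_bounded_linear by blast
  have fc: "continuous_on UNIV f"
    using fd by (auto intro!: continuous_at_imp_continuous_on differentiable_imp_continuous_within)
  define B where "B = (\<lambda>y t. t ^ Suc m *\<^sub>R Blinfun (frechet_derivative f (at (t *\<^sub>R y))))"
  have B: "blinfun_apply (B y t) v = t ^ Suc m *\<^sub>R frechet_derivative f (at (t *\<^sub>R y)) v" for y t v
    by (simp add: B_def scaleR_blinfun.rep_eq bounded_linear_Blinfun_apply[OF fl])
  have contB: "continuous_on S (\<lambda>(y, t). B y t)" for S
  proof (rule continuous_on_blinfun_componentwise)
    fix i :: 'a
    have "continuous_on UNIV (\<lambda>y. frechet_derivative f (at y) i)" using assms by simp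
    from continuous_scaled[OF this, of S "Suc m"]
    show "continuous_on S (\<lambda>z. blinfun_apply (case z of (y, t) \<Rightarrow> B y t) i)"
      by (simp add: split_beta B)
  qed
  have "((\<lambda>y. integral (cbox 0 1) (\<lambda>t. t ^ m *\<^sub>R f (t *\<^sub>R y))) has_derivative
      blinfun_apply (integral (cbox 0 1) (B x))) (at x within UNIV)"
  proof (rule leibniz_rule)
    fix y and t :: real
    have "(f has_derivative frechet_derivative f (at (t *\<^sub>R y))) (at (t *\<^sub>R y))"
      using fd frechet_derivative_works by blast
    then have "((\<lambda>y. f (t *\<^sub>R y)) has_derivative (\<lambda>v. frechet_derivative f (at (t *\<^sub>R y)) (t *\<^sub>R v))) (at y)"
      by (rule has_derivative_compose[rotated]) (auto intro!: derivative_eq_intros)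
    then have "((\<lambda>y. t ^ m *\<^sub>R f (t *\<^sub>R y)) has_derivative
        (\<lambda>v. t ^ m *\<^sub>R frechet_derivative f (at (t *\<^sub>R y)) (t *\<^sub>R v))) (at y)"
      by (rule has_derivative_scaleR_right)
    moreover have "(\<lambda>v. t ^ m *\<^sub>R frechet_derivative f (at (t *\<^sub>R y)) (t *\<^sub>R v)) = blinfun_apply (B y t)"
      by (rule ext) (simp add: B linear_scale[OF bounded_linear.linear[OF fl]] mult_ac)
    ultimately show "((\<lambda>y. t ^ m *\<^sub>R f (t *\<^sub>R y)) has_derivative blinfun_apply (B y t)) (at y within UNIV)"
      by simp
  next
    show "(\<lambda>t. t ^ m *\<^sub>R f (t *\<^sub>R y)) integrable_on cbox 0 (1::real)" for y
      using radial_integrable[OF fc] by (simp add: cbox_interval)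
  qed (auto intro: contB)
  moreover have "blinfun_apply (integral (cbox 0 1) (B x))
      = (\<lambda>v. radial_integral (Suc m) (\<lambda>y. frechet_derivative f (at y) v) x)"
  proof
    fix v
    have "B x integrable_on cbox 0 1"
      by (intro integrable_continuous continuous_on_compose2[OF contB[of UNIV], of _ "\<lambda>t. (x, t)", simplified]
          continuous_intros)
    then have "blinfun_apply (integral (cbox 0 1) (B x)) v = integral (cbox 0 1) (\<lambda>t. blinfun_apply (B x t) v)"
      by (rule blinfun_apply_integral)
    then show "blinfun_apply (integral (cbox 0 1) (B x)) v
      = radial_integral (Suc m) (\<lambda>y. frechet_derivative f (at y) v) x"
      by (simp add: B radial_integral_def cbox_interval)
  qed
  moreover have "radial_integral m f = (\<lambda>y. integral (cbox 0 1) (\<lambda>t. t ^ m *\<^sub>R f (t *\<^sub>R y)))"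
    by (simp add: radial_integral_def fun_eq_iff cbox_interval)
  ultimately show ?thesis
    by simp
qed

lemma C_k_radial_integral: "C_k k f \<Longrightarrow> C_k k (radial_integral m f)"
proof (induction k arbitrary: f m)
  case 0
  then show ?case by (simp add: radial_integral_continuous)
next
  case (Suc k)
  have "C_k (Suc 0) f"
    using Suc.prems
  proof (induction k)
    case (Suc k)
    then show ?case using C_k_SucD by blast
  qed
  note * = radial_integral_has_derivative[OF this, of m]
  show ?case using * frechet_derivative_at[OF *, symmetric] Suc
    by (auto simp: differentiable_def)
qed

lemma smooth_radial_integral: "smooth f \<Longrightarrow> smooth (radial_integral m f)"
  by (simp add: smooth_def C_k_radial_integral)

text \<open>The fundamental theorem of calculus for \<open>t \<mapsto> t\<^sup>m\<^sup>+\<^sup>1 f(t x)\<close> on \<open>[0,1]\<close>.\<close>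

lemma radial_integral_euler:
  fixes f :: "'a::euclidean_space \<Rightarrow> 'b::euclidean_space"
  assumes f: "smooth f"
  shows "der (\<lambda>x. x) (radial_integral m f) x + real (Suc m) *\<^sub>R radial_integral m f x = f x"
proof -
  let ?D = "\<lambda>y. frechet_derivative f (at y) x"
  have C1: "C_k (Suc 0) f" using f unfolding smooth_def by blast
  have int: "(\<lambda>t. t ^ Suc m *\<^sub>R ?D (t *\<^sub>R x)) integrable_on {0..1::real}"
    "(\<lambda>t. t ^ m *\<^sub>R f (t *\<^sub>R x)) integrable_on {0..1::real}"
    by (rule radial_integrable smooth_imp_continuous_on smooth_directional f)+
  have "((\<lambda>t. t ^ Suc m *\<^sub>R ?D (t *\<^sub>R x) + real (Suc m) *\<^sub>R t ^ m *\<^sub>R f (t *\<^sub>R x)) has_integral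
      1 ^ Suc m *\<^sub>R f (1 *\<^sub>R x) - 0 ^ Suc m *\<^sub>R f (0 *\<^sub>R x)) {0..1}"
  proof (rule fundamental_theorem_of_calculus)
    fix t :: real
    have "((\<lambda>t. t ^ Suc m) has_vector_derivative (real (Suc m) * t ^ m)) (at t within {0..1})"
      using DERIV_pow[of "Suc m" t "{0..1}"]
      unfolding has_real_derivative_iff_has_vector_derivative[symmetric] by simp
    moreover have "((\<lambda>t. f (t *\<^sub>R x)) has_vector_derivative ?D (t *\<^sub>R x)) (at t within {0..1})"
      using smooth_line[OF f, of 0 x] by simp
    ultimately show "((\<lambda>t. t ^ Suc m *\<^sub>R f (t *\<^sub>R x)) has_vector_derivative
        t ^ Suc m *\<^sub>R ?D (t *\<^sub>R x) + real (Suc m) *\<^sub>R t ^ m *\<^sub>R f (t *\<^sub>R x)) (at t within {0..1})"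
      using bounded_bilinear.has_vector_derivative[OF bounded_bilinear_scaleR] by fastforce
  qed simp
  then have "integral {0..1} (\<lambda>t. t ^ Suc m *\<^sub>R ?D (t *\<^sub>R x) + real (Suc m) *\<^sub>R t ^ m *\<^sub>R f (t *\<^sub>R x)) = f x"
    by (simp add: integral_unique)
  moreover have "integral {0..1} (\<lambda>t. t ^ Suc m *\<^sub>R ?D (t *\<^sub>R x) + real (Suc m) *\<^sub>R t ^ m *\<^sub>R f (t *\<^sub>R x))
      = radial_integral (Suc m) ?D x + real (Suc m) *\<^sub>R radial_integral m f x"
    unfolding radial_integral_def
    by (subst integral_add[OF int(1) integrable_cmul[OF int(2)]], subst integral_cmul) (rule refl)
  ultimately have "radial_integral (Suc m) ?D x + real (Suc m) *\<^sub>R radial_integral m f x = f x"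
    by simp
  then show ?thesis
    using der_eqI[OF radial_integral_has_derivative[OF C1, of m x], of "\<lambda>x. x"] by simp
qed

section \<open>Alternating forms\<close>

lemma alt_length: "\<alpha> \<in> alt k \<Longrightarrow> length vs \<noteq> k \<Longrightarrow> \<alpha> vs = 0"
  by (simp add: alt_def)

lemma alt_linear: "\<alpha> \<in> alt k \<Longrightarrow> length vs = k \<Longrightarrow> i < k \<Longrightarrow> linear (\<lambda>v. \<alpha> (vs[i := v]))"
  by (simp add: alt_def)

lemma alt_not_distinct: "\<alpha> \<in> alt k \<Longrightarrow> \<not> distinct vs \<Longrightarrow> \<alpha> vs = 0"
  by (cases "length vs = k") (auto simp: alt_def)

lemma alt_repeat:
  "\<alpha> \<in> alt k \<Longrightarrow> i < length vs \<Longrightarrow> j < length vs \<Longrightarrow> i \<noteq> j \<Longrightarrow> vs ! i = vs ! j \<Longrightarrow> \<alpha> vs = 0"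
  by (rule alt_not_distinct) (auto simp: distinct_conv_nth)

lemma altI:
  assumes "\<And>vs. length vs \<noteq> k \<Longrightarrow> \<alpha> vs = 0"
    and "\<And>vs i. length vs = k \<Longrightarrow> i < k \<Longrightarrow> linear (\<lambda>v. \<alpha> (vs[i := v]))"
    and "\<And>vs i j. length vs = k \<Longrightarrow> i < k \<Longrightarrow> j < k \<Longrightarrow> i \<noteq> j \<Longrightarrow> vs ! i = vs ! j \<Longrightarrow> \<alpha> vs = 0"
  shows "\<alpha> \<in> alt k"
  unfolding alt_def using assms by (auto simp: distinct_conv_nth)

lemma subspace_alt: "subspace (alt k)"
  unfolding subspace_def alt_def
  by (auto intro: linear_compose_add linear_compose_scale_right linear_zero)

lemma alt_0 [simp]: "0 \<in> alt k"
  by (rule subspace_0[OF subspace_alt])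
lemma alt_add: "\<alpha> \<in> alt k \<Longrightarrow> \<beta> \<in> alt k \<Longrightarrow> \<alpha> + \<beta> \<in> alt k"
  by (rule subspace_add[OF subspace_alt])
lemma alt_diff: "\<alpha> \<in> alt k \<Longrightarrow> \<beta> \<in> alt k \<Longrightarrow> \<alpha> - \<beta> \<in> alt k"
  by (rule subspace_diff[OF subspace_alt])
lemma alt_minus: "\<alpha> \<in> alt k \<Longrightarrow> - \<alpha> \<in> alt k"
  by (rule subspace_neg[OF subspace_alt])
lemma alt_scale: "\<alpha> \<in> alt k \<Longrightarrow> c *\<^sub>R \<alpha> \<in> alt k"
  by (rule subspace_scale[OF subspace_alt])
lemma alt_sum: "(\<And>i. i \<in> I \<Longrightarrow> \<alpha> i \<in> alt k) \<Longrightarrow> (\<Sum>i\<in>I. \<alpha> i) \<in> alt k"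
  by (rule subspace_sum[OF subspace_alt])

lemmas alt_intros = alt_0 alt_add alt_diff alt_minus alt_scale alt_sum

lemma alt_linear_comp:
  assumes "linear h" "\<alpha> \<in> alt k"
  shows "(\<lambda>vs. h (\<alpha> vs)) \<in> alt k"
proof (rule altI)
  show "linear (\<lambda>v. h (\<alpha> (vs[i := v])))" if "length vs = k" "i < k" for vs i
    using linear_compose[OF alt_linear[OF assms(2) that] assms(1)] by (simp add: o_def)
qed (use assms in \<open>simp_all add: alt_length linear_0 alt_repeat\<close>)

lemma contract_alt: "\<alpha> \<in> alt (Suc k) \<Longrightarrow> contract v \<alpha> \<in> alt k"
  unfolding contract_def
  using alt_linear[of \<alpha> "Suc k" "v # vs" "Suc i" for vs i] alt_repeat[of \<alpha> "Suc k" "Suc i" "v # vs" "Suc j" for i j vs]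
  by (auto intro!: altI simp: alt_length)

lemma contract_alt_0: "\<alpha> \<in> alt 0 \<Longrightarrow> contract v \<alpha> = 0"
  by (simp add: contract_def fun_eq_iff alt_length)

lemma contract_alt': "\<alpha> \<in> alt k \<Longrightarrow> contract v \<alpha> \<in> alt (k - 1)"
  by (cases k) (auto simp: contract_alt contract_alt_0)

lemma contract_add: "contract v (\<alpha> + \<beta>) = contract v \<alpha> + contract v \<beta>"
  by (simp add: contract_def fun_eq_iff)
lemma contract_diff: "contract v (\<alpha> - \<beta>) = contract v \<alpha> - contract v \<beta>"
  by (simp add: contract_def fun_eq_iff)
lemma contract_scale: "contract v (c *\<^sub>R \<alpha>) = c *\<^sub>R contract v \<alpha>"
  by (simp add: contract_def fun_eq_iff)
lemma contract_sum: "contract v (\<Sum>i\<in>I. \<alpha> i) = (\<Sum>i\<in>I. contract v (\<alpha> i))"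
  by (simp add: contract_def fun_eq_iff)
lemma contract_zero [simp]: "contract v 0 = 0"
  by (simp add: contract_def fun_eq_iff)
lemma contract_minus: "contract v (- \<alpha>) = - contract v \<alpha>"
  by (simp add: contract_def fun_eq_iff)

text \<open>An argument list is either empty or has a first entry. This is the principle behind all inductions on
the degree.\<close>

lemma form_eqI: "\<alpha> [] = \<beta> [] \<Longrightarrow> (\<And>v. contract v \<alpha> = contract v \<beta>) \<Longrightarrow> \<alpha> = \<beta>"
proof (rule ext)
  fix vs assume "\<alpha> [] = \<beta> []" "\<And>v. contract v \<alpha> = contract v \<beta>"
  then show "\<alpha> vs = \<beta> vs" by (cases vs) (auto simp: contract_def fun_eq_iff)
qed

text \<open>Polarisation: put the sum of the two vectors into both slots and expand.\<close>

lemma alt_swap: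
  assumes \<alpha>: "\<alpha> \<in> alt k" and len: "length vs = k" and ij: "i < k" "j < k" "i \<noteq> j"
  shows "\<alpha> (vs[i := vs ! j, j := vs ! i]) = - \<alpha> vs"
proof -
  let ?g = "\<lambda>a b. \<alpha> (vs[i := a, j := b])"
  have 2: "linear (\<lambda>b. ?g a b)" for a
    using alt_linear[OF \<alpha>, of "vs[i := a]" j] len ij by simp
  have 1: "linear (\<lambda>a. ?g a b)" for b
    using alt_linear[OF \<alpha>, of "vs[j := b]" i] len ij by (simp add: list_update_swap)
  have 0: "?g a a = 0" for a
  proof (rule alt_not_distinct[OF \<alpha>])
    have "vs[i := a, j := a] ! i = vs[i := a, j := a] ! j"
      using len ij by simp
    then show "\<not> distinct (vs[i := a, j := a])"
      using len ij by (metis length_list_update nth_eq_iff_index_eq)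
  qed
  have "?g (a + b) (a + b) = (?g a a + ?g a b) + (?g b a + ?g b b)" for a b
    by (simp add: linear_add[OF 1] linear_add[OF 2] add_ac)
  then have "?g a b + ?g b a = 0" for a b
    using 0 by (metis add.left_neutral add.right_neutral)
  then have "?g (vs ! i) (vs ! j) + ?g (vs ! j) (vs ! i) = 0"
    .
  then show ?thesis
    by (simp add: eq_neg_iff_add_eq_0 add.commute)
qed

lemma permute_list_transpose:
  assumes "i < length xs" "j < length xs"
  shows "permute_list (Transposition.transpose i j) xs = xs[i := xs ! j, j := xs ! i]"
  using assms by (intro nth_equalityI) (auto simp: permute_list_def Transposition.transpose_def nth_list_update)


section \<open>The wedge product\<close>

definition wedge_term ::
  "nat \<Rightarrow> ('v list \<Rightarrow> real) \<Rightarrow> ('v list \<Rightarrow> 'b::real_vector) \<Rightarrow> 'v list \<Rightarrow> (nat \<Rightarrow> nat) \<Rightarrow> 'b"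
  where "wedge_term k \<alpha> \<beta> vs \<sigma> = (of_int (sign \<sigma>) * \<alpha> (take k (permute_list \<sigma> vs))) *\<^sub>R
    \<beta> (drop k (permute_list \<sigma> vs))"

lemma wedge_eq: "length vs = k + l \<Longrightarrow>
    wedge k l \<alpha> \<beta> vs = (1 / (fact k * fact l)) *\<^sub>R (\<Sum>\<sigma> | \<sigma> permutes {..<k + l}. wedge_term k \<alpha> \<beta> vs \<sigma>)"
  by (simp add: wedge_def wedge_term_def)

lemma sign_compose_transpose:
  "\<sigma> permutes S \<Longrightarrow> finite S \<Longrightarrow> i \<noteq> j \<Longrightarrow> sign (\<sigma> \<circ> Transposition.transpose i j) = - sign \<sigma>"
  using permutes_imp_permutation[of S \<sigma>] by (simp add: sign_compose sign_swap_id permutation_swap_id)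

lemma sign_transpose_compose:
  "\<sigma> permutes S \<Longrightarrow> finite S \<Longrightarrow> i \<noteq> j \<Longrightarrow> sign (Transposition.transpose i j \<circ> \<sigma>) = - sign \<sigma>"
  using permutes_imp_permutation[of S \<sigma>] by (simp add: sign_compose sign_swap_id permutation_swap_id)

lemma permute_list_update:
  assumes "\<sigma> permutes {..<length vs}" "i < length vs"
  shows "permute_list \<sigma> (vs[i := v]) = (permute_list \<sigma> vs)[inv \<sigma> i := v]"
proof (rule nth_equalityI)
  fix m assume "m < length (permute_list \<sigma> (vs[i := v]))"
  then have m: "m < length vs" by simp
  have \<sigma>m: "\<sigma> m < length vs" using permutes_in_image[OF assms(1), of m] m by simp
  have "inv \<sigma> i < length vs" using permutes_in_image[OF permutes_inv[OF assms(1)], of i] assms(2) by simp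
  moreover have "\<sigma> m = i \<longleftrightarrow> m = inv \<sigma> i"
    using permutes_inverses[OF assms(1)] by metis
  ultimately show "permute_list \<sigma> (vs[i := v]) ! m = (permute_list \<sigma> vs)[inv \<sigma> i := v] ! m"
    using m \<sigma>m assms by (auto simp: permute_list_nth nth_list_update)
qed simp

lemma wedge_term_linear:
  assumes \<alpha>: "\<alpha> \<in> alt k" and \<beta>: "\<beta> \<in> alt l" and len: "length vs = k + l"
    and \<sigma>: "\<sigma> permutes {..<k + l}" and i: "i < k + l"
  shows "linear (\<lambda>v. wedge_term k \<alpha> \<beta> (vs[i := v]) \<sigma>)"
proof -
  let ?j = "inv \<sigma> i" and ?ys = "permute_list \<sigma> vs"
  have ys: "permute_list \<sigma> (vs[i := v]) = ?ys[?j := v]" for v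
    using permute_list_update \<sigma> len i by metis
  have j: "?j < k + l" using permutes_in_image[OF permutes_inv[OF \<sigma>], of i] i by simp
  show ?thesis
  proof (cases "?j < k")
    case True
    have "linear (\<lambda>v. \<alpha> ((take k ?ys)[?j := v]))"
      using alt_linear[OF \<alpha>, of "take k ?ys" ?j] True len by simp
    from linear_add[OF this] linear_scale[OF this] True show ?thesis
      by (intro linearI) (simp_all add: wedge_term_def ys take_update_swap algebra_simps)
  next
    case False
    have "linear (\<lambda>v. \<beta> ((drop k ?ys)[?j - k := v]))"
      using alt_linear[OF \<beta>, of "drop k ?ys" "?j - k"] False len j by simp
    from linear_add[OF this] linear_scale[OF this] False show ?thesis
      by (intro linearI) (simp_all add: wedge_term_def ys drop_update_swap algebra_simps)
  qed
qed

text \<open>If two arguments agree, exchanging their positions leaves the argument list unchanged but reverses the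
sign of each permutation, so the sum is equal to its own negative.\<close>

lemma wedge_alt:
  assumes \<alpha>: "\<alpha> \<in> alt k" and \<beta>: "\<beta> \<in> alt l"
  shows "wedge k l \<alpha> \<beta> \<in> alt (k + l)"
proof (rule altI)
  fix vs :: "'a list" and i assume len: "length vs = k + l" and i: "i < k + l"
  have "linear (\<lambda>v. (1 / (fact k * fact l)) *\<^sub>R
      (\<Sum>\<sigma> | \<sigma> permutes {..<k + l}. wedge_term k \<alpha> \<beta> (vs[i := v]) \<sigma>))"
    by (intro linear_compose_scale_right linear_compose_sum ballI)
      (auto intro: wedge_term_linear[OF \<alpha> \<beta> len _ i])
  then show "linear (\<lambda>v. wedge k l \<alpha> \<beta> (vs[i := v]))"
    using len by (simp add: wedge_eq)
next
  fix vs :: "'a list" and i j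
  assume len: "length vs = k + l" and ij: "i < k + l" "j < k + l" "i \<noteq> j" and eq: "vs ! i = vs ! j"
  let ?P = "{\<sigma>. \<sigma> permutes {..<k + l}}"
  let ?S = "\<Sum>\<sigma>\<in>?P. wedge_term k \<alpha> \<beta> vs \<sigma>"
  have "permute_list (Transposition.transpose i j) vs = vs"
    using ij len eq by (simp add: permute_list_transpose) (metis list_update_id)
  then have "wedge_term k \<alpha> \<beta> vs (Transposition.transpose i j \<circ> \<sigma>) = - wedge_term k \<alpha> \<beta> vs \<sigma>" if "\<sigma> permutes {..<k + l}" for \<sigma>
    using that ij len by (simp add: wedge_term_def sign_transpose_compose[OF that] permute_list_compose)
  then have "?S = - ?S"
    by (subst setum_permutations_compose_left[OF permutes_swap_id[of i "{..<k + l}" j]])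
      (use ij in \<open>simp_all add: sum_negf\<close>)
  then have "2 *\<^sub>R ?S = 0" unfolding scaleR_2 by (metis add.right_inverse)
  then have "?S = 0" by simp
  then show "wedge k l \<alpha> \<beta> vs = 0" using len by (simp add: wedge_eq)
qed (simp add: wedge_def)

definition shift_perm :: "nat \<Rightarrow> (nat \<Rightarrow> nat) \<Rightarrow> nat \<Rightarrow> nat"
  where "shift_perm m \<tau> = map_permutation {..<m} Suc \<tau>"

lemma shift_perm:
  assumes "\<tau> permutes {..<m}"
  shows "shift_perm m \<tau> permutes {..<Suc m}" "shift_perm m \<tau> 0 = 0"
    "sign (shift_perm m \<tau>) = sign \<tau>"
    "length ws = m \<Longrightarrow> permute_list (shift_perm m \<tau>) (v # ws) = v # permute_list \<tau> ws"
proof -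
  have p: "shift_perm m \<tau> permutes Suc ` {..<m}"
    unfolding shift_perm_def by (intro map_permutation_permutes assms) (simp add: bij_betw_def)
  show "shift_perm m \<tau> permutes {..<Suc m}"
    by (rule permutes_subset[OF p]) auto
  show 0: "shift_perm m \<tau> 0 = 0"
    by (rule permutes_not_in[OF p]) auto
  show "sign (shift_perm m \<tau>) = sign \<tau>"
    unfolding shift_perm_def by (rule sign_map_permutation) (use assms in auto)
  have "shift_perm m \<tau> (Suc i) = Suc (\<tau> i)" if "i < m" for i
    unfolding shift_perm_def using that by (intro map_permutation_apply) auto
  then show "permute_list (shift_perm m \<tau>) (v # ws) = v # permute_list \<tau> ws" if "length ws = m"
    using that 0
    by (intro nth_equalityI) (auto simp: permute_list_def less_Suc_eq_0_disj simp del: upt_Suc)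
qed

text \<open>The summands of the wedge product in which the first argument stays in the first slot are indexed by
the permutations of the remaining arguments.\<close>

lemma bij_betw_shift_perm:
  "bij_betw (shift_perm m) {\<tau>. \<tau> permutes {..<m}} {\<sigma>. \<sigma> permutes {..<Suc m} \<and> \<sigma> 0 = 0}"
proof (rule bij_betw_byWitness[where f' = "map_permutation (Suc ` {..<m}) (\<lambda>i. i - 1)"])
  have b: "bij_betw Suc {..<m} (Suc ` {..<m})"
    by (simp add: bij_betw_def)
  have b': "bij_betw (\<lambda>i. i - 1) (Suc ` {..<m}) {..<m}"
    by (rule bij_betwI[where g = Suc]) auto
  have sub: "\<sigma> permutes Suc ` {..<m}" if "\<sigma> permutes {..<Suc m}" "\<sigma> 0 = 0" for \<sigma>
  proof (rule permutes_superset[OF that(1)])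
    fix x assume "x \<in> {..<Suc m} - Suc ` {..<m}"
    then have "x = 0" by (cases x) auto
    then show "\<sigma> x = x" using that(2) by simp
  qed
  show "\<forall>\<tau>\<in>{\<tau>. \<tau> permutes {..<m}}. map_permutation (Suc ` {..<m}) (\<lambda>i. i - 1) (shift_perm m \<tau>) = \<tau>"
    unfolding shift_perm_def using map_permutation_compose_inv[OF b] by auto
  show "\<forall>\<sigma>\<in>{\<sigma>. \<sigma> permutes {..<Suc m} \<and> \<sigma> 0 = 0}.
      shift_perm m (map_permutation (Suc ` {..<m}) (\<lambda>i. i - 1) \<sigma>) = \<sigma>"
  proof (intro ballI)
    fix \<sigma> assume "\<sigma> \<in> {\<sigma>. \<sigma> permutes {..<Suc m} \<and> \<sigma> 0 = 0}"
    then have "\<sigma> permutes Suc ` {..<m}" using sub by blast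
    then show "shift_perm m (map_permutation (Suc ` {..<m}) (\<lambda>i. i - 1) \<sigma>) = \<sigma>"
      unfolding shift_perm_def by (rule map_permutation_compose_inv[OF b']) auto
  qed
  show "shift_perm m ` {\<tau>. \<tau> permutes {..<m}} \<subseteq> {\<sigma>. \<sigma> permutes {..<Suc m} \<and> \<sigma> 0 = 0}"
    using shift_perm by auto
  show "map_permutation (Suc ` {..<m}) (\<lambda>i. i - 1) ` {\<sigma>. \<sigma> permutes {..<Suc m} \<and> \<sigma> 0 = 0} \<subseteq> {\<tau>. \<tau> permutes {..<m}}"
    using map_permutation_permutes[OF b' sub] by auto
qed

text \<open>The permutation that moves the first entry of a list to position \<open>k\<close>.\<close>

primrec move_first :: "nat \<Rightarrow> nat \<Rightarrow> nat" where
  "move_first 0 = id"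
| "move_first (Suc k) = move_first k \<circ> Transposition.transpose k (Suc k)"

lemma move_first:
  assumes "k < N"
  shows "move_first k permutes {..<N}" "move_first k k = 0" "sign (move_first k) = (- 1) ^ k"
    "length (v # ws) = N \<Longrightarrow> permute_list (move_first k) (v # ws) = take k ws @ v # drop k ws"
proof -
  have "move_first k permutes {..<N} \<and> move_first k k = 0 \<and> sign (move_first k) = (- 1) ^ k \<and>
    (length (v # ws) = N \<longrightarrow> permute_list (move_first k) (v # ws) = take k ws @ v # drop k ws)"
    using assms
  proof (induction k)
    case 0
    then show ?case using permutes_id[of "{..<N}"] by (simp add: id_def)
  next
    case (Suc k)
    have t: "Transposition.transpose k (Suc k) permutes {..<N}" using Suc.prems by (intro permutes_swap_id) auto
    have "permute_list (move_first k \<circ> Transposition.transpose k (Suc k)) (v # ws) = take (Suc k) ws @ v # drop (Suc k) ws"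
      if len: "length (v # ws) = N"
    proof -
      let ?ys = "take k ws @ v # drop k ws"
      have l: "length (take k ws) = k" "length ?ys = N" "k < length ws" using len Suc.prems by auto
      have "permute_list (move_first k \<circ> Transposition.transpose k (Suc k)) (v # ws)
          = permute_list (Transposition.transpose k (Suc k)) (permute_list (move_first k) (v # ws))"
        using t len by (intro permute_list_compose) simp
      also have "\<dots> = permute_list (Transposition.transpose k (Suc k)) ?ys"
        using Suc len by simp
      also have "\<dots> = ?ys[k := ?ys ! Suc k, Suc k := ?ys ! k]"
        using l Suc.prems by (intro permute_list_transpose) auto
      also have "\<dots> = take k ws @ ws ! k # v # drop (Suc k) ws"
        using l by (simp add: list_update_append nth_append Cons_nth_drop_Suc[symmetric])
      finally show ?thesis using l by (simp add: take_Suc_conv_app_nth)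
    qed
    moreover have "move_first k \<circ> Transposition.transpose k (Suc k) permutes {..<N}"
      using Suc t by (intro permutes_compose) auto
    moreover have "sign (move_first k \<circ> Transposition.transpose k (Suc k)) = (- 1) ^ Suc k"
      using Suc by (subst sign_compose_transpose[of _ "{..<N}"]) auto
    moreover have "(move_first k \<circ> Transposition.transpose k (Suc k)) (Suc k) = 0"
      using Suc by simp
    ultimately show ?case
      unfolding move_first.simps by blast
  qed
  then show "move_first k permutes {..<N}" "move_first k k = 0" "sign (move_first k) = (- 1) ^ k"
    "length (v # ws) = N \<Longrightarrow> permute_list (move_first k) (v # ws) = take k ws @ v # drop k ws"
    by auto
qed

lemma sum_perm_slice:
  fixes f :: "(nat \<Rightarrow> nat) \<Rightarrow> 'b::comm_monoid_add"
  assumes c: "c permutes {..<N}" and p: "c p = q"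
  shows "(\<Sum>\<sigma> | \<sigma> permutes {..<N} \<and> \<sigma> p = i. f \<sigma>) = (\<Sum>\<sigma> | \<sigma> permutes {..<N} \<and> \<sigma> q = i. f (\<sigma> \<circ> c))"
proof (rule sum.reindex_bij_witness[where j = "\<lambda>\<sigma>. \<sigma> \<circ> inv c" and i = "\<lambda>\<sigma>. \<sigma> \<circ> c"])
  have ip: "inv c q = p" using c p permutes_inverses(2) by metis
  fix \<sigma> :: "nat \<Rightarrow> nat"
  show "\<sigma> \<circ> inv c \<circ> c = \<sigma>" "\<sigma> \<circ> c \<circ> inv c = \<sigma>"
    using c by (simp_all add: o_assoc[symmetric] permutes_inv_o)
  then show "f (\<sigma> \<circ> inv c \<circ> c) = f \<sigma>" by simp
  show "\<sigma> \<circ> inv c \<in> {\<sigma>. \<sigma> permutes {..<N} \<and> \<sigma> q = i}"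
    if "\<sigma> \<in> {\<sigma>. \<sigma> permutes {..<N} \<and> \<sigma> p = i}"
    using that ip c by (auto intro: permutes_compose permutes_inv)
  show "\<sigma> \<circ> c \<in> {\<sigma>. \<sigma> permutes {..<N} \<and> \<sigma> p = i}"
    if "\<sigma> \<in> {\<sigma>. \<sigma> permutes {..<N} \<and> \<sigma> q = i}"
    using that p c by (auto intro: permutes_compose)
qed

lemma wedge_term_swap:
  assumes \<alpha>: "\<alpha> \<in> alt k" and \<beta>: "\<beta> \<in> alt l" and len: "length vs = k + l"
    and \<sigma>: "\<sigma> permutes {..<k + l}"
    and pq: "p < k \<and> q < k \<or> k \<le> p \<and> k \<le> q \<and> p < k + l \<and> q < k + l"
  shows "wedge_term k \<alpha> \<beta> vs (\<sigma> \<circ> Transposition.transpose p q) = wedge_term k \<alpha> \<beta> vs \<sigma>"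
proof (cases "p = q")
  case False
  let ?ys = "permute_list \<sigma> vs"
  have lys: "length ?ys = k + l" using len by simp
  have "permute_list (\<sigma> \<circ> Transposition.transpose p q) vs = permute_list (Transposition.transpose p q) ?ys"
    using len pq by (intro permute_list_compose permutes_swap_id) auto
  also have "\<dots> = ?ys[p := ?ys ! q, q := ?ys ! p]"
    using len pq by (intro permute_list_transpose) auto
  finally have ys: "permute_list (\<sigma> \<circ> Transposition.transpose p q) vs = ?ys[p := ?ys ! q, q := ?ys ! p]" .
  from pq show ?thesis
  proof
    assume pq: "p < k \<and> q < k"
    then have "\<alpha> (take k (?ys[p := ?ys ! q, q := ?ys ! p])) = - \<alpha> (take k ?ys)"
      using alt_swap[OF \<alpha>, of "take k ?ys" p q] lys False by (simp add: take_update_swap)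
    then show ?thesis
      using pq by (simp add: wedge_term_def ys sign_compose_transpose[OF \<sigma> _ False])
  next
    assume pq: "k \<le> p \<and> k \<le> q \<and> p < k + l \<and> q < k + l"
    then have "\<beta> (drop k (?ys[p := ?ys ! q, q := ?ys ! p])) = - \<beta> (drop k ?ys)"
      using alt_swap[OF \<beta>, of "drop k ?ys" "p - k" "q - k"] lys False
      by (auto simp: drop_update_swap)
    then show ?thesis
      using pq by (simp add: wedge_term_def ys sign_compose_transpose[OF \<sigma> _ False])
  qed
qed simp

text \<open>All slots of the same factor contribute equally, since the factor is alternating.\<close>

lemma wedge_term_slice:
  assumes \<alpha>: "\<alpha> \<in> alt k" and \<beta>: "\<beta> \<in> alt l" and len: "length vs = k + l"
    and pq: "p < k \<and> q < k \<or> k \<le> p \<and> k \<le> q \<and> p < k + l \<and> q < k + l"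
  shows "(\<Sum>\<sigma> | \<sigma> permutes {..<k + l} \<and> \<sigma> p = i. wedge_term k \<alpha> \<beta> vs \<sigma>)
    = (\<Sum>\<sigma> | \<sigma> permutes {..<k + l} \<and> \<sigma> q = i. wedge_term k \<alpha> \<beta> vs \<sigma>)"
proof -
  have "Transposition.transpose p q permutes {..<k + l}" using pq by (intro permutes_swap_id) auto
  then have "(\<Sum>\<sigma> | \<sigma> permutes {..<k + l} \<and> \<sigma> p = i. wedge_term k \<alpha> \<beta> vs \<sigma>)
      = (\<Sum>\<sigma> | \<sigma> permutes {..<k + l} \<and> \<sigma> q = i. wedge_term k \<alpha> \<beta> vs (\<sigma> \<circ> Transposition.transpose p q))"
    by (rule sum_perm_slice) simp
  also have "\<dots> = (\<Sum>\<sigma> | \<sigma> permutes {..<k + l} \<and> \<sigma> q = i. wedge_term k \<alpha> \<beta> vs \<sigma>)"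
    by (intro sum.cong refl wedge_term_swap[OF \<alpha> \<beta> len _ pq]) simp
  finally show ?thesis .
qed

text \<open>Sort the permutations by the slot \<open>p\<close> that receives \<open>v\<close>. The \<open>k\<close> slots of \<open>\<alpha>\<close> contribute equally, and so do
the \<open>l\<close> slots of \<open>\<beta>\<close>; the factors \<open>k\<close> and \<open>l\<close> turn \<open>1/(k! l!)\<close> into the normalisations of the two products
on the right. The sign is that of moving \<open>v\<close> past the \<open>k\<close> arguments of \<open>\<alpha>\<close>. For \<open>k = 0\<close> or \<open>l = 0\<close> the truncated
degree is harmless, because the contraction of a form of degree 0 is zero.\<close>

lemma contract_wedge:
  assumes \<alpha>: "\<alpha> \<in> alt k" and \<beta>: "\<beta> \<in> alt l"
  shows "contract v (wedge k l \<alpha> \<beta>)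
    = wedge (k - 1) l (contract v \<alpha>) \<beta> + (-1) ^ k *\<^sub>R wedge k (l - 1) \<alpha> (contract v \<beta>)"
proof
  fix ws
  show "contract v (wedge k l \<alpha> \<beta>) ws
    = (wedge (k - 1) l (contract v \<alpha>) \<beta> + (-1) ^ k *\<^sub>R wedge k (l - 1) \<alpha> (contract v \<beta>)) ws"
  proof (cases "Suc (length ws) = k + l")
    case False
    have "wedge (k - 1) l (contract v \<alpha>) \<beta> ws = 0"
    proof (cases k)
      case 0
      then show ?thesis using \<alpha> by (simp add: contract_alt_0 wedge_def)
    qed (use False in \<open>simp add: wedge_def\<close>)
    moreover have "wedge k (l - 1) \<alpha> (contract v \<beta>) ws = 0"
    proof (cases l)
      case 0
      then show ?thesis using \<beta> by (simp add: contract_alt_0 wedge_def)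
    qed (use False in \<open>simp add: wedge_def\<close>)
    ultimately show ?thesis
      using False by (simp add: contract_def wedge_def)
  next
    case True
    define m where "m = length ws"
    have len: "length (v # ws) = k + l" and m: "k + l = Suc m" using True by (auto simp: m_def)
    define T where "T = wedge_term k \<alpha> \<beta> (v # ws)"
    \<comment> \<open>the contribution of the permutations that put \<open>v\<close> into slot \<open>p\<close>\<close>
    define S where "S = (\<lambda>p. \<Sum>\<sigma> | \<sigma> permutes {..<k + l} \<and> \<sigma> p = 0. T \<sigma>)"
    have fin: "finite {\<sigma>. \<sigma> permutes {..<k + l}}" by (simp add: finite_permutations)
    have "(\<Sum>\<sigma> | \<sigma> permutes {..<k + l}. T \<sigma>)
        = (\<Sum>p<k + l. \<Sum>\<sigma> | \<sigma> \<in> {\<sigma>. \<sigma> permutes {..<k + l}} \<and> inv \<sigma> 0 = p. T \<sigma>)"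
    proof (rule sum.group[OF fin, symmetric])
      show "(\<lambda>\<sigma>. inv \<sigma> 0) ` {\<sigma>. \<sigma> permutes {..<k + l}} \<subseteq> {..<k + l}"
        using permutes_in_image[OF permutes_inv, of _ "{..<k + l}" 0] m by auto
    qed simp
    also have "\<dots> = (\<Sum>p<k + l. S p)"
      unfolding S_def by (intro sum.cong refl) (auto simp: permutes_inv_eq permutes_inverses(1))
    also have "\<dots> = (\<Sum>p<k. S p) + (\<Sum>p=k..<k + l. S p)"
      by (simp add: lessThan_atLeast0 sum.atLeastLessThan_concat)
    also have "(\<Sum>p<k. S p) = real k *\<^sub>R S 0"
    proof -
      have S0: "S p = S 0" if "p < k" for p
        unfolding S_def T_def by (rule wedge_term_slice[OF \<alpha> \<beta> len]) (use that in simp)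
      have "(\<Sum>p<k. S p) = (\<Sum>p<k. S 0)" by (rule sum.cong[OF refl S0]) simp
      then show ?thesis by (simp add: sum_constant_scaleR)
    qed
    also have "(\<Sum>p=k..<k + l. S p) = real l *\<^sub>R S k"
    proof -
      have Sk: "S p = S k" if "p \<in> {k..<k + l}" for p
        unfolding S_def T_def by (rule wedge_term_slice[OF \<alpha> \<beta> len]) (use that in simp)
      have "(\<Sum>p=k..<k + l. S p) = (\<Sum>p=k..<k + l. S k)" by (rule sum.cong[OF refl Sk])
      then show ?thesis by (simp add: sum_constant_scaleR)
    qed
    finally have total: "(\<Sum>\<sigma> | \<sigma> permutes {..<k + l}. T \<sigma>) = real k *\<^sub>R S 0 + real l *\<^sub>R S k" .
    have slice: "(\<Sum>\<sigma> | \<sigma> permutes {..<k + l} \<and> \<sigma> 0 = 0. g \<sigma>)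
        = (\<Sum>\<tau> | \<tau> permutes {..<m}. g (shift_perm m \<tau>))" for g :: "(nat \<Rightarrow> nat) \<Rightarrow> 'b"
      using sum.reindex_bij_betw[OF bij_betw_shift_perm[of m], of g] m by simp
    have first: "(real k / (fact k * fact l)) *\<^sub>R S 0 = wedge (k - 1) l (contract v \<alpha>) \<beta> ws"
    proof (cases k)
      case 0
      then show ?thesis using \<alpha> by (simp add: contract_alt_0 wedge_def)
    next
      case (Suc k')
      have T: "T (shift_perm m \<tau>) = wedge_term k' (contract v \<alpha>) \<beta> ws \<tau>" if \<tau>: "\<tau> permutes {..<m}" for \<tau>
      proof -
        have "permute_list (shift_perm m \<tau>) (v # ws) = v # permute_list \<tau> ws"
          by (rule shift_perm(4)[OF \<tau>]) (simp add: m_def)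
        then show ?thesis
          by (simp add: T_def wedge_term_def contract_def Suc shift_perm(3)[OF \<tau>])
      qed
      have "S 0 = (\<Sum>\<tau> | \<tau> permutes {..<k' + l}. wedge_term k' (contract v \<alpha>) \<beta> ws \<tau>)"
        unfolding S_def slice using m Suc by (intro sum.cong T) auto
      moreover have "real k / (fact k * fact l) = 1 / (fact k' * fact l)"
        using Suc by (simp add: divide_simps mult_ac del: of_nat_Suc)
      ultimately show ?thesis
        using m Suc by (simp add: wedge_eq m_def)
    qed
    have second: "(real l / (fact k * fact l)) *\<^sub>R S k = ((-1) ^ k *\<^sub>R wedge k (l - 1) \<alpha> (contract v \<beta>)) ws"
    proof (cases l)
      case 0
      then show ?thesis using \<beta> by (simp add: contract_alt_0 wedge_def)
    next
      case (Suc l')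
      then have k: "k < k + l" by simp
      note mf = move_first[OF k]
      have T: "T (shift_perm m \<tau> \<circ> move_first k) = (-1) ^ k *\<^sub>R wedge_term k \<alpha> (contract v \<beta>) ws \<tau>"
        if \<tau>: "\<tau> permutes {..<m}" for \<tau>
      proof -
        have "permute_list (shift_perm m \<tau> \<circ> move_first k) (v # ws)
            = permute_list (move_first k) (v # permute_list \<tau> ws)"
        proof (subst permute_list_compose)
          show "move_first k permutes {..<length (v # ws)}" using mf(1) len by simp
          have "permute_list (shift_perm m \<tau>) (v # ws) = v # permute_list \<tau> ws"
            by (rule shift_perm(4)[OF \<tau>]) (simp add: m_def)
          then show "permute_list (move_first k) (permute_list (shift_perm m \<tau>) (v # ws))
              = permute_list (move_first k) (v # permute_list \<tau> ws)" by simp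
        qed
        also have "\<dots> = take k (permute_list \<tau> ws) @ v # drop k (permute_list \<tau> ws)"
          by (rule mf(4)) (use len in simp)
        finally have "permute_list (shift_perm m \<tau> \<circ> move_first k) (v # ws) = \<dots>" .
        moreover have "sign (shift_perm m \<tau> \<circ> move_first k) = sign \<tau> * (-1) ^ k"
          using mf(1,3) shift_perm(1,3)[OF \<tau>] by (simp add: sign_compose permutes_imp_permutation[of "{..<_}"])
        moreover have "length (take k (permute_list \<tau> ws)) = k" using m Suc by (simp add: m_def)
        ultimately show ?thesis
          by (simp add: T_def wedge_term_def contract_def)
      qed
      have "S k = (\<Sum>\<sigma> | \<sigma> permutes {..<k + l} \<and> \<sigma> 0 = 0. T (\<sigma> \<circ> move_first k))"
        unfolding S_def by (rule sum_perm_slice[OF mf(1,2)])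
      also have "\<dots> = (-1) ^ k *\<^sub>R (\<Sum>\<tau> | \<tau> permutes {..<k + l'}. wedge_term k \<alpha> (contract v \<beta>) ws \<tau>)"
        unfolding slice scaleR_sum_right using m Suc by (intro sum.cong T) auto
      finally have "S k = \<dots>" .
      moreover have "real l / (fact k * fact l) = 1 / (fact k * fact l')"
        using Suc by (simp add: divide_simps mult_ac del: of_nat_Suc)
      ultimately show ?thesis
        using m Suc by (simp add: wedge_eq m_def)
    qed
    have "contract v (wedge k l \<alpha> \<beta>) ws = (1 / (fact k * fact l)) *\<^sub>R (real k *\<^sub>R S 0 + real l *\<^sub>R S k)"
      unfolding contract_def wedge_eq[OF len] total[symmetric] T_def ..
    then show ?thesis
      using first second by (simp add: scaleR_add_right)
  qed
qed

lemma wedge_add_left: "wedge k l (\<alpha> + \<alpha>') \<beta> = wedge k l \<alpha> \<beta> + wedge k l \<alpha>' \<beta>"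
  by (rule ext) (simp add: wedge_def sum.distrib scaleR_add_left scaleR_add_right distrib_left)

lemma wedge_add_right: "wedge k l \<alpha> (\<beta> + \<beta>') = wedge k l \<alpha> \<beta> + wedge k l \<alpha> \<beta>'"
  by (rule ext) (simp add: wedge_def sum.distrib scaleR_add_right)

lemma wedge_minus_right: "wedge k l \<alpha> (- \<beta>) = - wedge k l \<alpha> \<beta>"
  using wedge_scale_right[of k l _ "-1"] by simp

lemma wedge_zero_left [simp]: "wedge k l 0 \<beta> = 0"
  using wedge_scale_left[of k l 0] by simp

lemma wedge_zero_right [simp]: "wedge k l \<alpha> 0 = 0"
  using wedge_scale_right[of k l _ 0] by simp

lemma wedge_0_left:
  assumes \<alpha>: "\<alpha> \<in> alt 0"
  shows "\<beta> \<in> alt l \<Longrightarrow> wedge 0 l \<alpha> \<beta> = \<alpha> [] *\<^sub>R \<beta>"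
proof (induction l arbitrary: \<beta>)
  case 0
  show ?case
  proof (rule form_eqI)
    show "wedge 0 0 \<alpha> \<beta> [] = (\<alpha> [] *\<^sub>R \<beta>) []"
      by (simp add: wedge_def)
    show "contract v (wedge 0 0 \<alpha> \<beta>) = contract v (\<alpha> [] *\<^sub>R \<beta>)" for v
      by (simp add: contract_wedge[OF \<alpha> 0] contract_scale contract_alt_0[OF \<alpha>] contract_alt_0[OF 0])
  qed
next
  case (Suc l)
  show ?case
  proof (rule form_eqI)
    show "wedge 0 (Suc l) \<alpha> \<beta> [] = (\<alpha> [] *\<^sub>R \<beta>) []"
      by (simp add: wedge_def alt_length[OF Suc.prems])
    have "wedge 0 l \<alpha> (contract v \<beta>) = \<alpha> [] *\<^sub>R contract v \<beta>" for v
      by (rule Suc.IH[OF contract_alt[OF Suc.prems]])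
    then show "contract v (wedge 0 (Suc l) \<alpha> \<beta>) = contract v (\<alpha> [] *\<^sub>R \<beta>)" for v
      by (simp add: contract_wedge[OF \<alpha> Suc.prems] contract_scale contract_alt_0[OF \<alpha>])
  qed
qed

lemma wedge_0_right:
  assumes \<beta>: "\<beta> \<in> alt 0"
  shows "\<alpha> \<in> alt k \<Longrightarrow> wedge k 0 \<alpha> \<beta> = (\<lambda>vs. \<alpha> vs *\<^sub>R \<beta> [])"
proof (induction k arbitrary: \<alpha>)
  case 0
  have "wedge 0 0 \<alpha> \<beta> = \<alpha> [] *\<^sub>R \<beta>"
    by (rule wedge_0_left[OF 0 \<beta>])
  also have "\<dots> = (\<lambda>vs. \<alpha> vs *\<^sub>R \<beta> [])"
    using alt_length[OF 0] alt_length[OF \<beta>] by (metis length_0_conv scaleR_fun_apply scaleR_zero_left scaleR_zero_right)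
  finally show ?case .
next
  case (Suc k)
  show ?case
  proof (rule form_eqI)
    show "wedge (Suc k) 0 \<alpha> \<beta> [] = \<alpha> [] *\<^sub>R \<beta> []"
      by (simp add: wedge_def alt_length[OF Suc.prems])
    have "contract v (wedge (Suc k) 0 \<alpha> \<beta>) = (\<lambda>vs. contract v \<alpha> vs *\<^sub>R \<beta> [])" for v
      by (simp add: contract_wedge[OF Suc.prems \<beta>] contract_alt_0[OF \<beta>] Suc.IH contract_alt[OF Suc.prems])
    then show "contract v (wedge (Suc k) 0 \<alpha> \<beta>) = contract v (\<lambda>vs. \<alpha> vs *\<^sub>R \<beta> [])" for v
      by (simp add: contract_def)
  qed
qed

lemma wedge_commute:
  fixes \<alpha> \<beta> :: "'v::real_vector list \<Rightarrow> real"
  shows "\<alpha> \<in> alt k \<Longrightarrow> \<beta> \<in> alt l \<Longrightarrow> wedge k l \<alpha> \<beta> = (-1) ^ (k * l) *\<^sub>R wedge l k \<beta> \<alpha>"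
proof (induction "k + l" arbitrary: k l \<alpha> \<beta>)
  case 0
  then show ?case by (simp add: wedge_0_left fun_eq_iff scaleR_fun_def) (metis alt_length length_0_conv mult.commute mult_zero_left)
next
  case (Suc n)
  note \<alpha> = \<open>\<alpha> \<in> alt k\<close> and \<beta> = \<open>\<beta> \<in> alt l\<close>
  show ?case
  proof (rule form_eqI)
    show "wedge k l \<alpha> \<beta> [] = ((-1) ^ (k * l) *\<^sub>R wedge l k \<beta> \<alpha>) []"
      using Suc(2) by (auto simp: wedge_def)
    fix v
    have 1: "wedge (k - 1) l (contract v \<alpha>) \<beta> = ((-1) ^ (k * l) * (-1) ^ l) *\<^sub>R wedge l (k - 1) \<beta> (contract v \<alpha>)"
    proof (cases k)
      case 0
      then show ?thesis using \<alpha> by (simp add: contract_alt_0)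
    next
      case (Suc k')
      then have "wedge k' l (contract v \<alpha>) \<beta> = (-1) ^ (k' * l) *\<^sub>R wedge l k' \<beta> (contract v \<alpha>)"
        using Suc.hyps \<alpha> \<beta> by (intro Suc.hyps(1)) (auto intro: contract_alt)
      moreover have "(-1) ^ (k' * l) = (-1) ^ (k * l) * (-1::real) ^ l"
        using Suc by (cases "even l"; cases "even k'") simp_all
      ultimately show ?thesis using Suc by simp
    qed
    have 2: "(-1) ^ k *\<^sub>R wedge k (l - 1) \<alpha> (contract v \<beta>) = (-1) ^ (k * l) *\<^sub>R wedge (l - 1) k (contract v \<beta>) \<alpha>"
    proof (cases l)
      case 0
      then show ?thesis using \<beta> by (simp add: contract_alt_0)
    next
      case (Suc l')
      then have "wedge k l' \<alpha> (contract v \<beta>) = (-1) ^ (k * l') *\<^sub>R wedge l' k (contract v \<beta>) \<alpha>"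
        using Suc.hyps \<alpha> \<beta> by (intro Suc.hyps(1)) (auto intro: contract_alt)
      moreover have "(-1) ^ k * (-1) ^ (k * l') = (-1::real) ^ (k * l)"
        using Suc by (simp add: power_add)
      ultimately show ?thesis using Suc by simp
    qed
    show "contract v (wedge k l \<alpha> \<beta>) = contract v ((-1) ^ (k * l) *\<^sub>R wedge l k \<beta> \<alpha>)"
      by (simp add: contract_wedge[OF \<alpha> \<beta>] contract_wedge[OF \<beta> \<alpha>] contract_scale scaleR_add_right 1 2
          del: One_nat_def)
  qed
qed

lemma contract_contract:
  assumes \<alpha>: "\<alpha> \<in> alt k"
  shows "contract v (contract w \<alpha>) = - contract w (contract v \<alpha>)"
proof
  fix vs
  show "contract v (contract w \<alpha>) vs = (- contract w (contract v \<alpha>)) vs"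
  proof (cases "length vs + 2 = k")
    case True
    then show ?thesis
      using alt_swap[OF \<alpha>, of "v # w # vs" 0 1] by (simp add: contract_def)
  next
    case False
    then show ?thesis by (simp add: contract_def alt_length[OF \<alpha>])
  qed
qed

definition covector :: "'v::euclidean_space \<Rightarrow> 'v list \<Rightarrow> real"
  where "covector w = (\<lambda>vs. if length vs = 1 then hd vs \<bullet> w else 0)"

lemma covector_alt: "covector w \<in> alt 1"
  by (rule altI) (auto simp: covector_def length_Suc_conv intro!: linearI inner_add_left)

lemma contract_1_wedge:
  assumes \<alpha>: "\<alpha> \<in> alt 1" and \<beta>: "\<beta> \<in> alt l"
  shows "contract v (wedge 1 l \<alpha> \<beta>) = \<alpha> [v] *\<^sub>R \<beta> - wedge 1 (l - 1) \<alpha> (contract v \<beta>)"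
proof -
  have "contract v \<alpha> \<in> alt 0" using contract_alt[of \<alpha> 0] \<alpha> by simp
  then show ?thesis
    using contract_wedge[OF \<alpha> \<beta>, of v] by (simp add: wedge_0_left[OF _ \<beta>]) (simp add: contract_def)
qed

lemma contract_covector_wedge:
  "\<beta> \<in> alt l \<Longrightarrow> contract v (wedge 1 l (covector w) \<beta>) = (v \<bullet> w) *\<^sub>R \<beta> - wedge 1 (l - 1) (covector w) (contract v \<beta>)"
  using contract_1_wedge[OF covector_alt] by (simp add: covector_def)

text \<open>Contracting with \<open>v\<close> gives \<open>\<iota>\<^sub>v\<alpha>\<close> from the covectors and, as contractions anticommute, the same expression
for \<open>\<iota>\<^sub>v\<alpha>\<close>, which is \<open>k - 1\<close> times \<open>\<iota>\<^sub>v\<alpha>\<close> by induction.\<close>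

lemma sum_covector_wedge_contract:
  "\<alpha> \<in> alt k \<Longrightarrow> (\<Sum>b\<in>Basis. wedge 1 (k - 1) (covector b) (contract b \<alpha>)) = real k *\<^sub>R \<alpha>"
proof (induction k arbitrary: \<alpha>)
  case 0
  then have "(\<Sum>b\<in>Basis. wedge 1 (0 - 1) (covector b) (contract b \<alpha>)) = real 0 *\<^sub>R \<alpha>"
    by (simp add: contract_alt_0)
  then show ?case .
next
  case (Suc k)
  show ?case
  proof (rule form_eqI)
    show "(\<Sum>b\<in>Basis. wedge 1 (Suc k - 1) (covector b) (contract b \<alpha>)) [] = (real (Suc k) *\<^sub>R \<alpha>) []"
      using Suc.prems by (simp add: alt_length wedge_def)
    fix v
    have IH: "(\<Sum>b\<in>Basis. wedge 1 (k - 1) (covector b) (contract b (contract v \<alpha>))) = real k *\<^sub>R contract v \<alpha>"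
      by (rule Suc.IH[OF contract_alt[OF Suc.prems]])
    have "contract v (\<Sum>b\<in>Basis. wedge 1 (Suc k - 1) (covector b) (contract b \<alpha>))
        = (\<Sum>b\<in>Basis. (v \<bullet> b) *\<^sub>R contract b \<alpha> + wedge 1 (k - 1) (covector b) (contract b (contract v \<alpha>)))"
      by (simp add: contract_sum contract_covector_wedge[OF contract_alt[OF Suc.prems]]
          contract_contract[OF Suc.prems, of v] wedge_minus_right del: One_nat_def)
    also have "\<dots> = contract v \<alpha> + real k *\<^sub>R contract v \<alpha>"
      by (simp add: sum.distrib contract_basis[OF Suc.prems] IH del: One_nat_def)
    finally show "contract v (\<Sum>b\<in>Basis. wedge 1 (Suc k - 1) (covector b) (contract b \<alpha>))
        = contract v (real (Suc k) *\<^sub>R \<alpha>)"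
      by (simp add: contract_scale contract_add scaleR_add_left)
  qed
qed

lemma sum_contract_covector_wedge:
  fixes \<alpha> :: "'v::euclidean_space list \<Rightarrow> 'b::real_vector"
  assumes "\<alpha> \<in> alt k"
  shows "(\<Sum>b\<in>Basis. contract b (wedge 1 k (covector b) \<alpha>)) = (real DIM('v) - real k) *\<^sub>R \<alpha>"
  using assms
  by (simp add: contract_covector_wedge sum_subtractf sum_constant_scaleR sum_covector_wedge_contract
      scaleR_diff_left del: One_nat_def)


section \<open>Forms of top degree\<close>

text \<open>The arguments are linearly dependent, so one of them can be exchanged for the others by linearity.\<close>

lemma alt_above_dim:
  fixes \<alpha> :: "'v::euclidean_space list \<Rightarrow> 'b::real_vector"
  assumes \<alpha>: "\<alpha> \<in> alt k" and k: "k > DIM('v)"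
  shows "\<alpha> = 0"
proof
  fix vs
  show "\<alpha> vs = 0 vs"
  proof (cases "length vs = k \<and> distinct vs")
    case True
    then have "card (set vs) > DIM('v)" using k by (simp add: distinct_card)
    then have "dependent (set vs)" using independent_card_le by (metis not_le)
    then obtain a where a: "a \<in> set vs" "a \<in> span (set vs - {a})" by (auto simp: dependent_def)
    then obtain i where i: "i < length vs" "vs ! i = a" by (auto simp: in_set_conv_nth)
    have lin: "linear (\<lambda>w. \<alpha> (vs[i := w]))" using alt_linear[OF \<alpha>] True i by simp
    have "\<alpha> (vs[i := a]) = 0"
      using a(2)
    proof (rule span_induct)
      show "subspace {w. \<alpha> (vs[i := w]) = 0}"
        by (rule linear_subspace_kernel[OF lin])
      fix w assume "w \<in> set vs - {a}"
      then obtain j where "j < length vs" "vs ! j = w" "j \<noteq> i" using i by (auto simp: in_set_conv_nth)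
      then show "\<alpha> (vs[i := w]) = 0" using i by (intro alt_repeat[OF \<alpha>, of i _ j]) auto
    qed
    then show ?thesis using i by auto
  next
    case False
    then show ?thesis using alt_length[OF \<alpha>] alt_not_distinct[OF \<alpha>] by auto
  qed
qed

text \<open>Contract \<open>\<alpha> \<and> \<beta>\<close>, which vanishes for reasons of degree, with \<open>v\<close>.\<close>

lemma wedge_contract_top:
  fixes \<beta> :: "'v::euclidean_space list \<Rightarrow> 'b::real_vector"
  assumes \<alpha>: "\<alpha> \<in> alt 1" and \<beta>: "\<beta> \<in> alt DIM('v)"
  shows "wedge 1 (DIM('v) - 1) \<alpha> (contract v \<beta>) = \<alpha> [v] *\<^sub>R \<beta>"
proof -
  have "wedge 1 DIM('v) \<alpha> \<beta> = 0"
    by (rule alt_above_dim[OF wedge_alt[OF \<alpha> \<beta>]]) simp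
  then show ?thesis using contract_1_wedge[OF \<alpha> \<beta>, of v] by simp
qed

text \<open>If \<open>c \<and> \<psi> = 0\<close> for a unit vector \<open>c\<close>, then \<open>\<psi> = c \<and> \<iota>\<^sub>c\<psi>\<close>, and the hypotheses pass to \<open>\<iota>\<^sub>c\<psi>\<close>.
For forms of top degree this shows that the value at a basis determines the form.\<close>

lemma alt_eq_0_if_list:
  assumes "distinct cs" "set cs \<subseteq> Basis" "\<psi> \<in> alt (length cs)"
    "\<And>c. c \<in> set cs \<Longrightarrow> wedge 1 (length cs) (covector c) \<psi> = 0" "\<psi> cs = 0"
  shows "\<psi> = 0"
  using assms
proof (induction cs arbitrary: \<psi>)
  case Nil
  then show ?case by (auto simp: fun_eq_iff) (metis alt_length list.size(3) length_0_conv)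
next
  case (Cons c cs)
  have \<psi>: "\<psi> \<in> alt (Suc (length cs))" using Cons.prems by simp
  have *: "(c \<bullet> c') *\<^sub>R \<psi> = wedge 1 (length cs) (covector c') (contract c \<psi>)" if "c' \<in> set (c # cs)" for c'
  proof -
    have "contract c (wedge 1 (length (c # cs)) (covector c') \<psi>) = contract c 0"
      using Cons.prems(4)[OF that] by (rule arg_cong)
    then show ?thesis using contract_covector_wedge[OF \<psi>, of c c'] by simp
  qed
  have "contract c \<psi> = 0"
  proof (rule Cons.IH)
    show "wedge 1 (length cs) (covector c') (contract c \<psi>) = 0" if c': "c' \<in> set cs" for c'
    proof -
      have "c \<bullet> c' = 0" using Cons.prems(1,2) c' by (auto simp: inner_Basis)
      then show ?thesis using *[of c'] c' by simp
    qed
    show "contract c \<psi> cs = 0" using Cons.prems by (simp add: contract_def)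
  qed (use Cons.prems contract_alt[OF \<psi>] in auto)
  then have "(c \<bullet> c) *\<^sub>R \<psi> = 0" using *[of c] by simp
  then show ?case using Cons.prems(2) by (auto simp: inner_Basis)
qed

lemma top_form_proportional:
  fixes \<mu> :: "'v::euclidean_space list \<Rightarrow> real"
  assumes \<mu>: "\<mu> \<in> alt DIM('v)" "\<mu> \<noteq> 0"
  obtains bs where "\<mu> bs \<noteq> 0" "\<And>\<eta>. \<eta> \<in> alt DIM('v) \<Longrightarrow> \<eta> = (\<eta> bs / \<mu> bs) *\<^sub>R \<mu>"
proof -
  obtain bs :: "'v list" where bs: "set bs = Basis" "distinct bs"
    using finite_distinct_list finite_Basis by blast
  then have len: "length bs = DIM('v)" using distinct_card by fastforce
  have zero: "\<eta> = 0" if \<eta>: "\<eta> \<in> alt DIM('v)" "\<eta> bs = 0" for \<eta> :: "'v list \<Rightarrow> real"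
  proof (rule alt_eq_0_if_list[of bs])
    show "wedge 1 (length bs) (covector c) \<eta> = 0" for c
      by (rule alt_above_dim[OF wedge_alt[OF covector_alt]]) (use \<eta> len in simp_all)
  qed (use bs len \<eta> in auto)
  show ?thesis
  proof (rule that[of bs])
    show b: "\<mu> bs \<noteq> 0" using zero \<mu> by blast
    fix \<eta> :: "'v list \<Rightarrow> real" assume \<eta>: "\<eta> \<in> alt DIM('v)"
    have "\<eta> - (\<eta> bs / \<mu> bs) *\<^sub>R \<mu> = 0"
      using b by (intro zero alt_intros \<eta> \<mu>(1)) simp
    then show "\<eta> = (\<eta> bs / \<mu> bs) *\<^sub>R \<mu>" by simp
  qed
qed


section \<open>The trace and its kernel\<close>

text \<open>This is \<open>phi k\<close> without the sign \<open>(-1)\<^sup>k\<^sup>-\<^sup>1\<close>. Dropping the sign makes the map independent of the degree.\<close>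

definition tr :: "('v::euclidean_space list \<Rightarrow> 'v) \<Rightarrow> 'v list \<Rightarrow> real"
  where "tr A = (\<Sum>b\<in>Basis. contract b (component b A))"

lemma phi_tr: "phi k A = (-1) ^ (k - 1) *\<^sub>R tr A"
  by (simp add: phi_def tr_def)

lemma K_iff: "A \<in> K k \<longleftrightarrow> A \<in> alt k \<and> tr A = 0"
  by (simp add: K_def phi_tr)

lemma tr_add: "tr (A + B) = tr A + tr B"
  by (simp add: tr_def component_def contract_def fun_eq_iff inner_add_left sum.distrib)
lemma tr_diff: "tr (A - B) = tr A - tr B"
  by (simp add: tr_def component_def contract_def fun_eq_iff inner_diff_left sum_subtractf)
lemma tr_scale: "tr (c *\<^sub>R A) = c *\<^sub>R tr A"
  by (simp add: tr_def component_def contract_def fun_eq_iff sum_distrib_left)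

lemma subspace_K: "subspace (K k)"
proof (rule subspaceI)
  show "0 \<in> K k"
    by (simp add: K_iff) (simp add: tr_def component_def contract_def fun_eq_iff)
qed (simp_all add: K_iff tr_add tr_scale alt_add alt_scale)

lemma component_alt: "A \<in> alt k \<Longrightarrow> component b A \<in> alt k"
  unfolding component_def by (rule alt_linear_comp) (auto intro: linearI inner_add_left)

lemma component_contract: "component b (contract v A) = contract v (component b A)"
  by (simp add: component_def contract_def)

lemma component_eqI: "(\<And>b. b \<in> Basis \<Longrightarrow> component b A = component b B) \<Longrightarrow> A = B"
  by (simp add: component_def fun_eq_iff) (metis euclidean_eqI)

lemma tens_alt: "\<alpha> \<in> alt k \<Longrightarrow> tens \<alpha> w \<in> alt k"
  unfolding tens_def by (rule alt_linear_comp) (auto intro: linearI scaleR_add_left)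

lemma tr_tens: "\<alpha> \<in> alt k \<Longrightarrow> tr (tens \<alpha> w) = contract w \<alpha>"
  unfolding contract_basis[symmetric, where w = w]
  by (simp add: tr_def component_tens) (simp add: contract_def fun_eq_iff)

lemma tr_sum: "tr (\<Sum>i\<in>I. A i) = (\<Sum>i\<in>I. tr (A i))"
proof -
  have "component b (\<Sum>i\<in>I. A i) = (\<Sum>i\<in>I. component b (A i))" for b
    by (simp add: component_def fun_eq_iff inner_sum_left)
  then show ?thesis
    unfolding tr_def by (simp only: contract_sum) (rule sum.swap)
qed

lemma tr_alt: "A \<in> alt k \<Longrightarrow> tr A \<in> alt (k - 1)"
  unfolding tr_def by (intro alt_sum contract_alt' component_alt)

lemma tr_contract: "A \<in> alt k \<Longrightarrow> tr (contract v A) = - contract v (tr A)"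
  by (simp add: tr_def component_contract contract_sum contract_contract[OF component_alt, of A k _ v]
      sum_negf)

text \<open>In top degree \<open>c \<and> \<iota>\<^sub>b\<alpha>\<close> is \<open>\<alpha>\<close> if \<open>b = c\<close> and zero for other basis vectors \<open>b\<close>. Hence \<open>c \<and> tr A\<close> is the \<open>c\<close>-component
of \<open>A\<close>.\<close>

lemma tr_eq_0_top:
  fixes A :: "'v::euclidean_space list \<Rightarrow> 'v"
  assumes A: "A \<in> alt DIM('v)" and tr: "tr A = 0"
  shows "A = 0"
proof (rule component_eqI)
  fix c :: 'v assume c: "c \<in> Basis"
  have "0 = wedge 1 (DIM('v) - 1) (covector c) (tr A)"
    using tr by simp
  also have "\<dots> = (\<Sum>b\<in>Basis. (b \<bullet> c) *\<^sub>R component b A)"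
    by (simp add: tr_def wedge_sum_right wedge_contract_top[OF covector_alt component_alt[OF A]] del: One_nat_def)
       (simp add: covector_def)
  also have "\<dots> = component c A"
    using c by (simp add: inner_Basis if_distrib[of "\<lambda>x. x *\<^sub>R _"] cong: if_cong)
  finally show "component c A = component c 0"
    by (simp add: component_def fun_eq_iff)
qed

lemma K_top: "A \<in> K DIM('v) \<Longrightarrow> A = 0" for A :: "'v::euclidean_space list \<Rightarrow> 'v"
  by (simp add: K_iff tr_eq_0_top)

lemma K_ge_dim:
  fixes A :: "'v::euclidean_space list \<Rightarrow> 'v"
  assumes "A \<in> K k" "k \<ge> DIM('v)"
  shows "A = 0"
  using assms K_top alt_above_dim[of A k] by (cases "k = DIM('v)") (auto simp: K_iff)

lemma K_1: "K 1 = (sl :: ('v::euclidean_space list \<Rightarrow> 'v) set)"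
proof -
  have "tr A = 0 \<longleftrightarrow> (\<Sum>b\<in>Basis. A [b] \<bullet> b) = 0" if A: "A \<in> alt 1" for A :: "'v list \<Rightarrow> 'v"
  proof -
    have "tr A vs = (if vs = [] then \<Sum>b\<in>Basis. A [b] \<bullet> b else 0)" for vs
      using alt_length[OF A] by (simp add: tr_def contract_def component_def)
    then show ?thesis by (auto simp: fun_eq_iff)
  qed
  then show ?thesis unfolding sl_def by (auto simp: K_iff)
qed

text \<open>Below the top degree this exhibits each form as the trace of an explicit vector-valued form.\<close>

lemma tr_sum_tens_wedge:
  fixes \<gamma> :: "'v::euclidean_space list \<Rightarrow> real"
  assumes "\<gamma> \<in> alt k"
  shows "tr (\<Sum>b\<in>Basis. tens (wedge 1 k (covector b) \<gamma>) b) = (real DIM('v) - real k) *\<^sub>R \<gamma>"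
  by (simp add: tr_sum tr_tens[OF wedge_alt[OF covector_alt assms]] sum_contract_covector_wedge[OF assms]
      del: One_nat_def)


section \<open>The pre-Lie identity for insertion\<close>

lemma insertion_alt:
  assumes "A \<in> alt a" "B \<in> alt b"
  shows "insertion a b A B \<in> alt (a + b - 1)"
proof (cases b)
  case 0
  then show ?thesis using assms by (simp add: insertion_def contract_alt_0)
next
  case (Suc b')
  then show ?thesis unfolding insertion_def
    using wedge_alt[OF component_alt[OF assms(1)] contract_alt[of B b']] assms by (auto intro!: alt_sum)
qed

lemma insertion_add_left: "insertion a b (A + A') B = insertion a b A B + insertion a b A' B"
proof -
  have "component c (A + A') = component c A + component c A'" for c
    by (simp add: component_def fun_eq_iff inner_add_left)
  then show ?thesis by (simp add: insertion_def wedge_add_left sum.distrib)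
qed

lemma insertion_scale_left: "insertion a b (c *\<^sub>R A) B = c *\<^sub>R insertion a b A B"
proof -
  have "component e (c *\<^sub>R A) = c *\<^sub>R component e A" for e
    by (simp add: component_def fun_eq_iff)
  then show ?thesis by (simp add: insertion_def wedge_scale_left scaleR_sum_right)
qed

lemma insertion_add_right: "insertion a b A (B + B') = insertion a b A B + insertion a b A B'"
  by (simp add: insertion_def contract_add wedge_add_right sum.distrib)

lemma insertion_scale_right: "insertion a b A (c *\<^sub>R B) = c *\<^sub>R insertion a b A B"
  by (simp add: insertion_def contract_scale wedge_scale_right scaleR_sum_right)

lemma insertion_minus_left: "insertion a b (- A) B = - insertion a b A B"
  using insertion_scale_left[of a b "-1"] by simp
lemma insertion_minus_right: "insertion a b A (- B) = - insertion a b A B"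
  using insertion_scale_right[of a b _ "-1"] by simp
lemma insertion_diff_left: "insertion a b (A - A') B = insertion a b A B - insertion a b A' B"
  using insertion_add_left[of a b A "- A'" B] by (simp add: insertion_minus_left)
lemma insertion_diff_right: "insertion a b A (B - B') = insertion a b A B - insertion a b A B'"
  using insertion_add_right[of a b A B "- B'"] by (simp add: insertion_minus_right)
lemma insertion_zero_left [simp]: "insertion a b 0 B = 0"
  using insertion_scale_left[of a b 0] by simp
lemma insertion_zero_right [simp]: "insertion a b A 0 = 0"
  using insertion_scale_right[of a b _ 0] by simp

lemmas insertion_linear = insertion_add_left insertion_add_right insertion_diff_left insertion_diff_right
  insertion_scale_left insertion_scale_right insertion_minus_left insertion_minus_right

lemma insertion_0_left:
  assumes "A \<in> alt 0" "B \<in> alt b"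
  shows "insertion 0 b A B = contract (A []) B"
proof -
  have "insertion 0 b A B = (\<Sum>e\<in>Basis. (A [] \<bullet> e) *\<^sub>R contract e B)"
    unfolding insertion_def
    by (intro sum.cong refl)
      (simp add: wedge_0_left[OF component_alt[OF assms(1)] contract_alt'[OF assms(2), simplified]], simp add: component_def)
  then show ?thesis using contract_basis[OF assms(2)] by simp
qed

lemma insertion_0_right: "B \<in> alt 0 \<Longrightarrow> insertion a 0 A B = 0"
  by (simp add: insertion_def contract_alt_0)

text \<open>In degree \<open>a\<close> an element has parity \<open>a - 1\<close>, hence the sign \<open>(-1)\<^sup>a\<^sup>+\<^sup>1\<close> in place of that for forms.\<close>

lemma contract_insertion:
  assumes A: "A \<in> alt a" and B: "B \<in> alt b"
  shows "contract v (insertion a b A B)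
    = insertion (a - 1) b (contract v A) B + (-1) ^ Suc a *\<^sub>R insertion a (b - 1) A (contract v B)"
proof -
  have "contract v (wedge a (b - 1) (component e A) (contract e B))
      = wedge (a - 1) (b - 1) (contract v (component e A)) (contract e B)
        - (-1) ^ a *\<^sub>R wedge a (b - 1 - 1) (component e A) (contract e (contract v B))" for e
    unfolding contract_wedge[OF component_alt[OF A] contract_alt'[OF B]] contract_contract[OF B, of v]
    by (simp add: wedge_minus_right)
  then show ?thesis
    unfolding insertion_def contract_sum component_contract
    by (simp add: sum_subtractf scaleR_sum_right sum_negf)
qed

lemma contract_insertion_Suc:
  assumes A: "A \<in> alt (Suc a)" and B: "B \<in> alt (Suc b)"
  shows "contract v (insertion (Suc a) (Suc b) A B)
    = insertion a (Suc b) (contract v A) B + (-1) ^ a *\<^sub>R insertion (Suc a) b A (contract v B)"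
  using contract_insertion[OF A B] by simp

text \<open>The graded antisymmetrisation of the associator of \<open>\<rhd>\<close> in its first two arguments. The parity of a form
of degree \<open>a\<close> is \<open>a - 1\<close>; it is written \<open>Suc a\<close> so that degree 0, that is, constant vectors, is covered.\<close>

definition prelie_defect ::
    "nat \<Rightarrow> nat \<Rightarrow> nat \<Rightarrow> ('v::euclidean_space list \<Rightarrow> 'v) \<Rightarrow> ('v list \<Rightarrow> 'v) \<Rightarrow> ('v list \<Rightarrow> 'v) \<Rightarrow> 'v list \<Rightarrow> 'v"
  where "prelie_defect a b c A B C =
     insertion a (b + c - 1) A (insertion b c B C)
     - (-1) ^ (Suc a * Suc b) *\<^sub>R insertion b (a + c - 1) B (insertion a c A C)
     - insertion (a + b - 1) c (insertion a b A B) C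
     + (-1) ^ (Suc a * Suc b) *\<^sub>R insertion (a + b - 1) c (insertion b a B A) C"

lemma prelie_defect_swap:
  "prelie_defect a b c A B C = - ((-1) ^ (Suc a * Suc b) *\<^sub>R prelie_defect b a c B A C)"
  by (cases "even (Suc a * Suc b)")
    (simp_all add: prelie_defect_def mult.commute[of "Suc b"] add.commute[of b] del: mult_Suc mult_Suc_right power_Suc)

text \<open>A form of degree 0 is a vector \<open>w\<close>, and its insertion is \<open>\<iota>\<^sub>w\<close>. The claim is the rule for \<open>\<iota>\<^sub>w\<close> on \<open>B \<rhd> C\<close>.\<close>

lemma prelie_defect_0:
  assumes A: "A \<in> alt 0" and B: "B \<in> alt b" and C: "C \<in> alt c"
  shows "prelie_defect 0 b c A B C = 0"
proof -
  have "prelie_defect 0 b c A B C = contract (A []) (insertion b c B C)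
      - (-1) ^ Suc b *\<^sub>R insertion b (c - 1) B (contract (A []) C)
      - insertion (b - 1) c (contract (A []) B) C"
    unfolding prelie_defect_def
    by (simp only: add_0 mult_1 One_nat_def[symmetric] insertion_0_left[OF A insertion_alt[OF B C]]
        insertion_0_left[OF A B] insertion_0_left[OF A C] insertion_0_right[OF A])
      (simp del: power_Suc)
  then show ?thesis
    by (simp add: contract_insertion[OF B C])
qed

text \<open>The contraction of the defect is a signed sum of the defects in which one of the three arguments is
contracted. If all degrees are positive, the defect itself has positive degree, so that its value at
the empty list is zero; the degrees 0 are treated separately.\<close>

theorem prelie_defect_eq_0:
  "A \<in> alt a \<Longrightarrow> B \<in> alt b \<Longrightarrow> C \<in> alt c \<Longrightarrow> prelie_defect a b c A B C = 0"
proof (induction "a + b + c" arbitrary: a b c A B C rule: less_induct)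
  case (less a b c A B C)
  note A = \<open>A \<in> alt a\<close> and B = \<open>B \<in> alt b\<close> and C = \<open>C \<in> alt c\<close>
  consider "a = 0" | "b = 0" | "c = 0" | a' b' c' where "a = Suc a'" "b = Suc b'" "c = Suc c'"
    by (metis not0_implies_Suc)
  then show ?case
  proof cases
    case 1
    then show ?thesis using A B C prelie_defect_0 by blast
  next
    case 2
    then show ?thesis using A B C prelie_defect_0[of B A a C c] prelie_defect_swap[of a b c A B C] by simp
  next
    case 3
    then show ?thesis using C by (simp add: prelie_defect_def insertion_0_right)
  next
    case 4
    note A = A[unfolded 4] and B = B[unfolded 4] and C = C[unfolded 4]
    note AB = insertion_alt[OF A B, simplified] and BA = insertion_alt[OF B A, simplified]
      and AC = insertion_alt[OF A C, simplified] and BC = insertion_alt[OF B C, simplified]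
    show ?thesis
    proof (rule form_eqI)
      have 1: "insertion p (Suc q) X Y [] = 0" if "X \<in> alt p" "Y \<in> alt (Suc q)" "p + q > 0" for p q and X Y :: "'a list \<Rightarrow> 'a"
        using alt_length[OF insertion_alt[OF that(1,2)], of "[]"] that(3) by simp
      show "prelie_defect a b c A B C [] = 0 []"
        unfolding prelie_defect_def 4 using 1[OF A BC] 1[OF B AC] 1[OF AB C] 1[of _ _ C c', OF BA[unfolded add.commute[of b']] C]
        by (simp add: add_ac)
      fix v
      let ?Av = "contract v A" and ?Bv = "contract v B" and ?Cv = "contract v C"
      have 1: "prelie_defect a' b c ?Av B C = 0"
        using contract_alt[OF A] B C 4 by (intro less.hyps) simp_all
      have 2: "prelie_defect a b' c A ?Bv C = 0"
        using contract_alt[OF B] A C 4 by (intro less.hyps) simp_all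
      have 3: "prelie_defect a b c' A B ?Cv = 0"
        using contract_alt[OF C] A B 4 by (intro less.hyps) simp_all
      have "contract v (prelie_defect a b c A B C)
          = prelie_defect a' b c ?Av B C + (-1) ^ a' *\<^sub>R prelie_defect a b' c A ?Bv C
            + (-1) ^ (a' + b') *\<^sub>R prelie_defect a b c' A B ?Cv"
        unfolding prelie_defect_def 4
        by (cases "even a'"; cases "even b'")
          (simp_all add: contract_add contract_diff contract_scale contract_minus
            contract_insertion_Suc[OF A BC] contract_insertion_Suc[OF B AC] contract_insertion_Suc[OF AB C]
            contract_insertion_Suc[OF BA[unfolded add.commute[of b']] C]
            contract_insertion_Suc[OF A B] contract_insertion_Suc[OF B A]
            contract_insertion_Suc[OF A C] contract_insertion_Suc[OF B C] insertion_linear add_ac algebra_simps)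
      then show "contract v (prelie_defect a b c A B C) = contract v 0"
        by (simp add: 1 2 3)
    qed
  qed
qed

section \<open>The bracket preserves trace-free forms\<close>

text \<open>The part of the trace of \<open>A \<rhd> B\<close> in which the contraction hits \<open>A\<close>.\<close>

definition cross_trace ::
    "nat \<Rightarrow> nat \<Rightarrow> ('v::euclidean_space list \<Rightarrow> 'v) \<Rightarrow> ('v list \<Rightarrow> 'v) \<Rightarrow> 'v list \<Rightarrow> real"
  where "cross_trace a b A B = (\<Sum>c\<in>Basis. \<Sum>e\<in>Basis.
    wedge (a - 1) (b - 1) (contract c (component e A)) (contract e (component c B)))"

lemma cross_trace_commute:
  assumes A: "A \<in> alt a" and B: "B \<in> alt b"
  shows "cross_trace a b A B = (-1) ^ ((a - 1) * (b - 1)) *\<^sub>R cross_trace b a B A"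
proof -
  have "cross_trace a b A B = (\<Sum>c\<in>Basis. \<Sum>e\<in>Basis. (-1) ^ ((a - 1) * (b - 1)) *\<^sub>R
      wedge (b - 1) (a - 1) (contract e (component c B)) (contract c (component e A)))"
    unfolding cross_trace_def
    by (intro sum.cong refl wedge_commute contract_alt' component_alt A B)
  also have "\<dots> = (-1) ^ ((a - 1) * (b - 1)) *\<^sub>R cross_trace b a B A"
    unfolding cross_trace_def scaleR_sum_right by (rule sum.swap)
  finally show ?thesis .
qed

lemma component_wedge: "component c (wedge k l \<alpha> \<beta>) = wedge k l \<alpha> (component c \<beta>)"
  by (rule ext) (simp add: component_def wedge_def inner_sum_left)

lemma component_sum: "component c (\<Sum>i\<in>I. A i) = (\<Sum>i\<in>I. component c (A i))"
  by (simp add: component_def fun_eq_iff inner_sum_left)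

text \<open>In the part in which the contraction hits \<open>B\<close>, the two contractions of \<open>B\<close> can be exchanged, and \<open>tr B\<close>
appears.\<close>

lemma tr_insertion:
  fixes A B :: "'v::euclidean_space list \<Rightarrow> 'v"
  assumes A: "A \<in> alt a" and B: "B \<in> K b"
  shows "tr (insertion a b A B) = cross_trace a b A B"
proof -
  have B': "B \<in> alt b" "tr B = 0" using B by (auto simp: K_iff)
  let ?w = "\<lambda>c e. wedge (a - 1) (b - 1) (contract c (component e A)) (contract e (component c B))"
  let ?r = "\<lambda>c e. wedge a (b - 1 - 1) (component e A) (contract e (contract c (component c B)))"
  have *: "contract c (wedge a (b - 1) (component e A) (contract e (component c B)))
      = ?w c e - (-1) ^ a *\<^sub>R ?r c e" for c e
    unfolding contract_wedge[OF component_alt[OF A] contract_alt'[OF component_alt[OF B'(1)]]]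
      contract_contract[OF component_alt[OF B'(1)], of c e]
    by (simp add: wedge_minus_right)
  have "tr (insertion a b A B)
      = (\<Sum>c\<in>Basis. \<Sum>e\<in>Basis. ?w c e - (-1) ^ a *\<^sub>R ?r c e)"
    by (simp add: tr_def insertion_def component_sum component_wedge component_contract contract_sum *
        del: One_nat_def)
  also have "\<dots> = cross_trace a b A B - (-1) ^ a *\<^sub>R (\<Sum>c\<in>Basis. \<Sum>e\<in>Basis. ?r c e)"
    by (simp add: cross_trace_def sum_subtractf scaleR_sum_right)
  also have "(\<Sum>c\<in>Basis. \<Sum>e\<in>Basis. ?r c e) = (\<Sum>e\<in>Basis. \<Sum>c\<in>Basis. ?r c e)"
    by (rule sum.swap)
  also have "\<dots> = (\<Sum>e\<in>Basis. wedge a (b - 1 - 1) (component e A) (contract e (tr B)))"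
    by (simp add: tr_def contract_sum wedge_sum_right)
  also have "\<dots> = 0" by (simp add: B')
  finally show ?thesis by simp
qed

lemma insertion_bracket_K:
  fixes A B :: "'v::euclidean_space list \<Rightarrow> 'v"
  assumes A: "A \<in> K a" and B: "B \<in> K b"
  shows "insertion a b A B - (-1) ^ ((a - 1) * (b - 1)) *\<^sub>R insertion b a B A \<in> K (a + b - 1)"
proof -
  have A': "A \<in> alt a" and B': "B \<in> alt b" using A B by (auto simp: K_iff)
  have "insertion a b A B - (-1) ^ ((a - 1) * (b - 1)) *\<^sub>R insertion b a B A \<in> alt (a + b - 1)"
    using insertion_alt[OF B' A'] by (intro alt_diff alt_scale insertion_alt A' B') (simp add: add.commute)
  moreover have "tr (insertion a b A B - (-1) ^ ((a - 1) * (b - 1)) *\<^sub>R insertion b a B A) = 0"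
    unfolding tr_diff tr_scale tr_insertion[OF A' B] tr_insertion[OF B' A] cross_trace_commute[OF A' B']
    by simp
  ultimately show ?thesis by (simp add: K_iff)
qed

text \<open>By \<open>wedge_contract_top\<close>, an endomorphism acts on top forms by its trace.\<close>

lemma insertion_sl_top:
  fixes X H :: "'v::euclidean_space list \<Rightarrow> 'v"
  assumes X: "X \<in> K 1" and H: "H \<in> alt DIM('v)"
  shows "insertion 1 DIM('v) X H = 0"
proof -
  have X': "X \<in> alt 1" "tr X = 0" using X unfolding K_iff by auto
  have "insertion 1 DIM('v) X H = (\<Sum>b\<in>Basis. component b X [b] *\<^sub>R H)"
    unfolding insertion_def by (intro sum.cong refl wedge_contract_top component_alt X' H)
  also have "\<dots> = tr X [] *\<^sub>R H"
    by (simp add: tr_def contract_def scaleR_sum_left)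
  finally show ?thesis by (simp add: X')
qed


section \<open>Sections of bundles of forms\<close>

primrec basis_lists :: "nat \<Rightarrow> 'v::euclidean_space list set" where
  "basis_lists 0 = {[]}"
| "basis_lists (Suc k) = (\<lambda>(b, us). b # us) ` (Basis \<times> basis_lists k)"

fun coordinate :: "'v::euclidean_space list \<Rightarrow> 'v list \<Rightarrow> real" where
  "coordinate [] [] = 1"
| "coordinate (u # us) (v # vs) = (v \<bullet> u) * coordinate us vs"
| "coordinate _ _ = 0"

lemma finite_basis_lists [simp]: "finite (basis_lists k)"
  by (induction k) auto

text \<open>A form is a combination of fixed functions with its values at lists of basis vectors as coefficients.
This makes the space of forms finite-dimensional and reduces linear functionals on it to evaluations.\<close>

lemma alt_expand:
  "\<alpha> \<in> alt k \<Longrightarrow> \<alpha> vs = (\<Sum>us\<in>basis_lists k. coordinate us vs *\<^sub>R \<alpha> us)"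
proof (induction k arbitrary: \<alpha> vs)
  case 0
  then show ?case by (cases vs) (auto simp: alt_length)
next
  case (Suc k)
  have inj: "inj_on (\<lambda>(b, us). b # us) (Basis \<times> basis_lists k)"
    by (auto simp: inj_on_def)
  show ?case
  proof (cases vs)
    case Nil
    show ?thesis
    proof -
      have "(\<Sum>us\<in>basis_lists (Suc k). coordinate us vs *\<^sub>R \<alpha> us) = 0"
        by (rule sum.neutral) (auto simp: Nil)
      then show ?thesis using Suc.prems Nil by (simp add: alt_length)
    qed
  next
    case (Cons w ws)
    have "\<alpha> vs = contract w \<alpha> ws"
      by (simp add: Cons contract_def)
    also have "\<dots> = (\<Sum>b\<in>Basis. (w \<bullet> b) *\<^sub>R contract b \<alpha> ws)"
      by (subst contract_basis[OF Suc.prems, symmetric]) simp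
    also have "\<dots> = (\<Sum>b\<in>Basis. \<Sum>us\<in>basis_lists k. ((w \<bullet> b) * coordinate us ws) *\<^sub>R contract b \<alpha> us)"
      by (subst Suc.IH[OF contract_alt[OF Suc.prems]]) (simp add: scaleR_sum_right)
    also have "\<dots> = (\<Sum>us\<in>basis_lists (Suc k). coordinate us vs *\<^sub>R \<alpha> us)"
      unfolding basis_lists.simps sum.reindex[OF inj] by (simp add: sum.cartesian_product Cons contract_def case_prod_unfold)
    finally show ?thesis .
  qed
qed

lemma alt_expand_basis:
  fixes \<alpha> :: "'v::euclidean_space list \<Rightarrow> 'b::euclidean_space"
  assumes "\<alpha> \<in> alt k"
  shows "\<alpha> = (\<Sum>us\<in>basis_lists k. \<Sum>b\<in>Basis. (\<alpha> us \<bullet> b) *\<^sub>R (\<lambda>vs. coordinate us vs *\<^sub>R b))"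
proof
  fix vs
  have "\<alpha> vs = (\<Sum>us\<in>basis_lists k. coordinate us vs *\<^sub>R (\<Sum>b\<in>Basis. (\<alpha> us \<bullet> b) *\<^sub>R b))"
    using alt_expand[OF assms, of vs] by (simp add: euclidean_representation)
  then show "\<alpha> vs = (\<Sum>us\<in>basis_lists k. \<Sum>b\<in>Basis. (\<alpha> us \<bullet> b) *\<^sub>R (\<lambda>vs. coordinate us vs *\<^sub>R b)) vs"
    by (simp add: scaleR_sum_right mult.commute)
qed

lemma alt_finite_dim:
  "\<exists>B. finite B \<and> (alt k :: ('v::euclidean_space list \<Rightarrow> 'b::euclidean_space) set) \<subseteq> span B"
proof (intro exI conjI subsetI)
  let ?B = "(\<lambda>(us, b) vs. coordinate us vs *\<^sub>R b) ` (basis_lists k \<times> Basis)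
    :: ('v list \<Rightarrow> 'b) set"
  show "finite ?B" by simp
  fix \<alpha> :: "'v list \<Rightarrow> 'b" assume \<alpha>: "\<alpha> \<in> alt k"
  show "\<alpha> \<in> span ?B"
    by (subst alt_expand_basis[OF \<alpha>]) (intro span_sum span_scale span_base, auto)
qed

text \<open>For maps into a space of forms, smoothness can be tested on evaluations, because by \<open>alt_expand_basis\<close>
every linear functional is a combination of these.\<close>

lemma sections_iff:
  fixes U :: "('v::euclidean_space list \<Rightarrow> 'b::euclidean_space) set"
    and s :: "'v \<Rightarrow> 'v list \<Rightarrow> 'b"
  assumes U: "U \<subseteq> alt k"
  shows "s \<in> sections U \<longleftrightarrow> (\<forall>x. s x \<in> U) \<and> (\<forall>vs. smooth (\<lambda>x. s x vs))"
proof (intro iffI conjI allI)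
  fix vs assume s: "s \<in> sections U"
  then show "s x \<in> U" for x by (simp add: sections_def)
  show "smooth (\<lambda>x. s x vs)"
  proof (rule smooth_componentwise)
    fix b :: 'b
    have "linear (\<lambda>\<alpha>::'v list \<Rightarrow> 'b. \<alpha> vs \<bullet> b)"
      by (rule linearI) (simp_all add: inner_add_left)
    then show "smooth (\<lambda>x. s x vs \<bullet> b)" using s unfolding sections_def by blast
  qed
next
  assume s: "(\<forall>x. s x \<in> U) \<and> (\<forall>vs. smooth (\<lambda>x. s x vs))"
  have "smooth (\<lambda>x. l (s x))" if l: "linear l" for l :: "('v list \<Rightarrow> 'b) \<Rightarrow> real"
  proof -
    have "l (s x) = (\<Sum>us\<in>basis_lists k. \<Sum>b\<in>Basis. (s x us \<bullet> b) * l (\<lambda>vs. coordinate us vs *\<^sub>R b))" for x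
    proof -
      have sx: "s x \<in> alt k" using s U by auto
      show ?thesis
        by (subst alt_expand_basis[OF sx]) (simp add: linear_sum[OF l] linear_scale[OF l])
    qed
    moreover have "smooth (\<lambda>x. \<Sum>us\<in>basis_lists k. \<Sum>b\<in>Basis. (s x us \<bullet> b) * l (\<lambda>vs. coordinate us vs *\<^sub>R b))"
      using s by (intro smooth_sum smooth_mult smooth_inner smooth_const) auto
    ultimately show ?thesis by simp
  qed
  then show "s \<in> sections U" using s by (simp add: sections_def)
qed

lemma sectionsD: "s \<in> sections U \<Longrightarrow> s x \<in> U"
  by (simp add: sections_def)

lemma K_subset_alt: "K k \<subseteq> alt k"
  by (auto simp: K_iff)

lemmas sections_alt_iff = sections_iff[OF order_refl]
lemmas sections_K_iff = sections_iff[OF K_subset_alt]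

lemma sections_K_alt:
  fixes A :: "'v::euclidean_space \<Rightarrow> 'v list \<Rightarrow> 'v"
  shows "A \<in> sections (K k) \<Longrightarrow> A \<in> sections (alt k)"
  unfolding sections_K_iff sections_alt_iff by (auto simp: K_iff)

lemma sections_smooth:
  fixes A :: "'v::euclidean_space \<Rightarrow> 'v list \<Rightarrow> 'b::euclidean_space"
  shows "A \<in> sections (alt k) \<Longrightarrow> smooth (\<lambda>x. A x vs)"
  by (simp add: sections_alt_iff)

lemma sections_Times_left:
  "a \<in> sections (U \<times> {0}) \<longleftrightarrow> (\<lambda>x. fst (a x)) \<in> sections U \<and> (\<forall>x. snd (a x) = 0)"
proof (intro iffI conjI)
  assume a: "a \<in> sections (U \<times> {0})"
  then show "\<forall>x. snd (a x) = 0" by (auto simp: sections_def mem_Times_iff)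
  have "smooth (\<lambda>x. l (fst (a x)))" if "linear l" for l :: "_ \<Rightarrow> real"
    using a linear_compose[OF linear_fst that] unfolding sections_def o_def by blast
  then show "(\<lambda>x. fst (a x)) \<in> sections U"
    using a by (auto simp: sections_def mem_Times_iff)
next
  assume a: "(\<lambda>x. fst (a x)) \<in> sections U \<and> (\<forall>x. snd (a x) = 0)"
  have "smooth (\<lambda>x. l (a x))" if l: "linear l" for l :: "_ \<Rightarrow> real"
  proof -
    have "linear (\<lambda>u. l (u, 0))"
      using linear_scale[OF l, of _ "(_, 0)"] by (intro linearI) (simp_all add: linear_add[OF l, symmetric])
    then have "smooth (\<lambda>x. l (fst (a x), 0))" using a unfolding sections_def by blast
    moreover have "(fst (a x), 0) = a x" for x using a by (metis prod.collapse)
    ultimately show ?thesis by simp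
  qed
  then show "a \<in> sections (U \<times> {0})" using a by (auto simp: sections_def mem_Times_iff)
qed

lemma sections_Times_right:
  "a \<in> sections ({0} \<times> U) \<longleftrightarrow> (\<lambda>x. snd (a x)) \<in> sections U \<and> (\<forall>x. fst (a x) = 0)"
proof (intro iffI conjI)
  assume a: "a \<in> sections ({0} \<times> U)"
  then show "\<forall>x. fst (a x) = 0" by (auto simp: sections_def mem_Times_iff)
  have "smooth (\<lambda>x. l (snd (a x)))" if "linear l" for l :: "_ \<Rightarrow> real"
    using a linear_compose[OF linear_snd that] unfolding sections_def o_def by blast
  then show "(\<lambda>x. snd (a x)) \<in> sections U"
    using a by (auto simp: sections_def mem_Times_iff)
next
  assume a: "(\<lambda>x. snd (a x)) \<in> sections U \<and> (\<forall>x. fst (a x) = 0)"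
  have "smooth (\<lambda>x. l (a x))" if l: "linear l" for l :: "_ \<Rightarrow> real"
  proof -
    have "linear (\<lambda>u. l (0, u))"
      using linear_scale[OF l, of _ "(0, _)"] by (intro linearI) (simp_all add: linear_add[OF l, symmetric])
    then have "smooth (\<lambda>x. l (0, snd (a x)))" using a unfolding sections_def by blast
    moreover have "(0, snd (a x)) = a x" for x using a by (metis prod.collapse)
    ultimately show ?thesis by simp
  qed
  then show "a \<in> sections ({0} \<times> U)" using a by (auto simp: sections_def mem_Times_iff)
qed

lemma sections_zero: "a \<in> sections {0} \<longleftrightarrow> a = 0"
  by (auto simp: sections_def fun_eq_iff linear_0)

lemma sections_add:
  "subspace U \<Longrightarrow> a \<in> sections U \<Longrightarrow> b \<in> sections U \<Longrightarrow> a + b \<in> sections U"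
  by (auto simp: sections_def subspace_add linear_add intro!: smooth_add)

lemma sections_scale:
  "subspace U \<Longrightarrow> smooth f \<Longrightarrow> a \<in> sections U \<Longrightarrow> (\<lambda>x. f x *\<^sub>R a x) \<in> sections U"
  by (auto simp: sections_def subspace_scale linear_scale intro!: smooth_mult)

lemma der_form_alt:
  fixes A :: "'v::euclidean_space \<Rightarrow> 'v list \<Rightarrow> 'b::euclidean_space"
  assumes A: "A \<in> sections (alt k)"
  shows "der_form X A x \<in> alt k"
proof (rule altI)
  note sm = sections_smooth[OF A] and Ax = sectionsD[OF A]
  show "der_form X A x vs = 0" if "length vs \<noteq> k" for vs
    using that by (simp add: der_form_def alt_length[OF Ax])
  show "der_form X A x vs = 0" if "length vs = k" "i < k" "j < k" "i \<noteq> j" "vs ! i = vs ! j" for vs i j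
    using that alt_repeat[OF Ax, of i vs j] by (simp add: der_form_def)
  show "linear (\<lambda>v. der_form X A x (vs[i := v]))" if "length vs = k" "i < k" for vs i
  proof (rule linearI)
    note lin = alt_linear[OF Ax that]
    show "der_form X A x (vs[i := v + w]) = der_form X A x (vs[i := v]) + der_form X A x (vs[i := w])" for v w
      by (simp add: der_form_def linear_add[OF lin] der_add sm)
    show "der_form X A x (vs[i := c *\<^sub>R v]) = c *\<^sub>R der_form X A x (vs[i := v])" for c v
      by (simp add: der_form_def linear_scale[OF lin] der_bounded_linear[OF bounded_linear_scaleR_right] sm)
  qed
qed

lemma der_form_sections:
  fixes A :: "'v::euclidean_space \<Rightarrow> 'v list \<Rightarrow> 'b::euclidean_space"
  assumes "smooth X" "A \<in> sections (alt k)"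
  shows "der_form X A \<in> sections (alt k)"
  unfolding sections_alt_iff
  using der_form_alt[OF assms(2)] smooth_der[OF assms(1) sections_smooth[OF assms(2)]]
  by (simp add: der_form_def)

lemma tr_der_form:
  fixes A :: "'v::euclidean_space \<Rightarrow> 'v list \<Rightarrow> 'v"
  assumes A: "A \<in> sections (alt k)"
  shows "tr (der_form X A x) = der_form X (\<lambda>y. tr (A y)) x"
proof
  fix vs
  note sm = sections_smooth[OF A]
  show "tr (der_form X A x) vs = der_form X (\<lambda>y. tr (A y)) x vs"
    by (simp add: tr_def component_def contract_def der_form_def der_sum der_inner smooth_inner sm)
qed

lemma der_form_K:
  fixes A :: "'v::euclidean_space \<Rightarrow> 'v list \<Rightarrow> 'v"
  assumes A: "A \<in> sections (K k)"
  shows "der_form X A x \<in> K k"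
proof -
  have "tr (A y) = 0" for y using sectionsD[OF A, of y] by (simp add: K_iff)
  then have "tr (der_form X A x) = 0"
    unfolding tr_der_form[OF sections_K_alt[OF A]] by (simp add: der_form_def fun_eq_iff)
  then show ?thesis using der_form_alt[OF sections_K_alt[OF A]] by (simp add: K_iff)
qed

lemma smooth_euler:
  fixes A :: "'v::euclidean_space \<Rightarrow> 'v list \<Rightarrow> 'b::euclidean_space"
  assumes "A \<in> sections (alt k)"
  shows "smooth (\<lambda>x. euler A x vs)"
  unfolding euler_def contract_def
  by (simp, intro smooth_sum smooth_scaleR smooth_inner smooth_id smooth_const sections_smooth[OF assms])

lemma euler_sections:
  fixes A :: "'v::euclidean_space \<Rightarrow> 'v list \<Rightarrow> 'b::euclidean_space"
  assumes A: "A \<in> sections (alt k)"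
  shows "euler A \<in> sections (alt (k - 1))"
  unfolding sections_alt_iff
  using smooth_euler[OF A] contract_alt'[OF sectionsD[OF A]] by (simp add: euler_eq[OF sectionsD[OF A]])

lemma euler_contract:
  fixes A :: "'v::euclidean_space \<Rightarrow> 'v list \<Rightarrow> 'b::euclidean_space"
  shows "A \<in> sections (alt k) \<Longrightarrow> euler A x = contract x (A x)"
  by (rule euler_eq[OF sectionsD])

lemma contract_self:
  assumes "\<alpha> \<in> alt k" shows "contract x (contract x \<alpha>) = 0"
  using alt_repeat[OF assms, of 0 "x # x # vs" 1 for vs] by (simp add: contract_def fun_eq_iff)

lemma euler_euler:
  fixes A :: "'v::euclidean_space \<Rightarrow> 'v list \<Rightarrow> 'b::euclidean_space"
  assumes "A \<in> sections (alt k)"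
  shows "euler (euler A) = 0"
  using euler_contract[OF euler_sections[OF assms]]
  by (simp add: fun_eq_iff euler_contract[OF assms] contract_self[OF sectionsD[OF assms]])

text \<open>The factor \<open>x\<close> in \<open>\<iota>\<^sub>x A\<close> contributes \<open>\<iota>\<^sub>X A\<close> to the product rule.\<close>

lemma der_form_euler:
  fixes A :: "'v::euclidean_space \<Rightarrow> 'v list \<Rightarrow> 'b::euclidean_space"
  assumes A: "A \<in> sections (alt k)"
  shows "der_form X (euler A) x = contract (X x) (A x) + contract x (der_form X A x)"
proof
  fix vs
  note sm = sections_smooth[OF A]
  have "der_form X (euler A) x vs
      = (\<Sum>e\<in>Basis. (x \<bullet> e) *\<^sub>R der_form X A x (e # vs)) + (\<Sum>e\<in>Basis. (X x \<bullet> e) *\<^sub>R A x (e # vs))"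
    by (simp add: der_form_def euler_def contract_def der_sum der_scaleR der_inner smooth_intros sm
        sum.distrib)
  also have "(\<Sum>e\<in>Basis. (x \<bullet> e) *\<^sub>R der_form X A x (e # vs)) = contract x (der_form X A x) vs"
    by (subst contract_basis[OF der_form_alt[OF A], symmetric]) (simp add: contract_def)
  also have "(\<Sum>e\<in>Basis. (X x \<bullet> e) *\<^sub>R A x (e # vs)) = contract (X x) (A x) vs"
    by (subst contract_basis[OF sectionsD[OF A], symmetric]) (simp add: contract_def)
  finally show "der_form X (euler A) x vs = (contract (X x) (A x) + contract x (der_form X A x)) vs"
    by simp
qed


section \<open>Exactness of the Koszul complex\<close>

definition radial_form ::
    "nat \<Rightarrow> ('v::euclidean_space \<Rightarrow> 'v list \<Rightarrow> 'b::euclidean_space) \<Rightarrow> 'v \<Rightarrow> 'v list \<Rightarrow> 'b"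
  where "radial_form m A x vs = radial_integral m (\<lambda>y. A y vs) x"

lemma radial_form_sections:
  fixes A :: "'v::euclidean_space \<Rightarrow> 'v list \<Rightarrow> 'b::euclidean_space"
  assumes A: "A \<in> sections (alt k)"
  shows "radial_form m A \<in> sections (alt k)"
  unfolding sections_alt_iff
proof (intro conjI allI)
  note sm = sections_smooth[OF A] and Ax = sectionsD[OF A]
  show "smooth (\<lambda>x. radial_form m A x vs)" for vs
    unfolding radial_form_def by (rule smooth_radial_integral[OF sm])
  note int = radial_integrable[OF smooth_imp_continuous_on[OF sm]]
  show "radial_form m A x \<in> alt k" for x
  proof (rule altI)
    show "radial_form m A x vs = 0" if "length vs \<noteq> k" for vs
      using that by (simp add: radial_form_def radial_integral_def alt_length[OF Ax])
    show "radial_form m A x vs = 0" if "length vs = k" "i < k" "j < k" "i \<noteq> j" "vs ! i = vs ! j" for vs i j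
      using that alt_repeat[OF Ax, of i vs j] by (simp add: radial_form_def radial_integral_def)
    show "linear (\<lambda>v. radial_form m A x (vs[i := v]))" if "length vs = k" "i < k" for vs i
    proof (rule linearI)
      note lin = alt_linear[OF Ax that]
      show "radial_form m A x (vs[i := v + w]) = radial_form m A x (vs[i := v]) + radial_form m A x (vs[i := w])" for v w
        unfolding radial_form_def radial_integral_def linear_add[OF lin] scaleR_add_right
        by (rule integral_add[OF int int])
      show "radial_form m A x (vs[i := c *\<^sub>R v]) = c *\<^sub>R radial_form m A x (vs[i := v])" for c v
        unfolding radial_form_def radial_integral_def linear_scale[OF lin]
        by (subst integral_cmul[symmetric]) (simp add: mult.commute)
    qed
  qed
qed

text \<open>At \<open>t \<noteq> 0\<close> the hypothesis at the point \<open>t x\<close> gives \<open>\<iota>\<^sub>x A(t x) = 0\<close>; the value at \<open>t = 0\<close> does not affect the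
integral.\<close>

lemma euler_radial_form:
  fixes A :: "'v::euclidean_space \<Rightarrow> 'v list \<Rightarrow> 'b::euclidean_space"
  assumes A: "A \<in> sections (alt k)" and 0: "euler A = 0"
  shows "euler (radial_form m A) = 0"
proof (intro ext)
  fix x vs
  have "A (t *\<^sub>R x) (x # vs) = 0" if "t \<noteq> 0" for t
  proof -
    have "contract (t *\<^sub>R x) (A (t *\<^sub>R x)) = t *\<^sub>R contract x (A (t *\<^sub>R x))"
      by (rule linear_scale[OF contract_linear[OF sectionsD[OF A]]])
    moreover have "contract (t *\<^sub>R x) (A (t *\<^sub>R x)) = 0"
      using 0 by (simp add: euler_contract[OF A, symmetric])
    ultimately have "t *\<^sub>R contract x (A (t *\<^sub>R x)) = 0" by simp
    then show ?thesis using that by (auto simp: contract_def fun_eq_iff)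
  qed
  then have "integral {0..1} (\<lambda>t. t ^ m *\<^sub>R A (t *\<^sub>R x) (x # vs)) = integral {0..1} (\<lambda>t::real. 0)"
    by (intro integral_spike[of "{0}"]) auto
  then show "euler (radial_form m A) x vs = 0 x vs"
    by (simp add: euler_contract[OF radial_form_sections[OF A]] contract_def radial_form_def radial_integral_def)
qed

text \<open>With \<open>R\<close> the radial integral of \<open>A\<close>, differentiating \<open>\<iota>\<^sub>x R = 0\<close> gives \<open>\<iota>\<^sub>x(D\<^sub>b R) = - \<iota>\<^sub>b R\<close>. Therefore the contraction
of the exterior derivative of \<open>R\<close> is the Euler derivative of \<open>R\<close> plus \<open>(m + 1) R\<close>, which is \<open>A\<close>.\<close>

theorem koszul_exact:
  fixes A :: "'v::euclidean_space \<Rightarrow> 'v list \<Rightarrow> 'b::euclidean_space"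
  assumes A: "A \<in> sections (alt (Suc m))" and 0: "euler A = 0"
  obtains B where "B \<in> sections (alt (Suc (Suc m)))" "euler B = A"
proof
  define R where "R = radial_form m A"
  define D where "D = (\<lambda>b. der_form (\<lambda>_. b) R)"
  \<comment> \<open>the exterior derivative of \<open>R\<close>\<close>
  define B where "B = (\<lambda>x. \<Sum>b\<in>Basis. wedge 1 (Suc m) (covector b) (D b x))"
  have R: "R \<in> sections (alt (Suc m))" and eR: "euler R = 0"
    unfolding R_def using radial_form_sections[OF A] euler_radial_form[OF A 0] by auto
  have D: "D b \<in> sections (alt (Suc m))" for b
    unfolding D_def by (rule der_form_sections[OF smooth_const R])
  have "B x \<in> alt (Suc (Suc m))" for x
    unfolding B_def using wedge_alt[OF covector_alt sectionsD[OF D]] by (auto intro!: alt_sum)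
  moreover have "smooth (\<lambda>x. B x vs)" for vs
  proof (cases "length vs = Suc (Suc m)")
    case True
    then show ?thesis
      unfolding B_def
      by (simp add: wedge_def, intro smooth_sum smooth_scaleR smooth_const sections_smooth[OF D])
  qed (simp add: B_def wedge_def)
  ultimately show Bs: "B \<in> sections (alt (Suc (Suc m)))"
    by (simp add: sections_alt_iff)
  show "euler B = A"
  proof
    fix x
    have cD: "contract x (D b x) = - contract b (R x)" for b
      using der_form_euler[OF R, of "\<lambda>_. b" x] unfolding eR D_def
      by (simp add: eq_neg_iff_add_eq_0 add.commute) (simp add: der_form_def fun_eq_iff)
    have "euler B x = contract x (B x)"
      by (rule euler_contract[OF Bs])
    also have "B x = (\<Sum>b\<in>Basis. wedge 1 (Suc m) (covector b) (D b x))"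
      by (simp only: B_def)
    also have "contract x \<dots> = (\<Sum>b\<in>Basis. (x \<bullet> b) *\<^sub>R D b x) + (\<Sum>b\<in>Basis. wedge 1 m (covector b) (contract b (R x)))"
      by (simp add: contract_sum contract_covector_wedge[OF sectionsD[OF D]]
          cD wedge_minus_right sum.distrib del: One_nat_def)
    also have "(\<Sum>b\<in>Basis. wedge 1 m (covector b) (contract b (R x))) = real (Suc m) *\<^sub>R R x"
      using sum_covector_wedge_contract[OF sectionsD[OF R]] by simp
    also have "(\<Sum>b\<in>Basis. (x \<bullet> b) *\<^sub>R D b x) = der_form (\<lambda>x. x) R x"
    proof
      fix vs
      have "D b x vs = frechet_derivative (\<lambda>y. R y vs) (at x) b" for b
        by (simp add: D_def der_form_def der_def)
      then show "(\<Sum>b\<in>Basis. (x \<bullet> b) *\<^sub>R D b x) vs = der_form (\<lambda>x. x) R x vs"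
        by (simp add: der_form_def der_basis[OF sections_smooth[OF R], of "\<lambda>x. x"])
    qed
    also have "\<dots> + real (Suc m) *\<^sub>R R x = A x"
      using radial_integral_euler[OF sections_smooth[OF A]]
      by (simp add: fun_eq_iff der_form_def R_def radial_form_def[abs_def])
    finally show "euler B x = A x" .
  qed
qed

lemma tr_sections:
  fixes B :: "'v::euclidean_space \<Rightarrow> 'v list \<Rightarrow> 'v"
  assumes B: "B \<in> sections (alt k)"
  shows "(\<lambda>x. tr (B x)) \<in> sections (alt (k - 1))"
  unfolding sections_alt_iff
proof (intro conjI allI)
  show "tr (B x) \<in> alt (k - 1)" for x by (rule tr_alt[OF sectionsD[OF B]])
  show "smooth (\<lambda>x. tr (B x) vs)" for vs
    by (simp add: tr_def contract_def component_def, intro smooth_sum smooth_inner smooth_const sections_smooth[OF B])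
qed

lemma wedge_sections:
  fixes G :: "'v::euclidean_space \<Rightarrow> 'v list \<Rightarrow> 'b::euclidean_space"
  assumes \<alpha>: "\<alpha> \<in> alt k" and G: "G \<in> sections (alt l)"
  shows "(\<lambda>x. wedge k l \<alpha> (G x)) \<in> sections (alt (k + l))"
  unfolding sections_alt_iff
proof (intro conjI allI)
  show "wedge k l \<alpha> (G x) \<in> alt (k + l)" for x by (rule wedge_alt[OF \<alpha> sectionsD[OF G]])
  show "smooth (\<lambda>x. wedge k l \<alpha> (G x) vs)" for vs
    by (cases "length vs = k + l"; simp add: wedge_def)
      (intro smooth_sum smooth_scaleR smooth_const sections_smooth[OF G])
qed

lemma tens_sections:
  fixes G :: "'v::euclidean_space \<Rightarrow> 'v list \<Rightarrow> real"
  assumes G: "G \<in> sections (alt k)" and w: "smooth w"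
  shows "(\<lambda>x. tens (G x) (w x)) \<in> sections (alt k)"
  unfolding sections_alt_iff
  using tens_alt[OF sectionsD[OF G]] by (auto simp: tens_def intro!: smooth_scaleR w sections_smooth[OF G])

lemma sections_alt_add:
  fixes A B :: "'v::euclidean_space \<Rightarrow> 'v list \<Rightarrow> 'b::euclidean_space"
  shows "A \<in> sections (alt k) \<Longrightarrow> B \<in> sections (alt k) \<Longrightarrow> (\<lambda>x. A x + B x) \<in> sections (alt k)"
  unfolding sections_alt_iff by (auto intro: smooth_add alt_add)

lemma sections_alt_diff:
  fixes A B :: "'v::euclidean_space \<Rightarrow> 'v list \<Rightarrow> 'b::euclidean_space"
  shows "A \<in> sections (alt k) \<Longrightarrow> B \<in> sections (alt k) \<Longrightarrow> (\<lambda>x. A x - B x) \<in> sections (alt k)"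
  unfolding sections_alt_iff by (auto intro: smooth_diff alt_diff)

lemma sections_alt_scale:
  fixes A :: "'v::euclidean_space \<Rightarrow> 'v list \<Rightarrow> 'b::euclidean_space"
  shows "A \<in> sections (alt k) \<Longrightarrow> (\<lambda>x. c *\<^sub>R A x) \<in> sections (alt k)"
  unfolding sections_alt_iff by (auto intro: smooth_scaleR smooth_const alt_scale)

lemma sections_alt_sum:
  fixes A :: "'i \<Rightarrow> 'v::euclidean_space \<Rightarrow> 'v list \<Rightarrow> 'b::euclidean_space"
  shows "(\<And>i. i \<in> I \<Longrightarrow> A i \<in> sections (alt k)) \<Longrightarrow> (\<lambda>x. \<Sum>i\<in>I. A i x) \<in> sections (alt k)"
  unfolding sections_alt_iff by (auto intro: smooth_sum alt_sum)

lemma euler_tr: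
  fixes B :: "'v::euclidean_space \<Rightarrow> 'v list \<Rightarrow> 'v"
  assumes B: "B \<in> sections (alt k)"
  shows "euler (\<lambda>x. tr (B x)) x = - tr (euler B x)"
  using euler_contract[OF tr_sections[OF B], of x] tr_contract[OF sectionsD[OF B, of x], of x]
  by (simp add: euler_contract[OF B])

text \<open>As \<open>\<iota>\<^sub>x\<close> anticommutes with the trace, \<open>tr B\<close> is annihilated by \<open>\<iota>\<^sub>x\<close>, and exactness applies once more.\<close>

lemma koszul_lift_with_trace:
  fixes A :: "'v::euclidean_space \<Rightarrow> 'v list \<Rightarrow> 'v"
  assumes A: "A \<in> sections (K (Suc m))" and 0: "euler A = 0"
  obtains B G where "B \<in> sections (alt (Suc (Suc m)))" "euler B = A"
    "G \<in> sections (alt (Suc (Suc m)))" "euler G = (\<lambda>x. tr (B x))"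
proof -
  obtain B where B: "B \<in> sections (alt (Suc (Suc m)))" "euler B = A"
    using koszul_exact[OF sections_K_alt[OF A] 0] by blast
  have trB: "(\<lambda>x. tr (B x)) \<in> sections (alt (Suc m))"
    using tr_sections[OF B(1)] by simp
  have "euler (\<lambda>x. tr (B x)) = 0"
    using sectionsD[OF A] by (simp add: fun_eq_iff euler_tr[OF B(1)] B(2) K_iff)
  then obtain G where "G \<in> sections (alt (Suc (Suc m)))" "euler G = (\<lambda>x. tr (B x))"
    using koszul_exact[OF trB] by blast
  then show ?thesis using that B by blast
qed

theorem koszul_exact_K:
  fixes A :: "'v::euclidean_space \<Rightarrow> 'v list \<Rightarrow> 'v"
  assumes A: "A \<in> sections (K (Suc m))" and 0: "euler A = 0" and m: "Suc (Suc m) < DIM('v)"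
  obtains B where "B \<in> sections (K (Suc (Suc m)))" "euler B = A"
proof -
  obtain B G where B: "B \<in> sections (alt (Suc (Suc m)))" "euler B = A"
    and G: "G \<in> sections (alt (Suc (Suc m)))" "euler G = (\<lambda>x. tr (B x))"
    using koszul_lift_with_trace[OF A 0] .
  \<comment> \<open>normalised to have trace \<open>G\<close>; the denominator is positive below the top degree\<close>
  define C where "C = (\<lambda>x. (1 / (real DIM('v) - real (Suc (Suc m)))) *\<^sub>R
    (\<Sum>b\<in>Basis. tens (wedge 1 (Suc (Suc m)) (covector b) (G x)) b))"
  have C: "C \<in> sections (alt (Suc (Suc (Suc m))))"
    unfolding C_def using wedge_sections[OF covector_alt G(1)]
    by (intro sections_alt_scale sections_alt_sum tens_sections smooth_const) simp
  have trC: "tr (C x) = G x" for x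
    using m by (simp add: C_def tr_scale tr_sum_tens_wedge[OF sectionsD[OF G(1)]] del: of_nat_Suc One_nat_def)
  have eC: "euler C \<in> sections (alt (Suc (Suc m)))" using euler_sections[OF C] by simp
  define B' where "B' = (\<lambda>x. B x + euler C x)"
  have B': "B' \<in> sections (alt (Suc (Suc m)))"
    unfolding B'_def by (rule sections_alt_add[OF B(1) eC])
  have "tr (B' x) = 0" for x
  proof -
    have "tr (euler C x) = - euler G x"
      using euler_tr[OF C, of x] by (simp add: trC)
    then show ?thesis by (simp add: B'_def tr_add G(2))
  qed
  then have K: "B' \<in> sections (K (Suc (Suc m)))"
    using B' unfolding sections_alt_iff sections_K_iff by (simp add: K_iff)
  have "euler B' = A"
  proof
    fix x
    have "euler B' x = contract x (B' x)"
      by (rule euler_contract[OF B'])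
    then have "euler B' x = euler B x + euler (euler C) x"
      by (simp only: euler_contract[OF B(1)] euler_contract[OF eC] B'_def contract_add)
    then show "euler B' x = A x" by (simp add: B(2) euler_euler[OF C])
  qed
  then show ?thesis using that K by blast
qed

lemma contract_tens: "contract v (tens \<alpha> w) = tens (contract v \<alpha>) w"
  by (simp add: contract_def tens_def)

text \<open>Up to sign, \<open>tr(\<eta> \<otimes> x) = \<iota>\<^sub>x\<eta>\<close> exhibits \<open>\<eta> \<otimes> x\<close> as the preimage of \<open>\<partial>\<^sub>n\<eta>\<close> under \<open>\<phi>\<^sub>n\<close>, which is injective by
\<open>tr_eq_0_top\<close>.\<close>

lemma d_top_eq:
  fixes \<eta> :: "'v::euclidean_space \<Rightarrow> 'v list \<Rightarrow> real"
  assumes \<eta>: "\<And>x. \<eta> x \<in> alt DIM('v)"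
  shows "d_top \<eta> = euler (\<lambda>x. (-1) ^ DIM('v) *\<^sub>R tens (\<eta> x) x)"
    and "d_top \<eta> x = (-1) ^ DIM('v) *\<^sub>R tens (contract x (\<eta> x)) x"
proof -
  have inj: "inj_on (phi DIM('v)) (alt DIM('v) :: ('v list \<Rightarrow> 'v) set)"
  proof (rule inj_onI)
    fix A B :: "'v list \<Rightarrow> 'v"
    assume AB: "A \<in> alt DIM('v)" "B \<in> alt DIM('v)" and "phi DIM('v) A = phi DIM('v) B"
    then have "tr (A - B) = 0" by (simp add: phi_tr tr_diff)
    then have "A - B = 0" by (intro tr_eq_0_top alt_diff AB)
    then show "A = B" by simp
  qed
  have alt: "(-1) ^ DIM('v) *\<^sub>R tens (\<eta> x) x \<in> alt DIM('v)" for x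
    by (intro alt_scale tens_alt \<eta>)
  have "the_inv_into (alt DIM('v)) (phi DIM('v)) (- euler \<eta> x) = (-1) ^ DIM('v) *\<^sub>R tens (\<eta> x) x" for x
  proof (rule the_inv_into_f_eq[OF inj _ alt])
    obtain m where m: "DIM('v) = Suc m" using DIM_positive[where 'a = 'v] gr0_implies_Suc by blast
    show "phi DIM('v) ((-1) ^ DIM('v) *\<^sub>R tens (\<eta> x) x) = - euler \<eta> x"
      unfolding phi_tr tr_scale tr_tens[OF \<eta>] euler_eq[OF \<eta>] unfolding m by simp
  qed
  then show 1: "d_top \<eta> = euler (\<lambda>x. (-1) ^ DIM('v) *\<^sub>R tens (\<eta> x) x)"
    by (simp add: d_top_def)
  show "d_top \<eta> x = (-1) ^ DIM('v) *\<^sub>R tens (contract x (\<eta> x)) x"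
    unfolding 1 euler_eq[of "\<lambda>x. (-1) ^ DIM('v) *\<^sub>R tens (\<eta> x) x", OF alt] by (simp add: contract_scale contract_tens)
qed

text \<open>Here \<open>B\<close> and \<open>G \<otimes> x\<close> have the same trace and top degree, so they are equal.\<close>

theorem koszul_exact_K_top:
  fixes A :: "'v::euclidean_space \<Rightarrow> 'v list \<Rightarrow> 'v"
  assumes A: "A \<in> sections (K (Suc m))" and 0: "euler A = 0" and m: "Suc (Suc m) = DIM('v)"
  obtains \<eta> where "\<eta> \<in> sections (alt DIM('v))" "d_top \<eta> = A"
proof -
  obtain B G where B: "B \<in> sections (alt (Suc (Suc m)))" "euler B = A"
    and G: "G \<in> sections (alt (Suc (Suc m)))" "euler G = (\<lambda>x. tr (B x))"
    using koszul_lift_with_trace[OF A 0] .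
  have B_eq: "B x = tens (G x) x" for x
  proof -
    have "B x - tens (G x) x = 0"
    proof (rule tr_eq_0_top)
      show "B x - tens (G x) x \<in> alt DIM('v)"
        using sectionsD[OF B(1)] sectionsD[OF G(1)] m by (intro alt_diff tens_alt) auto
      show "tr (B x - tens (G x) x) = 0"
        using fun_cong[OF G(2), of x] by (simp add: tr_diff tr_tens[OF sectionsD[OF G(1)]] euler_contract[OF G(1)])
    qed
    then show ?thesis by simp
  qed
  define \<eta> where "\<eta> = (\<lambda>x. (-1) ^ DIM('v) *\<^sub>R G x)"
  have \<eta>: "\<eta> \<in> sections (alt DIM('v))"
    unfolding \<eta>_def using sections_alt_scale[OF G(1)] m by simp
  have "d_top \<eta> = A"
  proof
    fix x
    have "d_top \<eta> x = (-1) ^ DIM('v) *\<^sub>R tens (contract x (\<eta> x)) x"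
      by (rule d_top_eq(2)[OF sectionsD[OF \<eta>]])
    also have "\<dots> = contract x (B x)"
      by (simp add: \<eta>_def contract_scale tens_scale contract_tens B_eq power_mult_distrib[symmetric])
    also have "\<dots> = A x" using B euler_contract[OF B(1)] by metis
    finally show "d_top \<eta> x = A x" .
  qed
  then show ?thesis using that \<eta> by blast
qed


section \<open>The bracket as a commutator of actions\<close>

lemma rho_euler: "A \<in> sections (alt 1) \<Longrightarrow> rho A = (\<lambda>x. euler A x [])"
  for A :: "'v::euclidean_space \<Rightarrow> 'v list \<Rightarrow> 'v"
  by (simp add: fun_eq_iff rho_def euler_contract contract_def)

lemma smooth_rho:
  fixes A :: "'v::euclidean_space \<Rightarrow> 'v list \<Rightarrow> 'v"
  assumes "A \<in> sections (alt 1)"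
  shows "smooth (rho A)"
  unfolding rho_euler[OF assms] by (rule smooth_euler[OF assms])

lemma rho_euler_0:
  fixes A :: "'v::euclidean_space \<Rightarrow> 'v list \<Rightarrow> 'v"
  assumes "A \<in> sections (alt 2)"
  shows "rho (euler A) = 0"
proof -
  have "euler A \<in> sections (alt 1)" using euler_sections[OF assms] by simp
  then show ?thesis using euler_euler[OF assms] by (simp add: rho_euler fun_eq_iff)
qed

text \<open>The operator by which \<open>A\<close> acts; \<open>nr_bracket_act\<close> expresses the bracket through it.\<close>

definition act ::
    "nat \<Rightarrow> nat \<Rightarrow> ('v::euclidean_space \<Rightarrow> 'v list \<Rightarrow> 'v) \<Rightarrow> ('v \<Rightarrow> 'v list \<Rightarrow> 'v) \<Rightarrow> 'v \<Rightarrow> 'v list \<Rightarrow> 'v"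
  where "act a b A B = (\<lambda>x. insertion a b (A x) (B x) + (if a = 1 then der_form (rho A) B x else 0))"

lemma nr_bracket_act:
  "nr_bracket a b A B = (\<lambda>x. act a b A B x - (-1) ^ ((a - 1) * (b - 1)) *\<^sub>R act b a B A x)"
  by (rule ext) (auto simp: nr_bracket_def act_def scaleR_add_right)

lemma smooth_insertion:
  fixes A B :: "'v::euclidean_space \<Rightarrow> 'v list \<Rightarrow> 'v"
  assumes A: "A \<in> sections (alt a)" and B: "B \<in> sections (alt b)"
  shows "smooth (\<lambda>x. insertion a b (A x) (B x) vs)"
  unfolding insertion_def wedge_def component_def contract_def
  by (cases "length vs = a + (b - 1)"; simp)
    (intro smooth_sum smooth_scaleR smooth_mult smooth_inner smooth_const sections_smooth[OF A] sections_smooth[OF B])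

lemma insertion_sections:
  fixes A B :: "'v::euclidean_space \<Rightarrow> 'v list \<Rightarrow> 'v"
  assumes A: "A \<in> sections (alt a)" and B: "B \<in> sections (alt b)"
  shows "(\<lambda>x. insertion a b (A x) (B x)) \<in> sections (alt (a + b - 1))"
  unfolding sections_alt_iff
  using smooth_insertion[OF A B] insertion_alt[OF sectionsD[OF A] sectionsD[OF B]] by blast

lemma der_form_insertion:
  fixes A B :: "'v::euclidean_space \<Rightarrow> 'v list \<Rightarrow> 'v"
  assumes A: "A \<in> sections (alt a)" and B: "B \<in> sections (alt b)"
  shows "der_form X (\<lambda>x. insertion a b (A x) (B x)) x
    = insertion a b (der_form X A x) (B x) + insertion a b (A x) (der_form X B x)"
proof
  fix vs
  note sA = sections_smooth[OF A] and sB = sections_smooth[OF B]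
  have 1: "der X (\<lambda>x. (c * (A x us \<bullet> e)) *\<^sub>R B x ws) x
      = (c * (der X (\<lambda>x. A x us) x \<bullet> e)) *\<^sub>R B x ws + (c * (A x us \<bullet> e)) *\<^sub>R der X (\<lambda>x. B x ws) x" for c us e ws
    by (simp add: der_scaleR der_bilinear[OF bounded_bilinear_mult] der_inner sA sB smooth_intros)
  have 2: "smooth (\<lambda>x. (c * (A x us \<bullet> e)) *\<^sub>R B x ws)" for c us e ws
    by (intro smooth_scaleR smooth_mult smooth_inner smooth_const sA sB)
  show "der_form X (\<lambda>x. insertion a b (A x) (B x)) x vs
    = (insertion a b (der_form X A x) (B x) + insertion a b (A x) (der_form X B x)) vs"
  proof (cases "length vs = a + (b - 1)")
    case True
    then show ?thesis
      unfolding insertion_def wedge_def component_def contract_def der_form_def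
      by (simp add: der_sum der_bounded_linear[OF bounded_linear_scaleR_right] 1 2 smooth_sum
          smooth_scaleR sum.distrib scaleR_add_right)
  next
    case False
    then show ?thesis by (simp add: insertion_def wedge_def der_form_def)
  qed
qed

lemma act_sections:
  fixes A B :: "'v::euclidean_space \<Rightarrow> 'v list \<Rightarrow> 'v"
  assumes A: "A \<in> sections (alt a)" and B: "B \<in> sections (alt b)"
  shows "act a b A B \<in> sections (alt (a + b - 1))"
proof (cases "a = 1")
  case True
  then show ?thesis
    unfolding act_def using insertion_sections[OF A B] der_form_sections[OF smooth_rho B] A
    by (auto intro!: sections_alt_add)
qed (use insertion_sections[OF A B] in \<open>simp add: act_def\<close>)

lemma nr_bracket_sections:
  fixes A B :: "'v::euclidean_space \<Rightarrow> 'v list \<Rightarrow> 'v"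
  assumes A: "A \<in> sections (alt a)" and B: "B \<in> sections (alt b)"
  shows "nr_bracket a b A B \<in> sections (alt (a + b - 1))"
  unfolding nr_bracket_act
  using act_sections[OF A B] act_sections[OF B A]
  by (intro sections_alt_diff sections_alt_scale) (simp_all add: add.commute)

lemma der_form_add:
  fixes A B :: "'v::euclidean_space \<Rightarrow> 'v list \<Rightarrow> 'b::euclidean_space"
  shows "A \<in> sections (alt k) \<Longrightarrow> B \<in> sections (alt k) \<Longrightarrow>
    der_form X (\<lambda>x. A x + B x) x = der_form X A x + der_form X B x"
  by (simp add: der_form_def fun_eq_iff der_add sections_smooth)

lemma der_form_diff:
  fixes A B :: "'v::euclidean_space \<Rightarrow> 'v list \<Rightarrow> 'b::euclidean_space"
  shows "A \<in> sections (alt k) \<Longrightarrow> B \<in> sections (alt k) \<Longrightarrow>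
    der_form X (\<lambda>x. A x - B x) x = der_form X A x - der_form X B x"
  by (simp add: der_form_def fun_eq_iff der_diff sections_smooth)

lemma der_form_scale:
  fixes A :: "'v::euclidean_space \<Rightarrow> 'v list \<Rightarrow> 'b::euclidean_space"
  shows "A \<in> sections (alt k) \<Longrightarrow> der_form X (\<lambda>x. c *\<^sub>R A x) x = c *\<^sub>R der_form X A x"
  by (simp add: der_form_def fun_eq_iff der_bounded_linear[OF bounded_linear_scaleR_right] sections_smooth)

lemma act_diff_scale:
  fixes A B C :: "'v::euclidean_space \<Rightarrow> 'v list \<Rightarrow> 'v"
  assumes B: "B \<in> sections (alt b)" and C: "C \<in> sections (alt b)"
  shows "act a b A (\<lambda>x. B x - c *\<^sub>R C x) x = act a b A B x - c *\<^sub>R act a b A C x"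
  by (simp add: act_def insertion_linear der_form_diff[OF B sections_alt_scale[OF C]]
      der_form_scale[OF C] scaleR_add_right)

text \<open>In degree 1 the vector field \<open>rho B\<close> is \<open>\<iota>\<^sub>x B\<close>. Its derivative along \<open>rho A\<close> consists of \<open>B(rho A)\<close>, which is \<open>A \<rhd> B\<close>
evaluated at \<open>x\<close>, and the derivative of the coefficients of \<open>B\<close>.\<close>

lemma rho_nr_bracket:
  fixes A B :: "'v::euclidean_space \<Rightarrow> 'v list \<Rightarrow> 'v"
  assumes A: "A \<in> sections (alt 1)" and B: "B \<in> sections (alt 1)"
  shows "rho (nr_bracket 1 1 A B) = vf_bracket (rho A) (rho B)"
proof
  fix x
  have act: "act 1 1 A B x [x] = der (rho A) (rho B) x"
    if A: "A \<in> sections (alt 1)" and B: "B \<in> sections (alt 1)" for A B :: "'v \<Rightarrow> 'v list \<Rightarrow> 'v"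
  proof -
    have "contract x (insertion 1 1 (A x) (B x)) = insertion 0 1 (contract x (A x)) (B x) + insertion 1 0 (A x) (contract x (B x))"
      using contract_insertion[OF sectionsD[OF A] sectionsD[OF B]] by simp
    also have "\<dots> = contract (A x [x]) (B x)"
      using contract_alt'[OF sectionsD[OF A], of x x] contract_alt'[OF sectionsD[OF B], of x x]
      by (simp add: insertion_0_left[OF _ sectionsD[OF B]] insertion_0_right del: One_nat_def)
        (simp add: contract_def)
    finally have "insertion 1 1 (A x) (B x) [x] = contract (rho A x) (B x) []"
      unfolding contract_def rho_def by metis
    moreover have "der (rho A) (rho B) x = der_form (rho A) (euler B) x []"
      unfolding rho_euler[OF B] by (simp add: der_form_def)
    ultimately show ?thesis
      unfolding der_form_euler[OF B] by (simp add: act_def contract_def)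
  qed
  show "rho (nr_bracket 1 1 A B) x = vf_bracket (rho A) (rho B) x"
  proof -
    have "rho (nr_bracket 1 1 A B) x = nr_bracket 1 1 A B x [x]"
      by (simp only: rho_def)
    also have "\<dots> = act 1 1 A B x [x] - act 1 1 B A x [x]"
      by (simp add: nr_bracket_act)
    finally show ?thesis
      unfolding act[OF A B] act[OF B A] by (simp add: vf_bracket_def)
  qed
qed

lemma prelie:
  fixes A B C :: "'v::euclidean_space list \<Rightarrow> 'v"
  assumes "A \<in> alt a" "B \<in> alt b" "C \<in> alt c"
  shows "insertion a (b + c - 1) A (insertion b c B C) - (-1) ^ (Suc a * Suc b) *\<^sub>R insertion b (a + c - 1) B (insertion a c A C)
    = insertion (a + b - 1) c (insertion a b A B - (-1) ^ (Suc a * Suc b) *\<^sub>R insertion b a B A) C"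
  using prelie_defect_eq_0[OF assms] by (simp add: prelie_defect_def insertion_linear algebra_simps)

lemma nr_bracket_skew:
  "nr_bracket a b A B = (\<lambda>x. - ((-1) ^ ((a - 1) * (b - 1)) *\<^sub>R nr_bracket b a B A x))"
  by (rule ext) (simp add: nr_bracket_act scaleR_diff_right mult.commute[of "b - Suc 0"])

text \<open>The derivative along \<open>rho A\<close> satisfies the product rule for \<open>\<rhd>\<close>. The terms in which it hits \<open>C\<close> cancel, those in
which it hits \<open>B\<close> belong to the bracket, and for \<open>b = 1\<close> the two derivatives of \<open>C\<close> leave the derivative along
\<open>[rho A, rho B]\<close>.\<close>

lemma act_commutator_1:
  fixes A B C :: "'v::euclidean_space \<Rightarrow> 'v list \<Rightarrow> 'v"
  assumes A: "A \<in> sections (alt 1)" and B: "B \<in> sections (alt b)" and C: "C \<in> sections (alt c)"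
    and b: "b \<ge> 1"
  shows "act 1 (b + c - 1) A (act b c B C) x - act b c B (act 1 c A C) x
    = act b c (nr_bracket 1 b A B) C x"
proof -
  note rA = smooth_rho[OF A]
  note sC = sections_smooth[OF C]
  have pre: "insertion 1 (b + c - 1) (A x) (insertion b c (B x) (C x)) - insertion b c (B x) (insertion 1 c (A x) (C x))
      = insertion b c (insertion 1 b (A x) (B x) - insertion b 1 (B x) (A x)) (C x)"
    using prelie[OF sectionsD[OF A] sectionsD[OF B] sectionsD[OF C], of x x x] by (simp add: power_mult)
  have dC: "der_form (rho A) C \<in> sections (alt c)" by (rule der_form_sections[OF rA C])
  have ins: "(\<lambda>x. insertion b c (B x) (C x)) \<in> sections (alt (b + c - 1))"
    by (rule insertion_sections[OF B C])
  have insAC: "(\<lambda>x. insertion 1 c (A x) (C x)) \<in> sections (alt c)"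
    using insertion_sections[OF A C] by simp
  show ?thesis
  proof (cases "b = 1")
    case False
    have "act 1 (b + c - 1) A (act b c B C) x
        = insertion 1 (b + c - 1) (A x) (insertion b c (B x) (C x))
          + (insertion b c (der_form (rho A) B x) (C x) + insertion b c (B x) (der_form (rho A) C x))"
      using False der_form_insertion[OF B C] by (simp add: act_def[abs_def])
    moreover have "act b c B (act 1 c A C) x = insertion b c (B x) (insertion 1 c (A x) (C x))
        + insertion b c (B x) (der_form (rho A) C x)"
      using False by (simp add: act_def insertion_linear)
    moreover have "act b c (nr_bracket 1 b A B) C x = insertion b c (insertion 1 b (A x) (B x) - insertion b 1 (B x) (A x)) (C x)
        + insertion b c (der_form (rho A) B x) (C x)"
      using False by (simp add: act_def nr_bracket_def insertion_linear)
    ultimately show ?thesis using pre by (simp add: algebra_simps)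
  next
    case True
    note B = B[unfolded True] and pre = pre[unfolded True, simplified]
    note rB = smooth_rho[OF B]
    have dCB: "der_form (rho B) C \<in> sections (alt c)" by (rule der_form_sections[OF rB C])
    have ins: "(\<lambda>x. insertion 1 c (B x) (C x)) \<in> sections (alt c)"
      using insertion_sections[OF B C] by simp
    have L: "act 1 c A (act 1 c B C) x
        = insertion 1 c (A x) (insertion 1 c (B x) (C x)) + insertion 1 c (A x) (der_form (rho B) C x)
          + (insertion 1 c (der_form (rho A) B x) (C x) + insertion 1 c (B x) (der_form (rho A) C x))
          + der_form (rho A) (der_form (rho B) C) x"
      if A: "A \<in> sections (alt 1)" and B: "B \<in> sections (alt 1)" for A B :: "'v \<Rightarrow> 'v list \<Rightarrow> 'v"
    proof -
      have "(\<lambda>x. insertion 1 c (B x) (C x)) \<in> sections (alt c)"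
        using insertion_sections[OF B C] by simp
      then show ?thesis
        using der_form_add[OF _ der_form_sections[OF smooth_rho[OF B] C]] der_form_insertion[OF B C]
        by (simp add: act_def insertion_linear)
    qed
    have vf: "der_form (rho A) (der_form (rho B) C) x - der_form (rho B) (der_form (rho A) C) x
        = der_form (rho (nr_bracket 1 1 A B)) C x"
      unfolding rho_nr_bracket[OF A B]
      by (simp add: fun_eq_iff der_form_def der_vf_bracket[OF rA rB sC])
    have "act 1 c (nr_bracket 1 1 A B) C x
        = insertion 1 c (insertion 1 1 (A x) (B x) - insertion 1 1 (B x) (A x)) (C x)
          + (insertion 1 c (der_form (rho A) B x) (C x) - insertion 1 c (der_form (rho B) A x) (C x))
          + der_form (rho (nr_bracket 1 1 A B)) C x"
    proof -
      have "act 1 c N C x = insertion 1 c (N x) (C x) + der_form (rho N) C x" for N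
        by (simp add: act_def)
      moreover have "nr_bracket 1 1 A B x = (insertion 1 1 (A x) (B x) - insertion 1 1 (B x) (A x))
          + (der_form (rho A) B x - der_form (rho B) A x)"
        by (simp add: nr_bracket_def)
      ultimately show ?thesis
        by (simp only: insertion_add_left insertion_diff_left)
    qed
    then show ?thesis
      using L[OF A B] L[OF B A] pre vf[symmetric] True by (simp add: algebra_simps)
  qed
qed

lemma act_uminus_left:
  assumes C: "C \<in> sections (alt c)"
  shows "act a c (\<lambda>x. - A x) C x = - act a c A C (x :: 'v::euclidean_space)"
proof -
  have "der_form (rho (\<lambda>x. - A x)) C x = - der_form (rho A) C x"
    using linear_neg[OF linear_frechet[OF sections_smooth[OF C]]]
    by (simp add: der_form_def der_def rho_def fun_eq_iff)
  then show ?thesis by (simp add: act_def insertion_linear)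
qed

text \<open>If both degrees exceed 1, no derivatives occur, neither in the actions of \<open>A\<close> and \<open>B\<close> nor in that of
their bracket, and the claim is the pre-Lie identity.\<close>

theorem act_commutator:
  fixes A B C :: "'v::euclidean_space \<Rightarrow> 'v list \<Rightarrow> 'v"
  assumes A: "A \<in> sections (alt a)" and B: "B \<in> sections (alt b)" and C: "C \<in> sections (alt c)"
    and ab: "a \<ge> 1" "b \<ge> 1"
  shows "act a (b + c - 1) A (act b c B C) x
      - (-1) ^ ((a - 1) * (b - 1)) *\<^sub>R act b (a + c - 1) B (act a c A C) x
    = act (a + b - 1) c (nr_bracket a b A B) C x"
proof -
  consider "a = 1" | "b = 1" | "a \<noteq> 1" "b \<noteq> 1" by blast
  then show ?thesis
  proof cases
    case 1
    then show ?thesis using act_commutator_1[OF _ B C ab(2), of A x] A by simp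
  next
    case 2
    have "nr_bracket a b A B = (\<lambda>x. - nr_bracket 1 a B A x)"
      using nr_bracket_skew[of a b A B] 2 by simp
    then show ?thesis
      using B 2
      by (simp add: act_uminus_left[OF C] act_commutator_1[OF _ A C ab(1), of B x, symmetric] del: One_nat_def)
  next
    case 3
    then have "2 \<le> a" "2 \<le> b" using ab by auto
    then obtain a' b' where ab': "a = Suc (Suc a')" "b = Suc (Suc b')"
      using le_Suc_ex[of 2 a] le_Suc_ex[of 2 b] by auto
    have "insertion a (b + c - 1) (A x) (insertion b c (B x) (C x))
        - (-1) ^ ((a - 1) * (b - 1)) *\<^sub>R insertion b (a + c - 1) (B x) (insertion a c (A x) (C x))
      = insertion (a + b - 1) c (insertion a b (A x) (B x) - (-1) ^ ((a - 1) * (b - 1)) *\<^sub>R insertion b a (B x) (A x)) (C x)"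
    proof -
      have "(-1) ^ (Suc a * Suc b) = (-1::real) ^ ((a - 1) * (b - 1))"
        unfolding ab' by (cases "even a'"; cases "even b'") simp_all
      then show ?thesis
        using prelie[OF sectionsD[OF A] sectionsD[OF B] sectionsD[OF C], of x x x] by (simp only:)
    qed
    then show ?thesis unfolding ab' by (simp add: act_def nr_bracket_def)
  qed
qed

text \<open>Each of the three double brackets expands into actions. By \<open>act_commutator\<close> for the pairs \<open>(A,B)\<close>, \<open>(B,C)\<close>
and \<open>(A,C)\<close> all terms cancel; the signs are checked for each combination of parities.\<close>

theorem nr_bracket_Jacobi:
  fixes A B C :: "'v::euclidean_space \<Rightarrow> 'v list \<Rightarrow> 'v"
  assumes A: "A \<in> sections (alt a)" and B: "B \<in> sections (alt b)" and C: "C \<in> sections (alt c)"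
    and abc: "a \<ge> 1" "b \<ge> 1" "c \<ge> 1"
  shows "nr_bracket a (b + c - 1) A (nr_bracket b c B C) x
    = nr_bracket (a + b - 1) c (nr_bracket a b A B) C x
      + (-1) ^ ((a - 1) * (b - 1)) *\<^sub>R nr_bracket b (a + c - 1) B (nr_bracket a c A C) x"
proof -
  obtain a' b' c' where abc': "a = Suc a'" "b = Suc b'" "c = Suc c'"
    using le_Suc_ex[OF abc(1)] le_Suc_ex[OF abc(2)] le_Suc_ex[OF abc(3)] by auto
  have ex: "act p (q + r - 1) X (nr_bracket q r Y Z) x
      = act p (q + r - 1) X (act q r Y Z) x - (-1) ^ ((q - 1) * (r - 1)) *\<^sub>R act p (q + r - 1) X (act r q Z Y) x"
    if Y: "Y \<in> sections (alt q)" and Z: "Z \<in> sections (alt r)" for p q r and X Y Z :: "'v \<Rightarrow> 'v list \<Rightarrow> 'v"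
    unfolding nr_bracket_act
    using act_sections[OF Y Z] act_sections[OF Z Y] by (intro act_diff_scale) (simp_all add: add.commute)
  note 1 = ex[OF B C, of a A] ex[OF A C, of b B] ex[OF A B, of c C]
  note 2 = act_commutator[OF A B C abc(1,2), of x] act_commutator[OF B C A abc(2,3), of x]
    act_commutator[OF A C B abc(1,3), of x]
  show ?thesis
    unfolding nr_bracket_act[of a "b + c - 1"] nr_bracket_act[of "a + b - 1" c] nr_bracket_act[of b "a + c - 1"]
    unfolding 1 2[symmetric] unfolding abc'
    by (cases "even a'"; cases "even b'"; cases "even c'") (simp_all add: add_ac)
qed

lemma nr_bracket_K:
  fixes A B :: "'v::euclidean_space \<Rightarrow> 'v list \<Rightarrow> 'v"
  assumes A: "A \<in> sections (K a)" and B: "B \<in> sections (K b)"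
  shows "nr_bracket a b A B \<in> sections (K (a + b - 1))"
  unfolding sections_K_iff
proof (intro conjI allI)
  show "smooth (\<lambda>x. nr_bracket a b A B x vs)" for vs
    by (rule sections_smooth[OF nr_bracket_sections[OF sections_K_alt[OF A] sections_K_alt[OF B]]])
  show "nr_bracket a b A B x \<in> K (a + b - 1)" for x
    unfolding nr_bracket_def
    using insertion_bracket_K[OF sectionsD[OF A] sectionsD[OF B], of x x]
      der_form_K[OF B, of "rho A" x] der_form_K[OF A, of "rho B" x]
    by (intro subspace_diff[OF subspace_K, of "_ + _"] subspace_add[OF subspace_K, of "_ - _"])
      (auto intro: subspace_0[OF subspace_K])
qed


section \<open>Compatibility with the differential\<close>

text \<open>The insertion produces \<open>\<iota>\<^sub>x A \<rhd> B\<close>, which is the contraction of \<open>B\<close> with the vector \<open>rho A\<close>. The same term is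
the difference between \<open>\<iota>\<^sub>x\<close> of the derivative of \<open>B\<close> and the derivative of \<open>\<iota>\<^sub>x B\<close> (\<open>der_form_euler\<close>).\<close>

lemma euler_act_1:
  fixes A B :: "'v::euclidean_space \<Rightarrow> 'v list \<Rightarrow> 'v"
  assumes A: "A \<in> sections (alt 1)" and B: "B \<in> sections (alt b)"
  shows "euler (act 1 b A B) x = act 1 (b - 1) A (euler B) x"
proof -
  have "euler (act 1 b A B) x = contract x (act 1 b A B x)"
    by (rule euler_contract[OF act_sections[OF A B]])
  also have "\<dots> = contract (contract x (A x) []) (B x) + insertion 1 (b - 1) (A x) (contract x (B x))
      + contract x (der_form (rho A) B x)"
    using contract_alt'[OF sectionsD[OF A], of x x]
    by (simp add: act_def contract_add contract_insertion[OF sectionsD[OF A] sectionsD[OF B]]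
        insertion_0_left[OF _ sectionsD[OF B]] del: One_nat_def)
  also have "\<dots> = act 1 (b - 1) A (euler B) x"
    by (simp add: act_def der_form_euler[OF B] euler_contract[OF B]) (simp add: contract_def rho_def)
  finally show ?thesis .
qed

text \<open>If \<open>a = 2\<close>, the action of \<open>\<iota>\<^sub>x A\<close> contains a derivative along \<open>rho(\<iota>\<^sub>x A)\<close>, which is zero.\<close>

lemma euler_act:
  fixes A B :: "'v::euclidean_space \<Rightarrow> 'v list \<Rightarrow> 'v"
  assumes A: "A \<in> sections (alt a)" and B: "B \<in> sections (alt b)" and a: "a \<ge> 2"
  shows "euler (act a b A B) x = act (a - 1) b (euler A) B x + (-1) ^ Suc a *\<^sub>R act a (b - 1) A (euler B) x"
proof -
  have r: "rho (euler A) = 0" if "a = 2" using rho_euler_0 A that by blast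
  have "der_form 0 B x = 0"
    by (simp add: der_form_def fun_eq_iff sections_smooth[OF B])
  then show ?thesis
    using a r unfolding euler_contract[OF act_sections[OF A B]]
    by (auto simp: act_def contract_insertion[OF sectionsD[OF A] sectionsD[OF B]]
      euler_contract[OF A] euler_contract[OF B])
qed

lemma euler_diff_scale:
  fixes A B :: "'v::euclidean_space \<Rightarrow> 'v list \<Rightarrow> 'v"
  assumes "A \<in> sections (alt k)" "B \<in> sections (alt k)"
  shows "euler (\<lambda>x. A x - c *\<^sub>R B x) x = euler A x - c *\<^sub>R euler B x"
  using euler_contract[OF sections_alt_diff[OF assms(1) sections_alt_scale[OF assms(2)]]]
  by (simp add: euler_contract[OF assms(1)] euler_contract[OF assms(2)] contract_diff contract_scale)

lemma euler_nr_bracket_expand: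
  fixes A B :: "'v::euclidean_space \<Rightarrow> 'v list \<Rightarrow> 'v"
  assumes A: "A \<in> sections (alt a)" and B: "B \<in> sections (alt b)"
  shows "euler (nr_bracket a b A B) x = euler (act a b A B) x - (-1) ^ ((a - 1) * (b - 1)) *\<^sub>R euler (act b a B A) x"
  unfolding nr_bracket_act
  using act_sections[OF A B] act_sections[OF B A] by (intro euler_diff_scale) (simp_all add: add.commute)

lemma act_0_right: "(\<And>x. B x \<in> alt 0) \<Longrightarrow> a \<noteq> 1 \<Longrightarrow> act a 0 A B x = 0"
  by (simp add: act_def insertion_0_right)

lemma euler_nr_bracket_1:
  fixes A B :: "'v::euclidean_space \<Rightarrow> 'v list \<Rightarrow> 'v"
  assumes A: "A \<in> sections (alt 1)" and B: "B \<in> sections (alt b)" and b: "b \<ge> 2"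
  shows "euler (nr_bracket 1 b A B) = nr_bracket 1 (b - 1) A (euler B)"
proof
  fix x
  have "euler A \<in> sections (alt 0)" using euler_sections[OF A] by simp
  then have "act b 0 B (euler A) x = 0"
    using b sectionsD by (intro act_0_right) auto
  then show "euler (nr_bracket 1 b A B) x = nr_bracket 1 (b - 1) A (euler B) x"
    unfolding euler_nr_bracket_expand[OF A B] nr_bracket_act[of 1 "b - 1"] euler_act_1[OF A B]
      euler_act[OF B A b] by simp
qed

lemma euler_nr_bracket:
  fixes A B :: "'v::euclidean_space \<Rightarrow> 'v list \<Rightarrow> 'v"
  assumes A: "A \<in> sections (alt a)" and B: "B \<in> sections (alt b)" and ab: "a \<ge> 2" "b \<ge> 2"
  shows "euler (nr_bracket a b A B) x
    = nr_bracket (a - 1) b (euler A) B x + (-1) ^ (a - 1) *\<^sub>R nr_bracket a (b - 1) A (euler B) x"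
proof -
  obtain a' b' where ab': "a = Suc (Suc a')" "b = Suc (Suc b')"
    using le_Suc_ex[OF ab(1)] le_Suc_ex[OF ab(2)] by auto
  show ?thesis
    unfolding euler_nr_bracket_expand[OF A B] euler_act[OF A B ab(1)] euler_act[OF B A ab(2)]
    unfolding nr_bracket_act ab' by (cases "even a'"; cases "even b'") (simp_all add: algebra_simps)
qed

section \<open>The bracket with top forms\<close>

text \<open>The coefficient with respect to \<open>\<mu>\<close> is a quotient of values at one fixed list, hence linear and smooth.\<close>

lemma coefficient:
  fixes \<mu> :: "'v::euclidean_space list \<Rightarrow> real"
  assumes \<mu>: "\<mu> \<in> alt DIM('v)" "\<mu> \<noteq> 0"
  obtains bs where "\<forall>\<eta> x. \<eta> x \<in> alt DIM('v) \<longrightarrow>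
    coefficient \<mu> \<eta> x = \<eta> x bs / \<mu> bs \<and> coefficient \<mu> \<eta> x *\<^sub>R \<mu> = \<eta> x"
proof -
  obtain bs where bs: "\<mu> bs \<noteq> 0" "\<And>\<eta>. \<eta> \<in> alt DIM('v) \<Longrightarrow> \<eta> = (\<eta> bs / \<mu> bs) *\<^sub>R \<mu>"
    using top_form_proportional[OF \<mu>] by blast
  have c: "coefficient \<mu> \<eta> x = \<eta> x bs / \<mu> bs" if "\<eta> x \<in> alt DIM('v)" for \<eta> x
    unfolding coefficient_def
  proof (rule the_equality)
    show "\<eta> x = (\<eta> x bs / \<mu> bs) *\<^sub>R \<mu>" by (rule bs(2)[OF that])
    show "c = \<eta> x bs / \<mu> bs" if "\<eta> x = c *\<^sub>R \<mu>" for c using that bs(1) by simp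
  qed
  show ?thesis
  proof (rule that[of bs], intro allI impI conjI)
    fix \<eta> :: "'v \<Rightarrow> 'v list \<Rightarrow> real" and x assume \<eta>: "\<eta> x \<in> alt DIM('v)"
    show "coefficient \<mu> \<eta> x = \<eta> x bs / \<mu> bs" by (rule c[of \<eta> x, OF \<eta>])
    then show "coefficient \<mu> \<eta> x *\<^sub>R \<mu> = \<eta> x" using bs(2)[OF \<eta>] by simp
  qed
qed

locale volume_form =
  fixes \<mu> :: "'v::euclidean_space list \<Rightarrow> real"
  assumes dim: "DIM('v) \<ge> 2" and \<mu>: "\<mu> \<in> alt DIM('v)" and \<mu>_nonzero: "\<mu> \<noteq> 0"
begin

lemma coefficient_scaleR:
  assumes "\<eta> \<in> sections (alt DIM('v))"
  shows "coefficient \<mu> \<eta> x *\<^sub>R \<mu> = \<eta> x"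
proof -
  obtain bs where "\<forall>\<eta> x. \<eta> x \<in> alt DIM('v) \<longrightarrow>
      coefficient \<mu> \<eta> x = \<eta> x bs / \<mu> bs \<and> coefficient \<mu> \<eta> x *\<^sub>R \<mu> = \<eta> x"
    using coefficient[OF \<mu> \<mu>_nonzero] .
  from this[rule_format, of \<eta> x, OF sectionsD[OF assms]] show ?thesis by blast
qed

lemma coefficient_add:
  assumes "\<eta> \<in> sections (alt DIM('v))" "\<theta> \<in> sections (alt DIM('v))"
  shows "coefficient \<mu> (\<lambda>x. \<eta> x + \<theta> x) = (\<lambda>x. coefficient \<mu> \<eta> x + coefficient \<mu> \<theta> x)"
proof -
  obtain bs where "\<forall>\<eta> x. \<eta> x \<in> alt DIM('v) \<longrightarrow>
      coefficient \<mu> \<eta> x = \<eta> x bs / \<mu> bs \<and> coefficient \<mu> \<eta> x *\<^sub>R \<mu> = \<eta> x"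
    using coefficient[OF \<mu> \<mu>_nonzero] .
  then have c: "coefficient \<mu> \<eta> x = \<eta> x bs / \<mu> bs" if "\<eta> x \<in> alt DIM('v)" for \<eta> x
    using that by simp
  show ?thesis
    by (simp add: fun_eq_iff c sectionsD[OF assms(1)] sectionsD[OF assms(2)] alt_add add_divide_distrib)
qed

lemma coefficient_scale:
  assumes "\<eta> \<in> sections (alt DIM('v))"
  shows "coefficient \<mu> (\<lambda>x. f x *\<^sub>R \<eta> x) = (\<lambda>x. f x *\<^sub>R coefficient \<mu> \<eta> x)"
proof -
  obtain bs where "\<forall>\<eta> x. \<eta> x \<in> alt DIM('v) \<longrightarrow>
      coefficient \<mu> \<eta> x = \<eta> x bs / \<mu> bs \<and> coefficient \<mu> \<eta> x *\<^sub>R \<mu> = \<eta> x"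
    using coefficient[OF \<mu> \<mu>_nonzero] .
  then have c: "coefficient \<mu> \<eta> x = \<eta> x bs / \<mu> bs" if "\<eta> x \<in> alt DIM('v)" for \<eta> x
    using that by simp
  show ?thesis by (simp add: fun_eq_iff c sectionsD[OF assms] alt_scale)
qed

lemma coefficient_multiple: "coefficient \<mu> (\<lambda>x. g x *\<^sub>R \<mu>) = g"
  unfolding coefficient_def using \<mu>_nonzero by (intro ext the_equality) auto

lemma smooth_coefficient:
  assumes "\<eta> \<in> sections (alt DIM('v))"
  shows "smooth (coefficient \<mu> \<eta>)"
proof -
  obtain bs where "\<forall>\<eta> x. \<eta> x \<in> alt DIM('v) \<longrightarrow>
      coefficient \<mu> \<eta> x = \<eta> x bs / \<mu> bs \<and> coefficient \<mu> \<eta> x *\<^sub>R \<mu> = \<eta> x"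
    using coefficient[OF \<mu> \<mu>_nonzero] .
  then have "coefficient \<mu> \<eta> = (\<lambda>x. \<eta> x bs * (1 / \<mu> bs))"
    using sectionsD[OF assms] by (simp add: fun_eq_iff)
  then show ?thesis using smooth_mult[OF sections_smooth[OF assms, of bs] smooth_const[of "1 / \<mu> bs"]] by simp
qed

lemma top_bracket_sections:
  assumes "smooth (rho X)" "\<eta> \<in> sections (alt DIM('v))"
  shows "top_bracket \<mu> X \<eta> \<in> sections (alt DIM('v))"
  unfolding sections_alt_iff top_bracket_def
  using smooth_der[OF assms(1) smooth_coefficient[OF assms(2)]] \<mu>
  by (auto intro: alt_scale smooth_mult smooth_const)

lemma coefficient_top_bracket: "coefficient \<mu> (top_bracket \<mu> X \<eta>) = der (rho X) (coefficient \<mu> \<eta>)"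
  unfolding top_bracket_def by (rule coefficient_multiple)

lemma top_bracket_add:
  "\<eta> \<in> sections (alt DIM('v)) \<Longrightarrow> \<theta> \<in> sections (alt DIM('v)) \<Longrightarrow>
    top_bracket \<mu> X (\<lambda>x. \<eta> x + \<theta> x) = (\<lambda>x. top_bracket \<mu> X \<eta> x + top_bracket \<mu> X \<theta> x)"
  by (simp add: top_bracket_def coefficient_add der_add smooth_coefficient scaleR_add_left)

lemma top_bracket_Leibniz:
  assumes f: "smooth f" and \<eta>: "\<eta> \<in> sections (alt DIM('v))"
  shows "top_bracket \<mu> X (\<lambda>x. f x *\<^sub>R \<eta> x) = (\<lambda>x. f x *\<^sub>R top_bracket \<mu> X \<eta> x + der (rho X) f x *\<^sub>R \<eta> x)"
proof
  fix x
  have "der (rho X) f x *\<^sub>R \<eta> x = (der (rho X) f x * coefficient \<mu> \<eta> x) *\<^sub>R \<mu>"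
    using coefficient_scaleR[OF \<eta>, of x] by (metis scaleR_scaleR)
  then show "top_bracket \<mu> X (\<lambda>x. f x *\<^sub>R \<eta> x) x = f x *\<^sub>R top_bracket \<mu> X \<eta> x + der (rho X) f x *\<^sub>R \<eta> x"
    unfolding top_bracket_def coefficient_scale[OF \<eta>]
    by (simp add: der_bilinear[OF bounded_bilinear_mult] f smooth_coefficient[OF \<eta>] scaleR_add_left)
qed

lemma top_bracket_minus:
  assumes "\<eta> \<in> sections (alt DIM('v))"
  shows "top_bracket \<mu> X (\<lambda>x. - \<eta> x) = (\<lambda>x. - top_bracket \<mu> X \<eta> x)"
  using top_bracket_Leibniz[OF smooth_const[of "-1"] assms] by simp

lemma top_bracket_zero_right: "top_bracket \<mu> X 0 = 0"
  unfolding top_bracket_def zero_fun_def using coefficient_multiple[of "\<lambda>_. 0"] by (simp add: zero_fun_def)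

lemma top_bracket_zero_field:
  "\<eta> \<in> sections (alt DIM('v)) \<Longrightarrow> rho X = 0 \<Longrightarrow> top_bracket \<mu> X \<eta> = 0"
  by (simp add: top_bracket_def fun_eq_iff smooth_coefficient)

lemma top_bracket_commutator:
  assumes X: "X \<in> sections (alt 1)" and Y: "Y \<in> sections (alt 1)" and \<eta>: "\<eta> \<in> sections (alt DIM('v))"
  shows "top_bracket \<mu> (nr_bracket 1 1 X Y) \<eta> x
    = top_bracket \<mu> X (top_bracket \<mu> Y \<eta>) x - top_bracket \<mu> Y (top_bracket \<mu> X \<eta>) x"
  unfolding top_bracket_def[of \<mu> _ "top_bracket _ _ _"] coefficient_top_bracket
  by (simp add: top_bracket_def rho_nr_bracket[OF X Y] scaleR_diff_left
      der_vf_bracket[OF smooth_rho[OF X] smooth_rho[OF Y] smooth_coefficient[OF \<eta>]] del: One_nat_def)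

lemma der_form_top: "\<eta> \<in> sections (alt DIM('v)) \<Longrightarrow> der_form (rho X) \<eta> = top_bracket \<mu> X \<eta>"
proof (intro ext)
  fix x vs assume \<eta>: "\<eta> \<in> sections (alt DIM('v))"
  have "(\<lambda>y. \<eta> y vs) = (\<lambda>y. coefficient \<mu> \<eta> y *\<^sub>R \<mu> vs)"
    using coefficient_scaleR[OF \<eta>] by (metis scaleR_fun_apply)
  then show "der_form (rho X) \<eta> x vs = top_bracket \<mu> X \<eta> x vs"
    unfolding der_form_def top_bracket_def
    by (simp add: der_bilinear[OF bounded_bilinear_mult] smooth_coefficient[OF \<eta>])
qed

lemma insertion_top_1:
  assumes "\<psi> \<in> alt k" "B \<in> alt 1"
  shows "insertion k 1 (tens \<psi> w) B = tens \<psi> (B [w])"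
proof -
  have c: "component b (tens \<psi> w) = (w \<bullet> b) *\<^sub>R \<psi>" for b
    by (rule component_tens)
  have "insertion k 1 (tens \<psi> w) B = wedge k 0 \<psi> (contract w B)"
    by (simp add: insertion_def c wedge_scale_left wedge_scale_right[symmetric] wedge_sum_right[symmetric]
        contract_basis[OF assms(2)] del: One_nat_def)
  also have "\<dots> = tens \<psi> (B [w])"
    using wedge_0_right[OF _ assms(1), of "contract w B"] contract_alt'[OF assms(2), of w]
    by (simp add: tens_def contract_def)
  finally show ?thesis .
qed

text \<open>The algebraic action of \<open>X\<close> on \<open>\<eta> \<otimes> x\<close> vanishes by \<open>insertion_sl_top\<close>. The derivative of the factor \<open>x\<close> along
\<open>rho X\<close> gives \<open>\<eta> \<otimes> rho X\<close>, which cancels the insertion of \<open>\<eta> \<otimes> x\<close> into \<open>X\<close>.\<close>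

lemma nr_bracket_top_tensor:
  assumes X: "X \<in> sections (K 1)" and \<eta>: "\<eta> \<in> sections (alt DIM('v))"
  shows "nr_bracket 1 DIM('v) X (\<lambda>x. c *\<^sub>R tens (\<eta> x) x) = (\<lambda>x. c *\<^sub>R tens (top_bracket \<mu> X \<eta> x) x)"
proof
  fix x
  note \<eta>x = sectionsD[OF \<eta>]
  have 1: "insertion 1 DIM('v) (X x) (c *\<^sub>R tens (\<eta> x) x) = 0"
    by (intro insertion_sl_top sectionsD[OF X] alt_scale tens_alt \<eta>x)
  have 2: "insertion DIM('v) 1 (c *\<^sub>R tens (\<eta> x) x) (X x) = c *\<^sub>R tens (\<eta> x) (rho X x)"
    using sectionsD[OF X, of x] unfolding insertion_scale_left
    by (subst insertion_top_1[OF \<eta>x]) (auto simp: K_iff rho_def)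
  have "der_form (rho X) (\<lambda>x. c *\<^sub>R tens (\<eta> x) x) x
      = c *\<^sub>R (tens (\<eta> x) (rho X x) + tens (der_form (rho X) \<eta> x) x)"
    by (simp add: der_form_def tens_def fun_eq_iff der_scaleR sections_smooth[OF \<eta>] smooth_intros
        der_bounded_linear[OF bounded_linear_mult_right] scaleR_add_right)
  then show "nr_bracket 1 DIM('v) X (\<lambda>x. c *\<^sub>R tens (\<eta> x) x) x = c *\<^sub>R tens (top_bracket \<mu> X \<eta> x) x"
    using dim 1 2 by (simp add: nr_bracket_def der_form_top[OF \<eta>] scaleR_add_right)
qed

text \<open>Apply \<open>\<iota>\<^sub>x\<close> to \<open>nr_bracket_top_tensor\<close>.\<close>

lemma d_top_bracket:
  assumes X: "X \<in> sections (K 1)" and \<eta>: "\<eta> \<in> sections (alt DIM('v))"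
  shows "d_top (top_bracket \<mu> X \<eta>) = nr_bracket 1 (DIM('v) - 1) X (d_top \<eta>)"
proof -
  note X' = sections_K_alt[OF X]
  have H: "(\<lambda>x. (-1) ^ DIM('v) *\<^sub>R tens (\<eta> x) x) \<in> sections (alt DIM('v))"
    by (intro sections_alt_scale tens_sections \<eta> smooth_id)
  have "d_top (top_bracket \<mu> X \<eta>) = euler (\<lambda>x. (-1) ^ DIM('v) *\<^sub>R tens (top_bracket \<mu> X \<eta> x) x)"
    by (rule d_top_eq(1)[OF sectionsD[OF top_bracket_sections[OF smooth_rho[OF X'] \<eta>]]])
  also have "\<dots> = euler (nr_bracket 1 DIM('v) X (\<lambda>x. (-1) ^ DIM('v) *\<^sub>R tens (\<eta> x) x))"
    unfolding nr_bracket_top_tensor[OF X \<eta>] ..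
  also have "\<dots> = nr_bracket 1 (DIM('v) - 1) X (euler (\<lambda>x. (-1) ^ DIM('v) *\<^sub>R tens (\<eta> x) x))"
    by (rule euler_nr_bracket_1[OF X' H dim])
  also have "\<dots> = nr_bracket 1 (DIM('v) - 1) X (d_top \<eta>)"
    unfolding d_top_eq(1)[OF sectionsD[OF \<eta>]] ..
  finally show ?thesis .
qed

end


section \<open>Linearity and the Leibniz rule for the bracket\<close>

lemma nr_bracket_add_right:
  fixes A B C :: "'v::euclidean_space \<Rightarrow> 'v list \<Rightarrow> 'v"
  assumes A: "A \<in> sections (alt a)" and B: "B \<in> sections (alt b)" and C: "C \<in> sections (alt b)"
  shows "nr_bracket a b A (\<lambda>x. B x + C x) = (\<lambda>x. nr_bracket a b A B x + nr_bracket a b A C x)"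
proof
  fix x
  have "der_form (rho (\<lambda>x. B x + C x)) A x = der_form (rho B) A x + der_form (rho C) A x"
    by (simp add: der_form_def der_def rho_def fun_eq_iff linear_add[OF linear_frechet[OF sections_smooth[OF A]]])
  then show "nr_bracket a b A (\<lambda>x. B x + C x) x = nr_bracket a b A B x + nr_bracket a b A C x"
    by (simp add: nr_bracket_def insertion_linear der_form_add[OF B C] scaleR_add_right)
qed

lemma nr_bracket_Leibniz:
  fixes A B :: "'v::euclidean_space \<Rightarrow> 'v list \<Rightarrow> 'v"
  assumes A: "A \<in> sections (alt a)" and B: "B \<in> sections (alt b)" and f: "smooth f"
  shows "nr_bracket a b A (\<lambda>x. f x *\<^sub>R B x)
    = (\<lambda>x. f x *\<^sub>R nr_bracket a b A B x + (if a = 1 then der (rho A) f x else 0) *\<^sub>R B x)"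
proof
  fix x
  have 1: "der_form (rho (\<lambda>x. f x *\<^sub>R B x)) A x = f x *\<^sub>R der_form (rho B) A x"
    by (simp add: der_form_def der_def rho_def fun_eq_iff linear_scale[OF linear_frechet[OF sections_smooth[OF A]]])
  have 2: "der_form X (\<lambda>x. f x *\<^sub>R B x) x = f x *\<^sub>R der_form X B x + der X f x *\<^sub>R B x" for X
    by (simp add: der_form_def fun_eq_iff der_scaleR f sections_smooth[OF B])
  show "nr_bracket a b A (\<lambda>x. f x *\<^sub>R B x) x
    = f x *\<^sub>R nr_bracket a b A B x + (if a = 1 then der (rho A) f x else 0) *\<^sub>R B x"
    by (simp add: nr_bracket_def insertion_linear 1 2 algebra_simps)
qed

lemma nr_bracket_zero_right:
  fixes A :: "'v::euclidean_space \<Rightarrow> 'v list \<Rightarrow> 'v"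
  assumes A: "A \<in> sections (alt a)"
  shows "nr_bracket a b A 0 = 0"
proof -
  have "(0 :: 'v \<Rightarrow> 'v list \<Rightarrow> 'v) \<in> sections (alt b)"
    by (simp add: sections_alt_iff)
  moreover have "(\<lambda>x::'v. (0 :: 'v list \<Rightarrow> 'v)) = 0"
    by (simp add: fun_eq_iff)
  ultimately show ?thesis
    using nr_bracket_Leibniz[OF A _ smooth_const[of 0], of 0 b] by simp
qed

lemma nr_bracket_zero_left:
  fixes B :: "'v::euclidean_space \<Rightarrow> 'v list \<Rightarrow> 'v"
  assumes B: "B \<in> sections (alt b)"
  shows "nr_bracket a b 0 B = 0"
  using nr_bracket_skew[of a b 0 B] nr_bracket_zero_right[OF B, of a] by (simp add: fun_eq_iff)

lemma sections_K_ge_dim: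
  fixes A :: "'v::euclidean_space \<Rightarrow> 'v list \<Rightarrow> 'v"
  assumes "A \<in> sections (K k)" "k \<ge> DIM('v)"
  shows "A = 0"
  using K_ge_dim[OF sectionsD[OF assms(1)] assms(2)] by (simp add: fun_eq_iff)

lemma euler_K:
  fixes A :: "'v::euclidean_space \<Rightarrow> 'v list \<Rightarrow> 'v"
  assumes A: "A \<in> sections (K k)"
  shows "euler A \<in> sections (K (k - 1))"
proof -
  have "tr (euler A x) = 0" for x
    using tr_contract[OF sectionsD[OF sections_K_alt[OF A]], of x x] sectionsD[OF A, of x]
    by (simp add: euler_contract[OF sections_K_alt[OF A]] K_iff)
  then show ?thesis
    using euler_sections[OF sections_K_alt[OF A]] unfolding sections_K_iff sections_alt_iff by (simp add: K_iff)
qed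

lemma d_top_K:
  fixes \<eta> :: "'v::euclidean_space \<Rightarrow> 'v list \<Rightarrow> real"
  assumes \<eta>: "\<eta> \<in> sections (alt DIM('v))"
  shows "d_top \<eta> \<in> sections (K (DIM('v) - 1))"
proof -
  have H: "(\<lambda>x. (-1) ^ DIM('v) *\<^sub>R tens (\<eta> x) x) \<in> sections (alt DIM('v))"
    by (intro sections_alt_scale tens_sections \<eta> smooth_id)
  have "tr (d_top \<eta> x) = 0" for x
    using tr_tens[OF contract_alt'[OF sectionsD[OF \<eta>]]]
    by (simp add: d_top_eq(2)[OF sectionsD[OF \<eta>]] tr_scale contract_self[OF sectionsD[OF \<eta>]])
  then show ?thesis
    using euler_sections[OF H] unfolding d_top_eq(1)[OF sectionsD[OF \<eta>], symmetric] sections_K_iff sections_alt_iff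
    by (simp add: K_iff)
qed


section \<open>The graded bundle\<close>

definition in_K :: "('v \<Rightarrow> 'v list \<Rightarrow> 'v) \<Rightarrow> 'v::euclidean_space \<Rightarrow> 'v fibre"
  where "in_K A = (\<lambda>x. (A x, 0))"

definition in_top :: "('v \<Rightarrow> 'v list \<Rightarrow> real) \<Rightarrow> 'v::euclidean_space \<Rightarrow> 'v fibre"
  where "in_top \<eta> = (\<lambda>x. (0, \<eta> x))"

lemma in_K_0 [simp]: "in_K 0 = 0" "in_K A = 0 \<longleftrightarrow> A = 0" "in_K A = in_K B \<longleftrightarrow> A = B"
  by (auto simp: in_K_def fun_eq_iff zero_prod_def)

lemma in_top_0 [simp]: "in_top 0 = 0" "in_top \<eta> = 0 \<longleftrightarrow> \<eta> = 0"
  by (auto simp: in_top_def fun_eq_iff zero_prod_def)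

lemma subspace_E_mu: "subspace (E_mu i)"
  unfolding E_mu_def
  by (simp add: subspace_Times subspace_alt subspace_K subspace_single_0)

lemma zero_sections_E_mu: "0 \<in> sections (E_mu i)"
  by (simp add: sections_def subspace_0[OF subspace_E_mu] linear_0)

text \<open>For \<open>k \<ge> n\<close> the section \<open>A\<close> is zero. Admitting these \<open>k\<close> here and in \<open>d_mu_in_K\<close> and \<open>br_K_K\<close> allows brackets to be
computed without asking whether their degree is still in range.\<close>

lemma in_K_sections:
  fixes A :: "'v::euclidean_space \<Rightarrow> 'v list \<Rightarrow> 'v"
  assumes A: "A \<in> sections (K k)" and k: "k \<ge> 1"
  shows "in_K A \<in> sections (E_mu (1 - int k))"
proof (cases "k < DIM('v)")
  case True
  then have "E_mu (1 - int k) = K k \<times> ({0} :: ('v list \<Rightarrow> real) set)" using k by (auto simp: E_mu_def)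
  then show ?thesis using A by (simp add: sections_Times_left in_K_def)
next
  case False
  then show ?thesis using sections_K_ge_dim[OF A] by (simp add: zero_sections_E_mu)
qed

lemma in_top_sections:
  fixes \<eta> :: "'v::euclidean_space \<Rightarrow> 'v list \<Rightarrow> real"
  shows "\<eta> \<in> sections (alt DIM('v)) \<Longrightarrow> in_top \<eta> \<in> sections (E_mu (1 - int DIM('v)))"
  by (simp add: E_mu_def sections_Times_right in_top_def)

lemma sections_E_mu_cases [consumes 1, case_names K top zero]:
  fixes a :: "'v::euclidean_space \<Rightarrow> 'v fibre"
  assumes a: "a \<in> sections (E_mu i)"
  obtains k A where "1 \<le> k" "k < DIM('v)" "i = 1 - int k" "A \<in> sections (K k)" "a = in_K A"
  | \<eta> where "i = 1 - int DIM('v)" "\<eta> \<in> sections (alt DIM('v))" "a = in_top \<eta>"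
  | "a = 0" "i < 1 - int DIM('v) \<or> i > 0"
proof -
  consider "i = 1 - int DIM('v)" | "1 - int DIM('v) < i" "i \<le> 0" | "i < 1 - int DIM('v) \<or> i > 0" by linarith
  then show ?thesis
  proof cases
    case 1
    then have "a \<in> sections ({0} \<times> alt DIM('v))" using a by (simp add: E_mu_def)
    then show ?thesis
      using that(2)[of "\<lambda>x. snd (a x)"] 1 unfolding sections_Times_right in_top_def
      by (metis prod.collapse)
  next
    case 2
    then have "a \<in> sections (K (nat (1 - i)) \<times> {0})" using a by (simp add: E_mu_def)
    then show ?thesis
      using that(1)[of "nat (1 - i)" "\<lambda>x. fst (a x)"] 2 unfolding sections_Times_left in_K_def
      by (auto simp: prod_eq_iff fun_eq_iff)
  next
    case 3
    then have "E_mu i = ({0} :: 'v fibre set)" by (auto simp: E_mu_def)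
    then show ?thesis using that(3) a 3 by (simp add: sections_zero)
  qed
qed

lemma d_mu_in_K:
  fixes A :: "'v::euclidean_space \<Rightarrow> 'v list \<Rightarrow> 'v"
  assumes A: "A \<in> sections (K k)" and k: "k \<ge> 2"
  shows "d_mu (1 - int k) (in_K A) = in_K (euler A)"
proof (cases "k < DIM('v)")
  case True
  then show ?thesis using k by (simp add: d_mu_def in_K_def)
next
  case False
  then have A0: "A = 0" using sections_K_ge_dim[OF A] by simp
  have "euler 0 = (0 :: 'v \<Rightarrow> 'v list \<Rightarrow> 'v)" by (simp add: euler_def fun_eq_iff)
  moreover have "d_top (\<lambda>y. 0) x = 0" for x :: 'v
    by (subst d_top_eq(2)) (simp_all add: tens_def contract_def fun_eq_iff)
  ultimately show ?thesis using False k by (simp add: d_mu_def A0) (simp add: fun_eq_iff zero_prod_def)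
qed

lemma d_mu_in_top: "d_mu (1 - int DIM('v)) (in_top \<eta>) = in_K (d_top \<eta>)"
  for \<eta> :: "'v::euclidean_space \<Rightarrow> 'v list \<Rightarrow> real"
  by (simp add: d_mu_def in_K_def in_top_def)

lemma d_mu_zero: "d_mu i (0 :: 'v::euclidean_space \<Rightarrow> 'v fibre) = 0"
proof -
  have "d_top (\<lambda>y. 0) x = 0" for x :: 'v
    by (subst d_top_eq(2)) (simp_all add: tens_def contract_def fun_eq_iff)
  then show ?thesis by (auto simp: d_mu_def fun_eq_iff zero_prod_def euler_def)
qed

lemma d_mu_0: "DIM('v) \<ge> 2 \<Longrightarrow> d_mu 0 (a :: 'v::euclidean_space \<Rightarrow> 'v fibre) = 0"
  by (simp add: d_mu_def)

lemma d_mu_sections: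
  fixes a :: "'v::euclidean_space \<Rightarrow> 'v fibre"
  assumes dim: "DIM('v) \<ge> 2" and a: "a \<in> sections (E_mu i)"
  shows "d_mu i a \<in> sections (E_mu (i + 1))"
  using a
proof (cases rule: sections_E_mu_cases)
  case (K k A)
  show ?thesis
  proof (cases "k = 1")
    case True
    then show ?thesis using K dim by (simp add: d_mu_0 zero_sections_E_mu)
  next
    case False
    then have "in_K (euler A) \<in> sections (E_mu (1 - int (k - 1)))"
      using K by (intro in_K_sections euler_K) auto
    moreover have "1 - int (k - 1) = i + 1" using K by simp
    ultimately show ?thesis using d_mu_in_K[OF K(4)] K False by simp
  qed
next
  case (top \<eta>)
  then have "in_K (d_top \<eta>) \<in> sections (E_mu (1 - int (DIM('v) - 1)))"
    using dim by (intro in_K_sections d_top_K) auto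
  moreover have "1 - int (DIM('v) - 1) = i + 1" using top dim by simp
  ultimately show ?thesis using top by (simp add: d_mu_in_top)
next
  case zero
  then show ?thesis by (simp add: d_mu_zero zero_sections_E_mu)
qed

lemma euler_add: "euler (\<lambda>x. A x + B x) x = euler A x + euler B x"
  by (simp add: euler_def contract_add scaleR_add_right sum.distrib)

lemma euler_scale: "euler (\<lambda>x. f x *\<^sub>R A x) x = f x *\<^sub>R euler A x"
  by (simp add: euler_def contract_scale scaleR_sum_right mult.commute)

lemma d_mu_linear:
  assumes dim: "DIM('v) \<ge> 2"
  shows "Cinf_linear (E_mu i) (E_mu (i + 1)) (d_mu i :: ('v::euclidean_space \<Rightarrow> 'v fibre) \<Rightarrow> _)"
  unfolding Cinf_linear_def
proof (intro conjI ballI allI impI)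
  fix a b :: "'v \<Rightarrow> 'v fibre" and f :: "'v \<Rightarrow> real"
  assume a: "a \<in> sections (E_mu i)"
  show "d_mu i a \<in> sections (E_mu (i + 1))" by (rule d_mu_sections[OF dim a])
  have snd_alt: "snd (c x) \<in> alt DIM('v)" if "c \<in> sections (E_mu i)" "i = 1 - int DIM('v)" for c :: "'v \<Rightarrow> 'v fibre" and x
    using sectionsD[OF that(1), of x] that(2) by (auto simp: E_mu_def)
  show "d_mu i (a + b) = d_mu i a + d_mu i b" if b: "b \<in> sections (E_mu i)"
  proof (cases "i = 1 - int DIM('v)")
    case True
    have "d_top (\<lambda>y. snd (a y) + snd (b y)) x = d_top (\<lambda>y. snd (a y)) x + d_top (\<lambda>y. snd (b y)) x" for x
      using snd_alt[OF a True] snd_alt[OF b True]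
      by (simp add: d_top_eq(2) alt_add contract_add) (simp add: tens_def fun_eq_iff algebra_simps)
    then show ?thesis by (simp add: d_mu_def True fun_eq_iff)
  qed (auto simp: d_mu_def fun_eq_iff euler_add)
  show "d_mu i (\<lambda>x. f x *\<^sub>R a x) = (\<lambda>x. f x *\<^sub>R d_mu i a x)"
  proof (cases "i = 1 - int DIM('v)")
    case True
    have "d_top (\<lambda>y. f y *\<^sub>R snd (a y)) x = f x *\<^sub>R d_top (\<lambda>y. snd (a y)) x" for x
      using snd_alt[OF a True]
      by (simp add: d_top_eq(2) alt_scale contract_scale) (simp add: tens_def fun_eq_iff algebra_simps)
    then show ?thesis by (simp add: d_mu_def True fun_eq_iff)
  qed (auto simp: d_mu_def fun_eq_iff euler_scale)
qed

lemma rho_mu_linear: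
  assumes dim: "DIM('v) \<ge> 2"
  shows "Cinf_linear (E_mu 0) UNIV (rho_mu :: ('v::euclidean_space \<Rightarrow> 'v fibre) \<Rightarrow> _)"
  unfolding Cinf_linear_def
proof (intro conjI ballI allI impI)
  fix a :: "'v \<Rightarrow> 'v fibre"
  assume a: "a \<in> sections (E_mu 0)"
  then have "smooth (rho_mu a)"
  proof (cases rule: sections_E_mu_cases)
    case (K k A)
    then have "A \<in> sections (alt 1)" using sections_K_alt by auto
    then show ?thesis using K by (simp add: rho_mu_def in_K_def smooth_rho)
  qed (use dim in auto)
  then show "rho_mu a \<in> sections UNIV" by (simp add: sections_def smooth_linear)
qed (simp_all add: rho_mu_def rho_def fun_eq_iff)

lemma d_mu_d_mu:
  fixes a :: "'v::euclidean_space \<Rightarrow> 'v fibre"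
  assumes dim: "DIM('v) \<ge> 2" and a: "a \<in> sections (E_mu i)"
  shows "d_mu (i + 1) (d_mu i a) = 0"
  using a
proof (cases rule: sections_E_mu_cases)
  case (K k A)
  consider "k = 1" | "k = 2" | "k \<ge> 3" using K(1) by linarith
  then show ?thesis
  proof cases
    case 1
    then show ?thesis using K dim by (simp add: d_mu_0 d_mu_zero)
  next
    case 2
    then show ?thesis using K dim by (simp add: d_mu_0)
  next
    case 3
    have "1 - int (k - 1) = i + 1" using K by simp
    then show ?thesis
      using d_mu_in_K[OF K(4)] d_mu_in_K[OF euler_K[OF K(4)]] K 3 euler_euler[OF sections_K_alt[OF K(4)]] by simp
  qed
next
  case (top \<eta>)
  show ?thesis
  proof (cases "DIM('v) = 2")
    case True
    then show ?thesis using top dim by (simp add: d_mu_0)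
  next
    case False
    have H: "(\<lambda>x. (-1) ^ DIM('v) *\<^sub>R tens (\<eta> x) x) \<in> sections (alt DIM('v))"
      by (intro sections_alt_scale tens_sections top smooth_id)
    have "euler (d_top \<eta>) = 0"
      unfolding d_top_eq(1)[OF sectionsD[OF top(2)]] by (rule euler_euler[OF H])
    moreover have "1 - int (DIM('v) - 1) = i + 1" using top dim by simp
    ultimately show ?thesis
      using d_mu_in_K[OF d_top_K[OF top(2)]] top dim False by (simp add: d_mu_in_top)
  qed
qed (simp add: d_mu_zero)

lemma rho_mu_d_mu:
  fixes a :: "'v::euclidean_space \<Rightarrow> 'v fibre"
  assumes dim: "DIM('v) \<ge> 2" and a: "a \<in> sections (E_mu (- 1))"
  shows "rho_mu (d_mu (- 1) a) = 0"
proof -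
  have rho: "rho_mu (in_K A) = rho A" for A :: "'v \<Rightarrow> 'v list \<Rightarrow> 'v" by (simp add: rho_mu_def in_K_def)
  show ?thesis
    using a
  proof (cases rule: sections_E_mu_cases)
    case (K k A)
    then have "k = 2" by simp
    then show ?thesis
      using d_mu_in_K[OF K(4)] K rho_euler_0[of A] sections_K_alt[OF K(4)] by (simp add: rho)
  next
    case (top \<eta>)
    then have n: "DIM('v) = 2" by simp
    have "(\<lambda>x. (-1) ^ DIM('v) *\<^sub>R tens (\<eta> x) x) \<in> sections (alt 2)"
      using top(2) unfolding n by (intro sections_alt_scale tens_sections smooth_id)
    then have "rho (d_top \<eta>) = 0"
      unfolding d_top_eq(1)[OF sectionsD[OF top(2)]] by (rule rho_euler_0)
    then show ?thesis using top d_mu_in_top[of \<eta>] by (simp add: rho)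
  next
    case zero
    then show ?thesis by (simp add: d_mu_zero) (simp add: rho_mu_def rho_def fun_eq_iff)
  qed
qed


lemma minus_one_powi_diff: "k \<ge> 1 \<Longrightarrow> (-1::real) powi (1 - int k) = (-1) ^ (k - 1)"
proof -
  assume "k \<ge> 1"
  then have "1 - int k = - int (k - 1)" by simp
  then have "(-1::real) powi (1 - int k) = inverse ((-1) ^ (k - 1))"
    by (simp only: power_int_minus power_int_of_nat)
  then show ?thesis by (cases "even (k - 1)") simp_all
qed

lemma minus_one_powi_mult:
  "k \<ge> 1 \<Longrightarrow> l \<ge> 1 \<Longrightarrow> (-1::real) powi ((1 - int k) * (1 - int l)) = (-1) ^ ((k - 1) * (l - 1))"
proof -
  assume "k \<ge> 1" "l \<ge> 1"
  then have "(1 - int k) * (1 - int l) = int ((k - 1) * (l - 1))"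
    by (cases k; cases l) simp_all
  then show ?thesis by (simp only: power_int_of_nat)
qed

lemma in_K_add: "in_K A + in_K B = in_K (\<lambda>x. A x + B x)"
  by (simp add: in_K_def fun_eq_iff)
lemma in_K_scale: "(\<lambda>x. f x *\<^sub>R in_K A x) = in_K (\<lambda>x. f x *\<^sub>R A x)"
  by (simp add: in_K_def)
lemma in_K_scaleR: "c *\<^sub>R in_K A = in_K (\<lambda>x. c *\<^sub>R A x)"
  by (simp add: in_K_def fun_eq_iff)
lemma in_K_minus: "- in_K A = in_K (\<lambda>x. - A x)"
  by (simp add: in_K_def fun_eq_iff)
lemma in_top_add: "in_top A + in_top B = in_top (\<lambda>x. A x + B x)"
  by (simp add: in_top_def fun_eq_iff)
lemma in_top_scale: "(\<lambda>x. f x *\<^sub>R in_top A x) = in_top (\<lambda>x. f x *\<^sub>R A x)"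
  by (simp add: in_top_def)
lemma in_top_minus: "- in_top A = in_top (\<lambda>x. - A x)"
  by (simp add: in_top_def fun_eq_iff)

lemma rho_mu_in_K: "rho_mu (in_K A) = rho A"
  by (simp add: rho_mu_def in_K_def)


section \<open>The dg-Lie algebroid\<close>

context volume_form
begin

abbreviation "br \<equiv> bracket_mu \<mu>"

lemma br_zero_right:
  assumes "a \<in> sections (E_mu i)" shows "br i j a 0 = 0"
  using assms
proof (cases rule: sections_E_mu_cases)
  case (K k A)
  then show ?thesis
    using nr_bracket_zero_right[OF sections_K_alt[OF K(4)]] top_bracket_zero_right
    by (auto simp: bracket_mu_def Let_def in_K_def zero_fun_def fun_eq_iff zero_prod_def)
next
  case (top \<eta>)
  then show ?thesis
    using top_bracket_zero_field[OF top(2), of 0] dim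
    by (auto simp: bracket_mu_def Let_def in_top_def zero_fun_def fun_eq_iff zero_prod_def rho_def)
next
  case zero
  then show ?thesis by (auto simp: bracket_mu_def Let_def)
qed

lemma br_zero_left:
  assumes "b \<in> sections (E_mu j)" shows "br i j 0 b = 0"
  using assms
proof (cases rule: sections_E_mu_cases)
  case (K k A)
  then show ?thesis
    using nr_bracket_zero_left[OF sections_K_alt[OF K(4)]] top_bracket_zero_right
    by (auto simp: bracket_mu_def Let_def in_K_def zero_fun_def fun_eq_iff zero_prod_def)
next
  case (top \<eta>)
  then show ?thesis
    using top_bracket_zero_field[OF top(2), of 0] dim
    by (auto simp: bracket_mu_def Let_def in_top_def zero_fun_def fun_eq_iff zero_prod_def rho_def)
next
  case zero
  then show ?thesis by (auto simp: bracket_mu_def Let_def)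
qed

lemma br_K_K:
  assumes A: "A \<in> sections (K k)" and B: "B \<in> sections (K l)" and kl: "k \<ge> 1" "l \<ge> 1"
  shows "br (1 - int k) (1 - int l) (in_K A) (in_K B) = in_K (nr_bracket k l A B)"
proof -
  consider "k < DIM('v)" "l < DIM('v)" | "A = 0" | "B = 0"
    using sections_K_ge_dim[OF A] sections_K_ge_dim[OF B] by linarith
  then show ?thesis
  proof cases
    case 1
    then show ?thesis using kl by (auto simp: bracket_mu_def Let_def in_K_def)
  next
    case 2
    then show ?thesis
      using br_zero_left[OF in_K_sections[OF B kl(2)]] nr_bracket_zero_left[OF sections_K_alt[OF B]] by simp
  next
    case 3
    then show ?thesis
      using br_zero_right[OF in_K_sections[OF A kl(1)]] nr_bracket_zero_right[OF sections_K_alt[OF A]] by simp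
  qed
qed

lemma br_K_top:
  "k \<ge> 1 \<Longrightarrow> br (1 - int k) (1 - int DIM('v)) (in_K A) (in_top \<eta>) = (if k = 1 then in_top (top_bracket \<mu> A \<eta>) else 0)"
  using dim by (auto simp: bracket_mu_def Let_def in_K_def in_top_def)

lemma br_top_K:
  "k \<ge> 1 \<Longrightarrow> br (1 - int DIM('v)) (1 - int k) (in_top \<eta>) (in_K A) = (if k = 1 then in_top (\<lambda>x. - top_bracket \<mu> A \<eta> x) else 0)"
  using dim by (auto simp: bracket_mu_def Let_def in_K_def in_top_def)

lemma br_top_top: "br (1 - int DIM('v)) (1 - int DIM('v)) a b = 0"
  using dim by (auto simp: bracket_mu_def Let_def)

lemma br_pos: "i > 0 \<Longrightarrow> br i j a b = 0" "j > 0 \<Longrightarrow> br i j a b = 0"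
  using dim by (auto simp: bracket_mu_def Let_def)

lemma smooth_rho_K: "A \<in> sections (K (Suc 0)) \<Longrightarrow> smooth (rho A)"
  for A :: "'v \<Rightarrow> 'v list \<Rightarrow> 'v"
  using smooth_rho[of A] sections_K_alt[of A 1] by simp

lemma degree_0_cases:
  fixes a :: "'v \<Rightarrow> 'v fibre"
  assumes "a \<in> sections (E_mu 0)"
  obtains A where "A \<in> sections (K 1)" "a = in_K A"
  using assms by (cases rule: sections_E_mu_cases) (use dim in auto)

lemma br_closed:
  fixes a b :: "'v \<Rightarrow> 'v fibre"
  assumes a: "a \<in> sections (E_mu i)" and b: "b \<in> sections (E_mu j)"
  shows "br i j a b \<in> sections (E_mu (i + j))"
  using a
proof (cases rule: sections_E_mu_cases)
  case a: (K k A)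
  from b show ?thesis
  proof (cases rule: sections_E_mu_cases)
    case b: (K l B)
    have "in_K (nr_bracket k l A B) \<in> sections (E_mu (1 - int (k + l - 1)))"
      using a b by (intro in_K_sections nr_bracket_K) auto
    moreover have "1 - int (k + l - 1) = i + j" using a b by simp
    ultimately show ?thesis using br_K_K[OF a(4) b(4)] a b by simp
  next
    case b: (top \<eta>)
    show ?thesis
    proof (cases "k = 1")
      case True
      then have "in_top (top_bracket \<mu> A \<eta>) \<in> sections (E_mu (1 - int DIM('v)))"
        using a b smooth_rho_K by (intro in_top_sections top_bracket_sections) auto
      then show ?thesis using br_K_top[OF a(1), of A \<eta>] a b True by simp
    next
      case False
      then show ?thesis using br_K_top[OF a(1), of A \<eta>] a b by (simp add: zero_sections_E_mu)
    qed
  next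
    case b: zero
    then show ?thesis using br_zero_right[OF assms(1)] by (simp add: zero_sections_E_mu)
  qed
next
  case a: (top \<eta>)
  from b show ?thesis
  proof (cases rule: sections_E_mu_cases)
    case b: (K l B)
    show ?thesis
    proof (cases "l = 1")
      case True
      then have "top_bracket \<mu> B \<eta> \<in> sections (alt DIM('v))"
        using a b smooth_rho_K by (intro top_bracket_sections) auto
      then have "in_top (\<lambda>x. - top_bracket \<mu> B \<eta> x) \<in> sections (E_mu (1 - int DIM('v)))"
        using sections_alt_scale[of _ _ "-1"] by (intro in_top_sections) simp
      then show ?thesis using br_top_K[OF b(1), of \<eta> B] a b True by simp
    next
      case False
      then show ?thesis using br_top_K[OF b(1), of \<eta> B] a b by (simp add: zero_sections_E_mu)
    qed
  next
    case b: (top \<theta>)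
    then show ?thesis using a br_top_top by (simp add: zero_sections_E_mu)
  next
    case b: zero
    then show ?thesis using br_zero_right[OF assms(1)] by (simp add: zero_sections_E_mu)
  qed
next
  case zero
  then show ?thesis using br_zero_left[OF b] by (simp add: zero_sections_E_mu)
qed

lemma br_skew:
  fixes a b :: "'v \<Rightarrow> 'v fibre"
  assumes a: "a \<in> sections (E_mu i)" and b: "b \<in> sections (E_mu j)"
  shows "br i j a b = - (((-1) powi (i * j)) *\<^sub>R br j i b a)"
  using a
proof (cases rule: sections_E_mu_cases)
  case a: (K k A)
  from b show ?thesis
  proof (cases rule: sections_E_mu_cases)
    case b: (K l B)
    have br: "br i j a b = in_K (nr_bracket k l A B)" "br j i b a = in_K (nr_bracket l k B A)"
      unfolding a(3,5) b(3,5) using br_K_K[OF a(4) b(4) a(1) b(1)] br_K_K[OF b(4) a(4) b(1) a(1)]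
      by simp_all
    show ?thesis
      unfolding br unfolding a(3) b(3) minus_one_powi_mult[OF a(1) b(1)] in_K_scaleR in_K_minus
      by (subst nr_bracket_skew) (rule refl)
  next
    case b: (top \<eta>)
    then show ?thesis
      using br_K_top[OF a(1), of A \<eta>] br_top_K[OF a(1), of \<eta> A] a by (simp add: in_top_minus)
  next
    case b: zero
    then show ?thesis using br_zero_right[OF assms(1)] br_zero_left[OF assms(1)] by simp
  qed
next
  case a: (top \<eta>)
  from b show ?thesis
  proof (cases rule: sections_E_mu_cases)
    case b: (K l B)
    then show ?thesis
      using br_K_top[OF b(1), of B \<eta>] br_top_K[OF b(1), of \<eta> B] a by (simp add: in_top_minus)
  next
    case b: (top \<theta>)
    then show ?thesis using a br_top_top by simp
  next
    case b: zero
    then show ?thesis using br_zero_right[OF assms(1)] br_zero_left[OF assms(1)] by simp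
  qed
next
  case zero
  then show ?thesis using br_zero_right[OF b] br_zero_left[OF b] by simp
qed

lemma br_add:
  fixes a b c :: "'v \<Rightarrow> 'v fibre"
  assumes a: "a \<in> sections (E_mu i)" and b: "b \<in> sections (E_mu j)" and c: "c \<in> sections (E_mu j)"
  shows "br i j a (b + c) = br i j a b + br i j a c"
proof -
  have bc: "b + c \<in> sections (E_mu j)" by (rule sections_add[OF subspace_E_mu b c])
  show ?thesis
    using a
  proof (cases rule: sections_E_mu_cases)
    case a: (K k A)
    from b show ?thesis
    proof (cases rule: sections_E_mu_cases)
      case b: (K l B)
      from c b obtain C where C: "C \<in> sections (K l)" "c = in_K C"
        by (cases rule: sections_E_mu_cases) auto
      have BC: "(\<lambda>x. B x + C x) \<in> sections (K l)"
        using sections_add[OF subspace_K b(4) C(1)] by (simp add: plus_fun_def)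
      show ?thesis
        using br_K_K[OF a(4) b(4) a(1) b(1)] br_K_K[OF a(4) C(1) a(1) b(1)] br_K_K[OF a(4) BC a(1) b(1)]
          nr_bracket_add_right[OF sections_K_alt[OF a(4)] sections_K_alt[OF b(4)] sections_K_alt[OF C(1)]]
          a b C by (simp add: in_K_add)
    next
      case b: (top \<eta>)
      from c b obtain \<theta> where \<theta>: "\<theta> \<in> sections (alt DIM('v))" "c = in_top \<theta>"
        by (cases rule: sections_E_mu_cases) auto
      show ?thesis
        using a b \<theta> top_bracket_add[OF b(2) \<theta>(1), of A] br_K_top[OF a(1)]
        by (simp add: in_top_add)
    next
      case b: zero
      then show ?thesis using br_zero_right[OF assms(1)] by simp
    qed
  next
    case a: (top \<eta>)
    from b show ?thesis
    proof (cases rule: sections_E_mu_cases)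
      case b: (K l B)
      from c b obtain C where C: "C \<in> sections (K l)" "c = in_K C"
        by (cases rule: sections_E_mu_cases) auto
      have "top_bracket \<mu> (\<lambda>x. B x + C x) \<eta> x = top_bracket \<mu> B \<eta> x + top_bracket \<mu> C \<eta> x" for x
        using linear_add[OF linear_frechet[OF smooth_coefficient[OF a(2)]]]
        by (simp add: top_bracket_def der_def rho_def scaleR_add_left)
      then show ?thesis
        using a b C br_top_K[OF b(1)] by (simp add: in_top_add in_K_add)
    next
      case b: (top \<theta>)
      then show ?thesis using a br_top_top by simp
    next
      case b: zero
      then show ?thesis using br_zero_right[OF assms(1)] by simp
    qed
  next
    case zero
    then show ?thesis using br_zero_left[OF b] br_zero_left[OF c] br_zero_left[OF bc] by simp
  qed
qed

lemma br_Leibniz: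
  fixes a b :: "'v \<Rightarrow> 'v fibre"
  assumes f: "smooth f" and a: "a \<in> sections (E_mu i)" and b: "b \<in> sections (E_mu j)"
  shows "br i j a (\<lambda>x. f x *\<^sub>R b x)
    = (\<lambda>x. f x *\<^sub>R br i j a b x + (if i = 0 then der (rho_mu a) f x else 0) *\<^sub>R b x)"
proof -
  have fb: "(\<lambda>x. f x *\<^sub>R b x) \<in> sections (E_mu j)" by (rule sections_scale[OF subspace_E_mu f b])
  show ?thesis
    using a
  proof (cases rule: sections_E_mu_cases)
    case a: (K k A)
    have i0: "i = 0 \<longleftrightarrow> k = 1" using a by auto
    from b show ?thesis
    proof (cases rule: sections_E_mu_cases)
      case b: (K l B)
      have fB: "(\<lambda>x. f x *\<^sub>R B x) \<in> sections (K l)"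
        by (rule sections_scale[OF subspace_K f b(4)])
      show ?thesis
        using br_K_K[OF a(4) b(4) a(1) b(1)] br_K_K[OF a(4) fB a(1) b(1)]
          nr_bracket_Leibniz[OF sections_K_alt[OF a(4)] sections_K_alt[OF b(4)] f] i0
        unfolding a(3,5) b(3,5) in_K_scale rho_mu_in_K by (simp add: in_K_def)
    next
      case b: (top \<eta>)
      show ?thesis
        using br_K_top[OF a(1)] top_bracket_Leibniz[OF f b(2)] i0
        unfolding a(3,5) b(1,3) in_top_scale rho_mu_in_K by (simp add: in_top_def fun_eq_iff zero_prod_def)
    next
      case b: zero
      then have z: "(\<lambda>x. f x *\<^sub>R b x) = 0" "b = 0" by (simp_all add: fun_eq_iff)
      show ?thesis unfolding z(1) unfolding z(2) br_zero_right[OF assms(2)] by (simp add: fun_eq_iff)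
    qed
  next
    case a: (top \<eta>)
    have i0: "i \<noteq> 0" using a dim by auto
    from b show ?thesis
    proof (cases rule: sections_E_mu_cases)
      case b: (K l B)
      have "top_bracket \<mu> (\<lambda>x. f x *\<^sub>R B x) \<eta> x = f x *\<^sub>R top_bracket \<mu> B \<eta> x" for x
        using linear_scale[OF linear_frechet[OF smooth_coefficient[OF a(2)]]]
        by (simp add: top_bracket_def der_def rho_def)
      then show ?thesis
        using br_top_K[OF b(1)] i0
        unfolding a(1,3) b(3,5) in_K_scale by (simp add: in_top_def fun_eq_iff zero_prod_def)
    next
      case b: (top \<theta>)
      then show ?thesis using a br_top_top i0 by (simp add: fun_eq_iff)
    next
      case b: zero
      then have z: "(\<lambda>x. f x *\<^sub>R b x) = 0" "b = 0" by (simp_all add: fun_eq_iff)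
      show ?thesis unfolding z(1) unfolding z(2) br_zero_right[OF assms(2)] by (simp add: fun_eq_iff)
    qed
  next
    case zero
    then have "i \<noteq> 0" by auto
    then show ?thesis
      unfolding zero(1) br_zero_left[OF b] br_zero_left[OF fb] by (simp add: fun_eq_iff)
  qed
qed

lemma anchor_br:
  fixes a b :: "'v \<Rightarrow> 'v fibre"
  assumes a: "a \<in> sections (E_mu 0)" and b: "b \<in> sections (E_mu 0)"
  shows "rho_mu (br 0 0 a b) = vf_bracket (rho_mu a) (rho_mu b)"
proof -
  obtain A where A: "A \<in> sections (K 1)" "a = in_K A" using degree_0_cases[OF a] .
  obtain B where B: "B \<in> sections (K 1)" "b = in_K B" using degree_0_cases[OF b] .
  have "br 0 0 a b = in_K (nr_bracket 1 1 A B)"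
    using br_K_K[OF A(1) B(1)] A B by simp
  then show ?thesis
    using rho_nr_bracket[OF sections_K_alt[OF A(1)] sections_K_alt[OF B(1)]] A B by (simp add: rho_mu_in_K)
qed

lemma d_br_K_K:
  fixes A B :: "'v \<Rightarrow> 'v list \<Rightarrow> 'v"
  assumes A: "A \<in> sections (K k)" and B: "B \<in> sections (K l)" and kl: "1 \<le> k" "1 \<le> l"
    and i: "i = 1 - int k" and j: "j = 1 - int l"
  shows "d_mu (i + j) (br i j (in_K A) (in_K B))
    = br (i + 1) j (d_mu i (in_K A)) (in_K B) + ((-1) powi i) *\<^sub>R br i (j + 1) (in_K A) (d_mu j (in_K B))"
proof -
  note A' = sections_K_alt[OF A] and B' = sections_K_alt[OF B]
  have AB: "br i j (in_K A) (in_K B) = in_K (nr_bracket k l A B)"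
    using br_K_K[OF A B kl] i j by simp
  have s: "i + j = 1 - int (k + l - 1)" using i j kl by simp
  have dAB: "d_mu (i + j) (br i j (in_K A) (in_K B)) = in_K (euler (nr_bracket k l A B))" if "k + l \<ge> 3"
    unfolding s AB using that by (intro d_mu_in_K nr_bracket_K[OF A B]) simp
  have k1: "br (i + 1) j (d_mu i (in_K A)) (in_K B) = 0" if "k = 1"
    using that i br_pos(1) by simp
  have l1: "br i (j + 1) (in_K A) (d_mu j (in_K B)) = 0" if "l = 1"
    using that j br_pos(2) by simp
  have k2: "br (i + 1) j (d_mu i (in_K A)) (in_K B) = in_K (nr_bracket (k - 1) l (euler A) B)" if "k \<ge> 2"
  proof -
    have "i + 1 = 1 - int (k - 1)" using i that by simp
    then show ?thesis
      using br_K_K[OF euler_K[OF A] B _ kl(2)] d_mu_in_K[OF A that] that i j by simp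
  qed
  have l2: "br i (j + 1) (in_K A) (d_mu j (in_K B)) = in_K (nr_bracket k (l - 1) A (euler B))" if "l \<ge> 2"
  proof -
    have "j + 1 = 1 - int (l - 1)" using j that by simp
    then show ?thesis
      using br_K_K[OF A euler_K[OF B] kl(1)] d_mu_in_K[OF B that] that i j by simp
  qed
  have p: "(-1::real) powi i = 1" if "k = 1" using that i by simp
  consider "k = 1" "l = 1" | "k = 1" "l \<ge> 2" | "k \<ge> 2" "l = 1" | "k \<ge> 2" "l \<ge> 2" using kl by linarith
  then show ?thesis
  proof cases
    case 1
    then show ?thesis using k1 l1 i j by (simp add: d_mu_0[OF dim])
  next
    case 2
    then show ?thesis
      using euler_nr_bracket_1[of A B l] A' B' by (subst dAB) (simp_all add: k1 l2 p)
  next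
    case 3
    have "euler (nr_bracket k 1 A B) = nr_bracket (k - 1) 1 (euler A) B"
    proof -
      have "nr_bracket 1 k B A \<in> sections (alt (1 + k - 1))"
        using B' 3 by (intro nr_bracket_sections A') simp
      then have BA: "nr_bracket 1 k B A \<in> sections (alt k)" by simp
      have "nr_bracket k 1 A B = (\<lambda>x. (-1) *\<^sub>R nr_bracket 1 k B A x)"
        using nr_bracket_skew[of k 1 A B] by simp
      then have "euler (nr_bracket k 1 A B) x = - euler (nr_bracket 1 k B A) x" for x
        using euler_scale[of "\<lambda>_. -1" "nr_bracket 1 k B A" x] by simp
      then show ?thesis
        using euler_nr_bracket_1[OF _ A' 3(1), of B] B' 3 nr_bracket_skew[of "k - 1" 1 "euler A" B]
        by (simp add: fun_eq_iff)
    qed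
    then show ?thesis using 3 by (subst dAB) (simp_all add: k2 l1)
  next
    case 4
    have "euler (nr_bracket k l A B) = (\<lambda>x. nr_bracket (k - 1) l (euler A) B x
        + (-1) powi i *\<^sub>R nr_bracket k (l - 1) A (euler B) x)"
      unfolding i minus_one_powi_diff[OF kl(1)] by (rule ext) (rule euler_nr_bracket[OF A' B' 4])
    then show ?thesis using 4 by (subst dAB) (simp_all add: k2 l2 in_K_scaleR in_K_add)
  qed
qed

lemma br_K_top_eq_0:
  "B \<in> sections (K m) \<Longrightarrow> m \<ge> 1 \<Longrightarrow> rho B = 0 \<or> m \<noteq> 1 \<Longrightarrow> \<eta> \<in> sections (alt DIM('v)) \<Longrightarrow>
    br (1 - int m) (1 - int DIM('v)) (in_K B) (in_top \<eta>) = 0"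
  using br_K_top[of m B \<eta>] top_bracket_zero_field[of \<eta> B] by auto

lemma br_top_K_eq_0:
  "B \<in> sections (K m) \<Longrightarrow> m \<ge> 1 \<Longrightarrow> rho B = 0 \<or> m \<noteq> 1 \<Longrightarrow> \<eta> \<in> sections (alt DIM('v)) \<Longrightarrow>
    br (1 - int DIM('v)) (1 - int m) (in_top \<eta>) (in_K B) = 0"
  using br_top_K[of m \<eta> B] top_bracket_zero_field[of \<eta> B] by (auto simp: fun_eq_iff in_top_def zero_prod_def)

lemma rho_d_top:
  fixes \<eta> :: "'v \<Rightarrow> 'v list \<Rightarrow> real"
  assumes "\<eta> \<in> sections (alt DIM('v))" "DIM('v) - 1 = 1"
  shows "rho (d_top \<eta>) = 0"
proof -
  have "1 - int DIM('v) = - 1" using assms(2) by simp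
  then show ?thesis
    using rho_mu_d_mu[OF dim, of "in_top \<eta>"] in_top_sections[OF assms(1)] d_mu_in_top[of \<eta>]
    by (simp add: rho_mu_in_K)
qed

lemma rho_euler_K: "A \<in> sections (K k) \<Longrightarrow> k - 1 = 1 \<Longrightarrow> rho (euler A) = 0"
  for A :: "'v \<Rightarrow> 'v list \<Rightarrow> 'v"
proof -
  assume "A \<in> sections (K k)" "k - 1 = 1"
  moreover from this have "k = 2" by simp
  ultimately show ?thesis using rho_euler_0[of A] sections_K_alt[of A k] by simp
qed

text \<open>For \<open>k = 1\<close> this is \<open>d_top_bracket\<close>. Otherwise every term vanishes: \<open>A\<close> has negative degree, \<open>\<iota>\<^sub>x A\<close> has
negative degree or zero anchor, and the bracket of \<open>A\<close> with \<open>d \<eta>\<close> has form degree at least \<open>n\<close>.\<close>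

lemma d_br_K_top:
  fixes A :: "'v \<Rightarrow> 'v list \<Rightarrow> 'v"
  assumes A: "A \<in> sections (K k)" and k: "1 \<le> k" and \<eta>: "\<eta> \<in> sections (alt DIM('v))"
    and i: "i = 1 - int k" and j: "j = 1 - int DIM('v)"
  shows "d_mu (i + j) (br i j (in_K A) (in_top \<eta>))
    = br (i + 1) j (d_mu i (in_K A)) (in_top \<eta>) + ((-1) powi i) *\<^sub>R br i (j + 1) (in_K A) (d_mu j (in_top \<eta>))"
proof -
  have n1: "DIM('v) - 1 \<ge> 1" using dim by simp
  have "j + 1 = 1 - int (DIM('v) - 1)" using dim j by simp
  then have second: "br i (j + 1) (in_K A) (d_mu j (in_top \<eta>)) = in_K (nr_bracket k (DIM('v) - 1) A (d_top \<eta>))"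
    using br_K_K[OF A d_top_K[OF \<eta>] k n1] by (simp add: i j d_mu_in_top)
  show ?thesis
  proof (cases "k = 1")
    case True
    have "d_mu (i + j) (br i j (in_K A) (in_top \<eta>)) = in_K (d_top (top_bracket \<mu> A \<eta>))"
      using br_K_top[OF k, of A \<eta>] True i j by (simp add: d_mu_in_top)
    moreover have "br (i + 1) j (d_mu i (in_K A)) (in_top \<eta>) = 0"
      using True i br_pos(1) by simp
    moreover have "(-1::real) powi i = 1" using True i by simp
    ultimately show ?thesis
      using d_top_bracket[OF _ \<eta>, of A] A True by (simp add: second)
  next
    case False
    have "br i j (in_K A) (in_top \<eta>) = 0" using br_K_top_eq_0[OF A k _ \<eta>] False i j by simp
    moreover have "nr_bracket k (DIM('v) - 1) A (d_top \<eta>) = 0"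
      using False k dim by (intro sections_K_ge_dim[OF nr_bracket_K[OF A d_top_K[OF \<eta>]]]) simp
    moreover have "br (i + 1) j (d_mu i (in_K A)) (in_top \<eta>) = 0"
    proof -
      have "i + 1 = 1 - int (k - 1)" "k \<ge> 2" "k - 1 \<ge> 1" using False k i by auto
      then show ?thesis
        using br_K_top_eq_0[OF euler_K[OF A] _ _ \<eta>] rho_euler_K[OF A] d_mu_in_K[OF A] i j by auto
    qed
    ultimately show ?thesis by (simp add: second d_mu_zero)
  qed
qed

lemma d_br_top_K:
  fixes A :: "'v \<Rightarrow> 'v list \<Rightarrow> 'v"
  assumes A: "A \<in> sections (K k)" and k: "1 \<le> k" and \<eta>: "\<eta> \<in> sections (alt DIM('v))"
    and i: "i = 1 - int DIM('v)" and j: "j = 1 - int k"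
  shows "d_mu (i + j) (br i j (in_top \<eta>) (in_K A))
    = br (i + 1) j (d_mu i (in_top \<eta>)) (in_K A) + ((-1) powi i) *\<^sub>R br i (j + 1) (in_top \<eta>) (d_mu j (in_K A))"
proof -
  have n1: "DIM('v) - 1 \<ge> 1" using dim by simp
  have "i + 1 = 1 - int (DIM('v) - 1)" using dim i by simp
  then have first: "br (i + 1) j (d_mu i (in_top \<eta>)) (in_K A) = in_K (nr_bracket (DIM('v) - 1) k (d_top \<eta>) A)"
    using br_K_K[OF d_top_K[OF \<eta>] A n1 k] by (simp add: i j d_mu_in_top)
  show ?thesis
  proof (cases "k = 1")
    case True
    have top: "top_bracket \<mu> A \<eta> \<in> sections (alt DIM('v))"
      using A True smooth_rho_K by (intro top_bracket_sections \<eta>) auto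
    have "d_top (\<lambda>x. - top_bracket \<mu> A \<eta> x) = (\<lambda>x. - d_top (top_bracket \<mu> A \<eta>) x)"
      using sectionsD[OF top]
      by (simp add: fun_eq_iff d_top_eq(2) alt_minus contract_minus) (simp add: tens_def)
    moreover have "nr_bracket (DIM('v) - 1) k (d_top \<eta>) A = (\<lambda>x. - nr_bracket 1 (DIM('v) - 1) A (d_top \<eta>) x)"
      using nr_bracket_skew[of "DIM('v) - 1" k "d_top \<eta>" A] True by simp
    moreover have "d_mu (i + j) (br i j (in_top \<eta>) (in_K A)) = in_K (d_top (\<lambda>x. - top_bracket \<mu> A \<eta> x))"
      using br_top_K[OF k, of \<eta> A] True i j by (simp add: d_mu_in_top)
    moreover have "br i (j + 1) (in_top \<eta>) (d_mu j (in_K A)) = 0"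
      using True j br_pos(2) by simp
    ultimately show ?thesis
      using d_top_bracket[OF _ \<eta>, of A] A True by (simp add: first)
  next
    case False
    have "br i j (in_top \<eta>) (in_K A) = 0" using br_top_K_eq_0[OF A k _ \<eta>] False i j by simp
    moreover have "nr_bracket (DIM('v) - 1) k (d_top \<eta>) A = 0"
      using False k dim by (intro sections_K_ge_dim[OF nr_bracket_K[OF d_top_K[OF \<eta>] A]]) simp
    moreover have "br i (j + 1) (in_top \<eta>) (d_mu j (in_K A)) = 0"
    proof -
      have "j + 1 = 1 - int (k - 1)" "k \<ge> 2" "k - 1 \<ge> 1" using False k j by auto
      then show ?thesis
        using br_top_K_eq_0[OF euler_K[OF A] _ _ \<eta>] rho_euler_K[OF A] d_mu_in_K[OF A] i j by auto
    qed
    ultimately show ?thesis by (simp add: first d_mu_zero)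
  qed
qed

lemma d_br_top_top:
  assumes \<eta>: "\<eta> \<in> sections (alt DIM('v))" and \<theta>: "\<theta> \<in> sections (alt DIM('v))"
    and i: "i = 1 - int DIM('v)"
  shows "d_mu (i + i) (br i i (in_top \<eta>) (in_top \<theta>))
    = br (i + 1) i (d_mu i (in_top \<eta>)) (in_top \<theta>) + ((-1) powi i) *\<^sub>R br i (i + 1) (in_top \<eta>) (d_mu i (in_top \<theta>))"
proof -
  have i1: "i + 1 = 1 - int (DIM('v) - 1)" and n1: "DIM('v) - 1 \<ge> 1" using dim i by auto
  have "br (i + 1) i (d_mu i (in_top \<eta>)) (in_top \<theta>) = 0"
    using br_K_top_eq_0[OF d_top_K[OF \<eta>] n1 _ \<theta>] rho_d_top[OF \<eta>] unfolding i1 by (auto simp: i d_mu_in_top)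
  moreover have "br i (i + 1) (in_top \<eta>) (d_mu i (in_top \<theta>)) = 0"
    using br_top_K_eq_0[OF d_top_K[OF \<theta>] n1 _ \<eta>] rho_d_top[OF \<theta>] unfolding i1 by (auto simp: i d_mu_in_top)
  ultimately show ?thesis using br_top_top i by (simp add: d_mu_zero)
qed

lemma d_br:
  fixes a b :: "'v \<Rightarrow> 'v fibre"
  assumes a: "a \<in> sections (E_mu i)" and b: "b \<in> sections (E_mu j)"
  shows "d_mu (i + j) (br i j a b) = br (i + 1) j (d_mu i a) b + ((-1) powi i) *\<^sub>R br i (j + 1) a (d_mu j b)"
proof -
  have a0: ?thesis if "a = 0"
    using that br_zero_left[OF b] br_zero_left[OF d_mu_sections[OF dim b]] by (simp add: d_mu_zero)
  have b0: ?thesis if "b = 0"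
    using that br_zero_right[OF a] br_zero_right[OF d_mu_sections[OF dim a]] by (simp add: d_mu_zero)
  show ?thesis
    using a
  proof (cases rule: sections_E_mu_cases)
    case a: (K k A)
    from b show ?thesis
    proof (cases rule: sections_E_mu_cases)
      case b: (K l B)
      show ?thesis unfolding a(5) b(5) by (rule d_br_K_K[OF a(4) b(4) a(1) b(1) a(3) b(3)])
    next
      case b: (top \<eta>)
      show ?thesis unfolding a(5) b(3) by (rule d_br_K_top[OF a(4) a(1) b(2) a(3) b(1)])
    qed (rule b0)
  next
    case a: (top \<eta>)
    from b show ?thesis
    proof (cases rule: sections_E_mu_cases)
      case b: (K l B)
      show ?thesis unfolding a(3) b(5) by (rule d_br_top_K[OF b(4) b(1) a(2) a(1) b(3)])
    next
      case b: (top \<theta>)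
      have ji: "j = i" using a b by simp
      show ?thesis unfolding a(3) b(3) ji by (rule d_br_top_top[OF a(2) b(2) a(1)])
    qed (rule b0)
  qed (rule a0)
qed

lemma Jacobi_K:
  fixes A B C :: "'v \<Rightarrow> 'v list \<Rightarrow> 'v"
  assumes A: "A \<in> sections (K k)" and B: "B \<in> sections (K l)" and C: "C \<in> sections (K m)"
    and klm: "1 \<le> k" "1 \<le> l" "1 \<le> m" and ij: "i1 = 1 - int k" "i2 = 1 - int l" "i3 = 1 - int m"
  shows "br i1 (i2 + i3) (in_K A) (br i2 i3 (in_K B) (in_K C))
    = br (i1 + i2) i3 (br i1 i2 (in_K A) (in_K B)) (in_K C)
      + ((-1) powi (i1 * i2)) *\<^sub>R br i2 (i1 + i3) (in_K B) (br i1 i3 (in_K A) (in_K C))"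
proof -
  have s: "i2 + i3 = 1 - int (l + m - 1)" "i1 + i2 = 1 - int (k + l - 1)" "i1 + i3 = 1 - int (k + m - 1)"
    using ij klm by auto
  have g: "l + m - 1 \<ge> 1" "k + l - 1 \<ge> 1" "k + m - 1 \<ge> 1" using klm by auto
  have 1: "br i1 (i2 + i3) (in_K A) (br i2 i3 (in_K B) (in_K C)) = in_K (nr_bracket k (l + m - 1) A (nr_bracket l m B C))"
    unfolding s unfolding ij br_K_K[OF B C klm(2,3)] by (rule br_K_K[OF A nr_bracket_K[OF B C] klm(1) g(1)])
  have 2: "br (i1 + i2) i3 (br i1 i2 (in_K A) (in_K B)) (in_K C) = in_K (nr_bracket (k + l - 1) m (nr_bracket k l A B) C)"
    unfolding s unfolding ij br_K_K[OF A B klm(1,2)] by (rule br_K_K[OF nr_bracket_K[OF A B] C g(2) klm(3)])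
  have 3: "br i2 (i1 + i3) (in_K B) (br i1 i3 (in_K A) (in_K C)) = in_K (nr_bracket l (k + m - 1) B (nr_bracket k m A C))"
    unfolding s unfolding ij br_K_K[OF A C klm(1,3)] by (rule br_K_K[OF B nr_bracket_K[OF A C] klm(2) g(3)])
  have "nr_bracket k (l + m - 1) A (nr_bracket l m B C) = (\<lambda>x. nr_bracket (k + l - 1) m (nr_bracket k l A B) C x
      + (-1) ^ ((k - 1) * (l - 1)) *\<^sub>R nr_bracket l (k + m - 1) B (nr_bracket k m A C) x)"
    by (rule ext) (rule nr_bracket_Jacobi[OF sections_K_alt[OF A] sections_K_alt[OF B] sections_K_alt[OF C] klm])
  then show ?thesis
    unfolding 1 2 3 unfolding ij minus_one_powi_mult[OF klm(1,2)] by (simp add: in_K_scaleR in_K_add)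
qed


text \<open>The action on top forms, extended by zero to the elements of negative degree.\<close>

definition act_top :: "nat \<Rightarrow> ('v \<Rightarrow> 'v list \<Rightarrow> 'v) \<Rightarrow> ('v \<Rightarrow> 'v list \<Rightarrow> real) \<Rightarrow> 'v \<Rightarrow> 'v list \<Rightarrow> real"
  where "act_top k A \<eta> = (if k = 1 then top_bracket \<mu> A \<eta> else 0)"

lemma act_top_sections:
  assumes A: "A \<in> sections (K k)" and \<eta>: "\<eta> \<in> sections (alt DIM('v))"
  shows "act_top k A \<eta> \<in> sections (alt DIM('v))"
proof (cases "k = 1")
  case True
  then show ?thesis
    using top_bracket_sections[OF smooth_rho_K \<eta>, of A] A by (simp add: act_top_def)
next
  case False
  then show ?thesis by (simp add: act_top_def sections_alt_iff)
qed

lemma sections_alt_minus: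
  fixes \<eta> :: "'v \<Rightarrow> 'v list \<Rightarrow> real"
  shows "\<eta> \<in> sections (alt k) \<Longrightarrow> (\<lambda>x. - \<eta> x) \<in> sections (alt k)"
  using sections_alt_scale[of \<eta> k "-1"] by simp

lemma act_top_minus: "\<eta> \<in> sections (alt DIM('v)) \<Longrightarrow> act_top k A (\<lambda>x. - \<eta> x) = (\<lambda>x. - act_top k A \<eta> x)"
  by (simp add: act_top_def top_bracket_minus fun_eq_iff)

lemma act_top_zero: "act_top k A 0 = 0"
  by (simp add: act_top_def top_bracket_zero_right)

text \<open>A vanishing \<open>\<eta>\<close> is allowed in any degree \<open>j\<close>, since it arises as the bracket of a top form with an element
of negative degree.\<close>

lemma br_K_act_top:
  assumes A: "A \<in> sections (K k)" "1 \<le> k" and j: "j = 1 - int DIM('v) \<or> \<eta> = 0"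
  shows "br (1 - int k) j (in_K A) (in_top \<eta>) = in_top (act_top k A \<eta>)"
proof (cases "\<eta> = 0")
  case True
  then show ?thesis using br_zero_right[OF in_K_sections[OF A]] by (simp add: act_top_zero)
next
  case False
  then show ?thesis using br_K_top[OF A(2), of A \<eta>] j by (simp add: act_top_def)
qed

lemma br_act_top_K:
  assumes A: "A \<in> sections (K k)" "1 \<le> k" and j: "j = 1 - int DIM('v) \<or> \<eta> = 0"
  shows "br j (1 - int k) (in_top \<eta>) (in_K A) = in_top (\<lambda>x. - act_top k A \<eta> x)"
proof (cases "\<eta> = 0")
  case True
  then show ?thesis using br_zero_left[OF in_K_sections[OF A]] by (simp add: act_top_zero) (simp add: in_top_def fun_eq_iff zero_prod_def)
next
  case False
  then show ?thesis using br_top_K[OF A(2), of \<eta> A] j by (simp add: act_top_def) (simp add: in_top_def fun_eq_iff zero_prod_def)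
qed

text \<open>In degree 0 this is the commutator of vector fields acting on the coefficient function. If one of the
degrees is negative, so is that of the bracket, and all terms vanish.\<close>

lemma act_top_commutator:
  assumes A: "A \<in> sections (K k)" and B: "B \<in> sections (K l)" and kl: "1 \<le> k" "1 \<le> l"
    and \<eta>: "\<eta> \<in> sections (alt DIM('v))"
  shows "act_top k A (act_top l B \<eta>) x
    = act_top (k + l - 1) (nr_bracket k l A B) \<eta> x + act_top l B (act_top k A \<eta>) x"
proof (cases "k = 1 \<and> l = 1")
  case True
  then show ?thesis
    using top_bracket_commutator[OF _ _ \<eta>, of A B x] sections_K_alt[OF A] sections_K_alt[OF B]
    by (simp add: act_top_def)
next
  case False
  then have "k + l - 1 \<noteq> 1" using kl by linarith
  then show ?thesis using False by (auto simp: act_top_def top_bracket_zero_right)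
qed

lemma br_in_top_in_top:
  assumes "\<eta> \<in> sections (alt DIM('v))" "\<theta> \<in> sections (alt DIM('v))"
  shows "br i j (in_top \<eta>) (in_top \<theta>) = 0"
proof -
  have r: "rho (0 :: 'v \<Rightarrow> 'v list \<Rightarrow> 'v) = 0" by (simp add: rho_def fun_eq_iff)
  have z: "(\<lambda>x::'v. (0 :: 'v list \<Rightarrow> 'v)) = 0" by (simp add: fun_eq_iff)
  have "(0 :: 'v \<Rightarrow> 'v list \<Rightarrow> 'v) \<in> sections (alt l)" for l by (simp add: sections_alt_iff)
  from nr_bracket_zero_left[OF this] have "nr_bracket k l 0 0 = (0 :: 'v \<Rightarrow> 'v list \<Rightarrow> 'v)" for k l .
  then show ?thesis
    using top_bracket_zero_field[OF assms(1) r] top_bracket_zero_field[OF assms(2) r]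
    by (auto simp: bracket_mu_def Let_def in_top_def z fun_eq_iff zero_prod_def)
qed

lemma act_top_degree: "(1 - int k) * m = 0 \<or> act_top k A \<eta> = 0"
  by (simp add: act_top_def)

lemma Jacobi_K_K_top:
  fixes A B :: "'v \<Rightarrow> 'v list \<Rightarrow> 'v"
  assumes A: "A \<in> sections (K k)" and B: "B \<in> sections (K l)" and kl: "1 \<le> k" "1 \<le> l"
    and ij: "i1 = 1 - int k" "i2 = 1 - int l" "i3 = 1 - int DIM('v)" and \<eta>: "\<eta> \<in> sections (alt DIM('v))"
  shows "br i1 (i2 + i3) (in_K A) (br i2 i3 (in_K B) (in_top \<eta>))
    = br (i1 + i2) i3 (br i1 i2 (in_K A) (in_K B)) (in_top \<eta>)
      + ((-1) powi (i1 * i2)) *\<^sub>R br i2 (i1 + i3) (in_K B) (br i1 i3 (in_K A) (in_top \<eta>))"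
proof -
  have g: "k + l - 1 \<ge> 1" and s: "i1 + i2 = 1 - int (k + l - 1)" using ij kl by auto
  have "br i2 i3 (in_K B) (in_top \<eta>) = in_top (act_top l B \<eta>)"
    unfolding ij by (rule br_K_act_top[OF B kl(2)]) simp
  moreover have "br i1 (i2 + i3) (in_K A) (in_top (act_top l B \<eta>)) = in_top (act_top k A (act_top l B \<eta>))"
    unfolding ij(1) by (rule br_K_act_top[OF A kl(1)]) (auto simp: act_top_def ij)
  moreover have "br i1 i3 (in_K A) (in_top \<eta>) = in_top (act_top k A \<eta>)"
    unfolding ij by (rule br_K_act_top[OF A kl(1)]) simp
  moreover have "br i2 (i1 + i3) (in_K B) (in_top (act_top k A \<eta>)) = in_top (act_top l B (act_top k A \<eta>))"
    unfolding ij(2) by (rule br_K_act_top[OF B kl(2)]) (auto simp: act_top_def ij)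
  moreover have "br i1 i2 (in_K A) (in_K B) = in_K (nr_bracket k l A B)"
    unfolding ij by (rule br_K_K[OF A B kl])
  moreover have "br (i1 + i2) i3 (in_K (nr_bracket k l A B)) (in_top \<eta>) = in_top (act_top (k + l - 1) (nr_bracket k l A B) \<eta>)"
    unfolding s by (rule br_K_act_top[OF nr_bracket_K[OF A B] g]) (simp add: ij)
  moreover have "((-1) powi (i1 * i2)) *\<^sub>R in_top (act_top l B (act_top k A \<eta>)) = in_top (act_top l B (act_top k A \<eta>))"
    using act_top_degree[of l i1 B "act_top k A \<eta>"] unfolding ij by (auto simp: mult.commute)
  moreover have "act_top k A (act_top l B \<eta>)
      = (\<lambda>x. act_top (k + l - 1) (nr_bracket k l A B) \<eta> x + act_top l B (act_top k A \<eta>) x)"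
    by (rule ext) (rule act_top_commutator[OF A B kl \<eta>])
  ultimately show ?thesis by (simp add: in_top_add)
qed

lemma Jacobi_K_top_K:
  fixes A C :: "'v \<Rightarrow> 'v list \<Rightarrow> 'v"
  assumes A: "A \<in> sections (K k)" and C: "C \<in> sections (K m)" and km: "1 \<le> k" "1 \<le> m"
    and ij: "i1 = 1 - int k" "i2 = 1 - int DIM('v)" "i3 = 1 - int m" and \<eta>: "\<eta> \<in> sections (alt DIM('v))"
  shows "br i1 (i2 + i3) (in_K A) (br i2 i3 (in_top \<eta>) (in_K C))
    = br (i1 + i2) i3 (br i1 i2 (in_K A) (in_top \<eta>)) (in_K C)
      + ((-1) powi (i1 * i2)) *\<^sub>R br i2 (i1 + i3) (in_top \<eta>) (br i1 i3 (in_K A) (in_K C))"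
proof -
  have g: "k + m - 1 \<ge> 1" and s: "i1 + i3 = 1 - int (k + m - 1)" using ij km by auto
  let ?N = "nr_bracket k m A C"
  have "br i2 i3 (in_top \<eta>) (in_K C) = in_top (\<lambda>x. - act_top m C \<eta> x)"
    unfolding ij by (rule br_act_top_K[OF C km(2)]) simp
  moreover have "br i1 (i2 + i3) (in_K A) (in_top (\<lambda>x. - act_top m C \<eta> x)) = in_top (act_top k A (\<lambda>x. - act_top m C \<eta> x))"
    unfolding ij(1) by (rule br_K_act_top[OF A km(1)]) (auto simp: act_top_def ij fun_eq_iff)
  moreover have "br i1 i2 (in_K A) (in_top \<eta>) = in_top (act_top k A \<eta>)"
    unfolding ij by (rule br_K_act_top[OF A km(1)]) simp
  moreover have "br (i1 + i2) i3 (in_top (act_top k A \<eta>)) (in_K C) = in_top (\<lambda>x. - act_top m C (act_top k A \<eta>) x)"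
    unfolding ij(3) by (rule br_act_top_K[OF C km(2)]) (auto simp: act_top_def ij)
  moreover have "br i1 i3 (in_K A) (in_K C) = in_K ?N"
    unfolding ij by (rule br_K_K[OF A C km])
  moreover have "br i2 (i1 + i3) (in_top \<eta>) (in_K ?N) = in_top (\<lambda>x. - act_top (k + m - 1) ?N \<eta> x)"
    unfolding s by (rule br_act_top_K[OF nr_bracket_K[OF A C] g]) (simp add: ij)
  moreover have "((-1) powi (i1 * i2)) *\<^sub>R in_top (\<lambda>x. - act_top (k + m - 1) ?N \<eta> x) = in_top (\<lambda>x. - act_top (k + m - 1) ?N \<eta> x)"
  proof (cases "k = 1")
    case False
    then have "act_top (k + m - 1) ?N \<eta> = 0" using km by (simp add: act_top_def)
    then show ?thesis by (simp add: in_top_def fun_eq_iff)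
  qed (simp add: ij)
  moreover have "act_top k A (\<lambda>x. - act_top m C \<eta> x)
      = (\<lambda>x. - act_top m C (act_top k A \<eta>) x + - act_top (k + m - 1) ?N \<eta> x)"
    unfolding act_top_minus[OF act_top_sections[OF C \<eta>]]
    by (rule ext) (simp add: act_top_commutator[OF A C km \<eta>])
  ultimately show ?thesis by (simp add: in_top_add)
qed

lemma Jacobi_top_K_K:
  fixes B C :: "'v \<Rightarrow> 'v list \<Rightarrow> 'v"
  assumes B: "B \<in> sections (K l)" and C: "C \<in> sections (K m)" and lm: "1 \<le> l" "1 \<le> m"
    and ij: "i1 = 1 - int DIM('v)" "i2 = 1 - int l" "i3 = 1 - int m" and \<eta>: "\<eta> \<in> sections (alt DIM('v))"
  shows "br i1 (i2 + i3) (in_top \<eta>) (br i2 i3 (in_K B) (in_K C))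
    = br (i1 + i2) i3 (br i1 i2 (in_top \<eta>) (in_K B)) (in_K C)
      + ((-1) powi (i1 * i2)) *\<^sub>R br i2 (i1 + i3) (in_K B) (br i1 i3 (in_top \<eta>) (in_K C))"
proof -
  have g: "l + m - 1 \<ge> 1" and s: "i2 + i3 = 1 - int (l + m - 1)" using ij lm by auto
  let ?N = "nr_bracket l m B C"
  note sB = act_top_sections[OF B \<eta>] and sC = act_top_sections[OF C \<eta>]
  have "br i2 i3 (in_K B) (in_K C) = in_K ?N"
    unfolding ij by (rule br_K_K[OF B C lm])
  moreover have "br i1 (i2 + i3) (in_top \<eta>) (in_K ?N) = in_top (\<lambda>x. - act_top (l + m - 1) ?N \<eta> x)"
    unfolding s by (rule br_act_top_K[OF nr_bracket_K[OF B C] g]) (simp add: ij)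
  moreover have "br i1 i2 (in_top \<eta>) (in_K B) = in_top (\<lambda>x. - act_top l B \<eta> x)"
    unfolding ij by (rule br_act_top_K[OF B lm(1)]) simp
  moreover have "br (i1 + i2) i3 (in_top (\<lambda>x. - act_top l B \<eta> x)) (in_K C)
      = in_top (\<lambda>x. - act_top m C (\<lambda>x. - act_top l B \<eta> x) x)"
    unfolding ij(3) by (rule br_act_top_K[OF C lm(2)]) (auto simp: act_top_def ij fun_eq_iff)
  moreover have "br i1 i3 (in_top \<eta>) (in_K C) = in_top (\<lambda>x. - act_top m C \<eta> x)"
    unfolding ij by (rule br_act_top_K[OF C lm(2)]) simp
  moreover have "br i2 (i1 + i3) (in_K B) (in_top (\<lambda>x. - act_top m C \<eta> x)) = in_top (act_top l B (\<lambda>x. - act_top m C \<eta> x))"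
    unfolding ij(2) by (rule br_K_act_top[OF B lm(1)]) (auto simp: act_top_def ij fun_eq_iff)
  moreover have "((-1) powi (i1 * i2)) *\<^sub>R in_top (act_top l B (\<lambda>x. - act_top m C \<eta> x)) = in_top (act_top l B (\<lambda>x. - act_top m C \<eta> x))"
    using act_top_degree[of l i1 B "\<lambda>x. - act_top m C \<eta> x"] unfolding ij by (auto simp: mult.commute)
  moreover have "(\<lambda>x. - act_top (l + m - 1) ?N \<eta> x)
      = (\<lambda>x. - act_top m C (\<lambda>x. - act_top l B \<eta> x) x + act_top l B (\<lambda>x. - act_top m C \<eta> x) x)"
    unfolding act_top_minus[OF sB] act_top_minus[OF sC]
    by (rule ext) (simp add: act_top_commutator[OF B C lm \<eta>])
  ultimately show ?thesis by (simp add: in_top_add)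
qed

lemma br_top_cases:
  fixes a :: "'v \<Rightarrow> 'v fibre"
  assumes a: "a \<in> sections (E_mu i)" and \<eta>: "\<eta> \<in> sections (alt DIM('v))"
  obtains \<xi> \<zeta> where "\<xi> \<in> sections (alt DIM('v))" "br i (1 - int DIM('v)) a (in_top \<eta>) = in_top \<xi>"
    "\<zeta> \<in> sections (alt DIM('v))" "br (1 - int DIM('v)) i (in_top \<eta>) a = in_top \<zeta>"
  using a
proof (cases rule: sections_E_mu_cases)
  case (K k A)
  then show ?thesis
    using that[of "act_top k A \<eta>" "\<lambda>x. - act_top k A \<eta> x"] act_top_sections[OF K(4) \<eta>]
      br_K_act_top[OF K(4) K(1), of "1 - int DIM('v)" \<eta>] br_act_top_K[OF K(4) K(1), of "1 - int DIM('v)" \<eta>]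
    by (simp add: sections_alt_minus)
next
  case (top \<theta>)
  have "(0 :: 'v \<Rightarrow> 'v list \<Rightarrow> real) \<in> sections (alt DIM('v))" by (simp add: sections_alt_iff)
  then show ?thesis
    using that[of 0 0] br_in_top_in_top[OF top(2) \<eta>] br_in_top_in_top[OF \<eta> top(2)] top by simp
next
  case zero
  have "(0 :: 'v \<Rightarrow> 'v list \<Rightarrow> real) \<in> sections (alt DIM('v))" by (simp add: sections_alt_iff)
  then show ?thesis
    using that[of 0 0] br_zero_left[OF in_top_sections[OF \<eta>]] br_zero_right[OF in_top_sections[OF \<eta>]] zero by simp
qed

text \<open>If at least two arguments are top forms, all brackets vanish. The case of no top form is
\<open>nr_bracket_Jacobi\<close>, that of one top form is \<open>act_top_commutator\<close> up to graded antisymmetry.\<close>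

theorem Jacobi:
  fixes a b c :: "'v \<Rightarrow> 'v fibre"
  assumes a: "a \<in> sections (E_mu i)" and b: "b \<in> sections (E_mu j)" and c: "c \<in> sections (E_mu k)"
  shows "br i (j + k) a (br j k b c) = br (i + j) k (br i j a b) c + ((-1) powi (i * j)) *\<^sub>R br j (i + k) b (br i k a c)"
proof -
  note za = br_zero_right[OF a] br_zero_left[OF a]
  note zb = br_zero_right[OF b] br_zero_left[OF b]
  note zc = br_zero_right[OF c] br_zero_left[OF c]
  have a0: ?thesis if "a = 0"
    using that zb zc br_zero_left[OF br_closed[OF b c]] by simp
  have b0: ?thesis if "b = 0"
    using that za zc br_zero_left[OF br_closed[OF a c]] by simp
  have c0: ?thesis if "c = 0"
    using that za zb br_zero_right[OF br_closed[OF a b]] by simp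
  have bc_top: ?thesis if t: "j = 1 - int DIM('v)" "k = 1 - int DIM('v)" "b = in_top \<eta>" "c = in_top \<theta>"
    "\<eta> \<in> sections (alt DIM('v))" "\<theta> \<in> sections (alt DIM('v))" for \<eta> \<theta>
  proof -
    obtain \<xi> where \<xi>: "\<xi> \<in> sections (alt DIM('v))" "br i j a b = in_top \<xi>"
      using br_top_cases[OF a t(5)] t(1,3) by metis
    obtain \<zeta> where \<zeta>: "\<zeta> \<in> sections (alt DIM('v))" "br i k a c = in_top \<zeta>"
      using br_top_cases[OF a t(6)] t(2,4) by metis
    show ?thesis
      unfolding \<xi>(2) \<zeta>(2) unfolding t(3,4) br_in_top_in_top[OF t(5,6)] br_in_top_in_top[OF \<xi>(1) t(6)]
        br_in_top_in_top[OF t(5) \<zeta>(1)] za by simp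
  qed
  have ac_top: ?thesis if t: "i = 1 - int DIM('v)" "k = 1 - int DIM('v)" "a = in_top \<eta>" "c = in_top \<theta>"
    "\<eta> \<in> sections (alt DIM('v))" "\<theta> \<in> sections (alt DIM('v))" for \<eta> \<theta>
  proof -
    obtain \<xi> where \<xi>: "\<xi> \<in> sections (alt DIM('v))" "br i j a b = in_top \<xi>"
      using br_top_cases[OF b t(5)] t(1,3) by metis
    obtain \<zeta> where \<zeta>: "\<zeta> \<in> sections (alt DIM('v))" "br j k b c = in_top \<zeta>"
      using br_top_cases[OF b t(6)] t(2,4) by metis
    show ?thesis
      unfolding \<xi>(2) \<zeta>(2) unfolding t(3,4) br_in_top_in_top[OF t(5,6)] br_in_top_in_top[OF \<xi>(1) t(6)]
        br_in_top_in_top[OF t(5) \<zeta>(1)] zb by simp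
  qed
  have ab_top: ?thesis if t: "i = 1 - int DIM('v)" "j = 1 - int DIM('v)" "a = in_top \<eta>" "b = in_top \<theta>"
    "\<eta> \<in> sections (alt DIM('v))" "\<theta> \<in> sections (alt DIM('v))" for \<eta> \<theta>
  proof -
    obtain \<xi> where \<xi>: "\<xi> \<in> sections (alt DIM('v))" "br i k a c = in_top \<xi>"
      using br_top_cases[OF c t(5)] t(1,3) by metis
    obtain \<zeta> where \<zeta>: "\<zeta> \<in> sections (alt DIM('v))" "br j k b c = in_top \<zeta>"
      using br_top_cases[OF c t(6)] t(2,4) by metis
    show ?thesis
      unfolding \<xi>(2) \<zeta>(2) unfolding t(3,4) br_in_top_in_top[OF t(5,6)] br_in_top_in_top[OF t(5) \<zeta>(1)]
        br_in_top_in_top[OF t(6) \<xi>(1)] zc by simp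
  qed
  show ?thesis
    using a
  proof (cases rule: sections_E_mu_cases)
    case a: (K k' A)
    from b show ?thesis
    proof (cases rule: sections_E_mu_cases)
      case b: (K l B)
      from c show ?thesis
      proof (cases rule: sections_E_mu_cases)
        case c: (K m C)
        show ?thesis unfolding a(5) b(5) c(5)
          by (rule Jacobi_K[OF a(4) b(4) c(4) a(1) b(1) c(1) a(3) b(3) c(3)])
      next
        case c: (top \<eta>)
        show ?thesis unfolding a(5) b(5) c(3)
          by (rule Jacobi_K_K_top[OF a(4) b(4) a(1) b(1) a(3) b(3) c(1) c(2)])
      qed (rule c0)
    next
      case b: (top \<eta>)
      from c show ?thesis
      proof (cases rule: sections_E_mu_cases)
        case c: (K m C)
        show ?thesis unfolding a(5) b(3) c(5)
          by (rule Jacobi_K_top_K[OF a(4) c(4) a(1) c(1) a(3) b(1) c(3) b(2)])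
      next
        case c: (top \<theta>)
        show ?thesis by (rule bc_top[OF b(1) c(1) b(3) c(3) b(2) c(2)])
      qed (rule c0)
    qed (rule b0)
  next
    case a: (top \<eta>)
    from b show ?thesis
    proof (cases rule: sections_E_mu_cases)
      case b: (K l B)
      from c show ?thesis
      proof (cases rule: sections_E_mu_cases)
        case c: (K m C)
        show ?thesis unfolding a(3) b(5) c(5)
          by (rule Jacobi_top_K_K[OF b(4) c(4) b(1) c(1) a(1) b(3) c(3) a(2)])
      next
        case c: (top \<theta>)
        show ?thesis by (rule ac_top[OF a(1) c(1) a(3) c(3) a(2) c(2)])
      qed (rule c0)
    next
      case b: (top \<theta>)
      show ?thesis by (rule ab_top[OF a(1) b(1) a(3) b(3) a(2) b(2)])
    qed (rule b0)
  qed (rule a0)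
qed

lemma finite_dim_E_mu: "\<exists>B. finite B \<and> (E_mu i :: 'v fibre set) \<subseteq> span B"
proof -
  obtain B1 B2 where B1: "finite B1" "(alt (nat (1 - i)) :: ('v list \<Rightarrow> 'v) set) \<subseteq> span B1"
    and B2: "finite B2" "(alt DIM('v) :: ('v list \<Rightarrow> real) set) \<subseteq> span B2"
    using alt_finite_dim by metis
  have "E_mu i \<subseteq> span B1 \<times> span B2"
    using B1 B2 K_subset_alt[of "nat (1 - i)"] span_zero[of B1] span_zero[of B2]
    by (auto simp: E_mu_def zero_prod_def)
  also have "\<dots> \<subseteq> span ((\<lambda>u. (u, 0)) ` B1 \<union> (\<lambda>u. (0, u)) ` B2)"
  proof clarify
    fix u v assume u: "u \<in> span B1" and v: "v \<in> span B2"
    have l1: "linear (\<lambda>u. (u, 0))" and l2: "linear (\<lambda>u. (0, u))" by (auto intro!: linearI)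
    have "(u, 0) \<in> span ((\<lambda>u. (u, 0)) ` B1)" "(0, v) \<in> span ((\<lambda>u. (0, u)) ` B2)"
      using u v linear_span_image[OF l1] linear_span_image[OF l2] by blast+
    then have "(u, 0) + (0, v) \<in> span ((\<lambda>u. (u, 0)) ` B1 \<union> (\<lambda>u. (0, u)) ` B2)"
      by (intro span_add) (auto intro: subsetD[OF span_mono])
    then show "(u, v) \<in> span ((\<lambda>u. (u, 0)) ` B1 \<union> (\<lambda>u. (0, u)) ` B2)" by simp
  qed
  finally show ?thesis using B1 B2 by blast
qed

theorem dg_Lie_algebroid_mu: "dg_Lie_algebroid E_mu d_mu rho_mu br"
proof
  show "E_mu i = {0}" if "i > 0" for i using that dim by (auto simp: E_mu_def)
qed (use dim in \<open>auto intro: subspace_E_mu finite_dim_E_mu d_mu_linear d_mu_d_mu rho_mu_linear rho_mu_d_mu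
    br_closed br_add br_skew br_Leibniz anchor_br d_br Jacobi\<close>)

end


section \<open>The resolution\<close>

lemma eq_zero_by_continuity:
  fixes f :: "'v::euclidean_space \<Rightarrow> real"
  assumes "smooth f" "\<And>x. x \<noteq> 0 \<Longrightarrow> f x = 0"
  shows "f x = 0"
proof (cases "x = 0")
  case True
  have "(f \<longlongrightarrow> f 0) (at 0)"
    using smooth_imp_continuous_on[OF assms(1), of UNIV] by (simp add: continuous_on_def)
  moreover have "(f \<longlongrightarrow> 0) (at 0)"
    by (rule tendsto_eventually) (auto simp: eventually_at assms(2) intro!: exI[of _ 1])
  ultimately show ?thesis using tendsto_unique[OF at_neq_bot] True by blast
qed (rule assms(2))

text \<open>Off the origin \<open>\<iota>\<^sub>x\<eta> \<otimes> x = 0\<close> implies \<open>\<iota>\<^sub>x\<eta> = 0\<close>; as \<open>\<iota>\<^sub>x\<eta>\<close> is the trace of \<open>\<eta> \<otimes> x\<close>, this implies \<open>\<eta> = 0\<close>. Continuity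
extends this to the origin.\<close>

lemma d_top_injective:
  fixes \<eta> :: "'v::euclidean_space \<Rightarrow> 'v list \<Rightarrow> real"
  assumes \<eta>: "\<eta> \<in> sections (alt DIM('v))" and 0: "d_top \<eta> = 0"
  shows "\<eta> = 0"
proof (intro ext)
  fix x vs
  have zero: "\<eta> x = 0" if x: "x \<noteq> 0" for x
  proof -
    note \<eta>x = sectionsD[OF \<eta>, of x]
    have "tens (contract x (\<eta> x)) x = 0"
      using fun_cong[OF 0, of x] by (simp add: d_top_eq(2)[OF sectionsD[OF \<eta>]])
    then have "contract x (\<eta> x) = 0" using x by (simp add: tens_def fun_eq_iff)
    then have "tens (\<eta> x) x = 0"
      by (intro tr_eq_0_top tens_alt \<eta>x) (simp add: tr_tens[OF \<eta>x])
    then show ?thesis using x by (simp add: tens_def fun_eq_iff)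
  qed
  have "\<eta> x vs = 0" by (rule eq_zero_by_continuity[OF sections_smooth[OF \<eta>]]) (simp add: zero)
  then show "\<eta> x vs = 0 x vs" by simp
qed

lemma kernel_in_image:
  fixes A :: "'v::euclidean_space \<Rightarrow> 'v list \<Rightarrow> 'v"
  assumes A: "A \<in> sections (K k)" and k: "1 \<le> k" "k < DIM('v)" and 0: "euler A = 0"
  shows "in_K A \<in> d_mu (- int k) ` sections (E_mu (- int k))"
proof -
  obtain m where m: "k = Suc m" using k by (cases k) auto
  note A = A[unfolded m]
  show ?thesis
  proof (cases "Suc (Suc m) = DIM('v)")
    case True
    then obtain \<eta> where \<eta>: "\<eta> \<in> sections (alt DIM('v))" "d_top \<eta> = A"
      using koszul_exact_K_top[OF A 0] by blast
    have "- int k = 1 - int DIM('v)" using True m by simp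
    then show ?thesis using in_top_sections[OF \<eta>(1)] d_mu_in_top[of \<eta>] \<eta>(2) by (metis image_eqI)
  next
    case False
    then obtain B where B: "B \<in> sections (K (Suc (Suc m)))" "euler B = A"
      using koszul_exact_K[OF A 0] k m by auto
    have "- int k = 1 - int (Suc (Suc m))" using m by simp
    then show ?thesis using in_K_sections[OF B(1)] d_mu_in_K[OF B(1)] B(2)
      by (intro image_eqI[of _ _ "in_K B"]) simp_all
  qed
qed

lemma is_resolution_mu:
  assumes dim: "DIM('v) \<ge> 2"
  shows "is_resolution E_mu d_mu rho_mu (F_mu :: ('v::euclidean_space \<Rightarrow> 'v) set)"
  unfolding is_resolution_def
proof (intro conjI allI impI)
  have E0: "(E_mu 0 :: 'v fibre set) = K 1 \<times> {0}" using dim by (simp add: E_mu_def)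
  have s0: "sections (E_mu 0) = (in_K :: ('v \<Rightarrow> 'v list \<Rightarrow> 'v) \<Rightarrow> _) ` sections (K 1)"
  proof (intro equalityI subsetI)
    fix a assume "a \<in> (sections (E_mu 0) :: ('v \<Rightarrow> 'v fibre) set)"
    then show "a \<in> in_K ` sections (K 1)"
      by (cases rule: sections_E_mu_cases) (use dim in auto)
  qed (auto simp: E0 sections_Times_left in_K_def)
  show "rho_mu ` sections (E_mu 0) = (F_mu :: ('v \<Rightarrow> 'v) set)"
    unfolding s0 F_mu_def K_1 image_image rho_mu_in_K ..
  show "{a \<in> sections (E_mu 0). rho_mu a = 0} = d_mu (- 1) ` (sections (E_mu (- 1)) :: ('v \<Rightarrow> 'v fibre) set)"
  proof (intro equalityI subsetI)
    fix a assume "a \<in> {a \<in> sections (E_mu 0 :: 'v fibre set). rho_mu a = 0}"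
    then obtain A where A: "A \<in> sections (K 1)" "a = in_K A" "rho A = 0"
      unfolding s0 by (auto simp: rho_mu_in_K)
    note A' = sections_K_alt[OF A(1)]
    have "euler A = 0"
    proof (rule ext, rule form_eqI)
      fix x
      show "euler A x [] = 0 x []" using A(3) rho_euler[OF A'] by (simp add: fun_eq_iff)
      have "euler A x \<in> alt 0" using sectionsD[OF euler_sections[OF A']] by simp
      then show "contract v (euler A x) = contract v (0 x)" for v by (simp add: contract_alt_0)
    qed
    then show "a \<in> d_mu (- 1) ` sections (E_mu (- 1))"
      using kernel_in_image[OF A(1)] A(2) dim by simp
  next
    fix a assume "a \<in> d_mu (- 1) ` (sections (E_mu (- 1)) :: ('v \<Rightarrow> 'v fibre) set)"
    then show "a \<in> {a \<in> sections (E_mu 0). rho_mu a = 0}"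
      using rho_mu_d_mu[OF dim] d_mu_sections[OF dim, of _ "-1"] by auto
  qed
  fix i :: int assume i: "i < 0"
  show "{a \<in> sections (E_mu i). d_mu i a = 0} = d_mu (i - 1) ` (sections (E_mu (i - 1)) :: ('v \<Rightarrow> 'v fibre) set)"
  proof (intro equalityI subsetI)
    fix a :: "'v \<Rightarrow> 'v fibre" assume "a \<in> {a \<in> sections (E_mu i). d_mu i a = 0}"
    then have a: "a \<in> sections (E_mu i)" and da: "d_mu i a = 0" by auto
    have zero: "0 \<in> d_mu (i - 1) ` (sections (E_mu (i - 1)) :: ('v \<Rightarrow> 'v fibre) set)"
      using d_mu_zero zero_sections_E_mu by (metis image_eqI)
    show "a \<in> d_mu (i - 1) ` sections (E_mu (i - 1))"
      using a
    proof (cases rule: sections_E_mu_cases)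
      case (K k A)
      then have "euler A = 0" using da d_mu_in_K[OF K(4)] i by simp
      moreover have "i - 1 = - int k" using K by simp
      ultimately show ?thesis using kernel_in_image[OF K(4,1,2)] K(5) by simp
    next
      case (top \<eta>)
      then have "\<eta> = 0" using da d_mu_in_top[of \<eta>] d_top_injective[OF top(2)] by simp
      then show ?thesis using top zero by simp
    qed (use zero in simp)
  next
    fix a assume "a \<in> d_mu (i - 1) ` (sections (E_mu (i - 1)) :: ('v \<Rightarrow> 'v fibre) set)"
    then show "a \<in> {a \<in> sections (E_mu i). d_mu i a = 0}"
      using d_mu_d_mu[OF dim, of _ "i - 1"] d_mu_sections[OF dim, of _ "i - 1"] by auto
  qed
qed

lemma minimal_at_0: "minimal_at (E_mu :: int \<Rightarrow> 'v::euclidean_space fibre set) d_mu 0"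
  unfolding minimal_at_def
proof (intro allI ballI)
  fix i and a :: "'v \<Rightarrow> 'v fibre" assume "a \<in> sections (E_mu i)"
  then show "d_mu i a 0 = 0"
  proof (cases rule: sections_E_mu_cases)
    case (K k A)
    then show ?thesis by (auto simp: d_mu_def in_K_def euler_def zero_prod_def)
  next
    case (top \<eta>)
    have "d_top \<eta> 0 = 0"
      unfolding d_top_eq(2)[OF sectionsD[OF top(2)]] by (simp add: tens_def fun_eq_iff)
    then show ?thesis using top d_mu_in_top[of \<eta>] by (simp add: in_K_def zero_prod_def)
  next
    case zero
    then show ?thesis by (simp add: d_mu_zero)
  qed
qed

theorem proposition2p8:
  fixes \<mu> :: "'v::euclidean_space list \<Rightarrow> real"
  assumes "DIM('v) \<ge> 2"
    and "\<mu> \<in> alt DIM('v)"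
    and "\<mu> \<noteq> 0"
  shows "dg_Lie_algebroid E_mu d_mu rho_mu (bracket_mu \<mu>) \<and>
    universal_Linf_algebroid E_mu d_mu rho_mu (bracket_mu \<mu>) F_mu \<and>
    minimal_at (E_mu :: int \<Rightarrow> 'v fibre set) d_mu 0"
proof -
  interpret volume_form \<mu>
    using assms by unfold_locales
  show ?thesis
    using dg_Lie_algebroid_mu is_resolution_mu[OF assms(1)] minimal_at_0
    by (simp add: universal_Linf_algebroid_def)
qed

end
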